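(* Assume that the continuous Cauchy problem $$-\epsilon\Delta u+\mathbf b\cdot\nabla u=f\ \text{ in }\Omega,\qquad u=g_1,\quad \nabla u\cdot\mathbf n=g_2\ \text{ on }\Gamma_1$$ admits a unique solution. Then the least-squares weak Galerkin (LS-WG) finite element scheme find $u_h=\{u_0,u_b,\mathbf u_g\}\in W_h$ satisfying $u_b=Q_bg_1$ and $\mathbf u_g\cdot\mathbf n=Q_ng_2$ on $\Gamma_1$, such that $$a(u_h,v_h)=\sum_{T\in\mathcal T_h}(f,-\epsilon\Delta_w v_h+\mathbf b\cdot\nabla_w v_h)_T\qquad\forall v_h\in W_h^0,$$ possesses a unique solution $u_h\in W_h$.
   Context: Domain and data. $\Omega\subset\mathbb R^d$ ($d=2,3$) is an open, bounded, convex polytopal domain with unit outward normal $\mathbf n$. Its boundary is partitioned into two disjoint relatively open subsets $\Gamma_1,\Gamma_2$ with $\partial\Omega=\overline\Gamma_1\cup\overline\Gamma_2$ and $|\Gamma_1|>0$. The diffusion coefficient $\epsilon>0$ is constant and $\mathbf b\in[L^\infty(\Omega)]^d$. The data $f,g_1,g_2$ are assumed sufficiently regular to ensure the well-posedness of the corresponding discrete formulation. $(\cdot,\cdot)_T$ and $\langle\cdot,\cdot\rangle_{\partial T}$ are the $L^2$ inner products on $T$ and $\partial T$; on $\partial T$, $\mathbf n$ is the outward unit normal to $T$. Mesh. $\mathcal T_h$ is a partition of $\Omega$ into polygonal (2D) or polyhedral (3D) elements, shape-regular in the usual sense of weak Galerkin methods on polytopal meshes. $\mathcal E_h$ is the set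 of all edges (faces in 3D) of $\mathcal T_h$, and $\mathcal E_h^0=\mathcal E_h\setminus\partial\Omega$ is the set of interior ones. $h_T$ is the diameter of $T$. Discrete spaces. $k\ge1$ is a given integer and $P_r$ denotes polynomials of degree at most $r$. For $T\in\mathcal T_h$, $$W_k(T)=\{v=\{v_0,v_b,\mathbf v_g\}:\ v_0\in P_k(T),\ v_b\in P_k(e),\ \mathbf v_g\in[P_{k-1}(e)]^d,\ e\subset\partial T\},$$ where $v_b$ and $\mathbf v_g$ (representing the values of $v$ and of $\nabla v$ on $\partial T$) are not required to be the traces of $v_0$ and $\nabla v_0$. The global space $W_h$ is constructed by patching the local spaces $W_k(T)$ across interior edges such that $v_b$ is single-valued on each $e\in\mathcal E_h$. The subspace with vanishing Cauchy data is $$W_h^0=\{v=\{v_0,v_b,\mathbf v_g\}\in W_h:\ v_b|_e=0,\ \mathbf v_g\cdot\mathbf n|_e=0,\ e\subset\Gamma_1\}.$$ Weak operators. For $v\in W_h$ and $T\in\mathcal T_h$, the discrete weak Laplacian $\Delta_wv|_T\in P_{k-1}(T)$ and the discrete weak gradient $\nabla_wv|_T\in[P_{k-1}(T)]^d$ are defined by $$(\Delta_wv,w)_T=(v_0,\Delta w)_T-\langle v_b,\nabla w\cdot\mathbf n\rangle_{\partial T}+\langle\mathbf v_g\cdot\mathbf n,w\rangle_{\partial T}\quad\forall w\in P_{k-1}(T),$$ $$(\nabla_wv,\boldsymbol\psi)_T=-(v_0,\nabla\cdot\boldsymbol\psi)_T+\langle v_b,\boldsymbol\psi\cdot\mathbf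 n\rangle_{\partial T}\quad\forall\boldsymbol\psi\in[P_{k-1}(T)]^d.$$ Bilinear forms. For $u,v\in W_h$, $$s(u,v)=\sum_{T\in\mathcal T_h}\Big(h_T^{-3}\langle u_0-u_b,v_0-v_b\rangle_{\partial T}+h_T^{-1}\langle(\nabla u_0-\mathbf u_g)\cdot\mathbf n,(\nabla v_0-\mathbf v_g)\cdot\mathbf n\rangle_{\partial T}\Big),$$ $$a(u,v)=\sum_{T\in\mathcal T_h}(-\epsilon\Delta_wu+\mathbf b\cdot\nabla_wu,\,-\epsilon\Delta_wv+\mathbf b\cdot\nabla_wv)_T+s(u,v).$$ Projections. $Q_b:L^2(e)\to P_k(e)$ and $Q_n:L^2(e)\to P_{k-1}(e)$ are the $L^2$ projections on each edge $e$.
   Formalization: Uniqueness is proved up to the tangential part of u_g, which the scheme never sees (u_0, u_b and u_g·n are unique); v_g as well as v_b is taken single-valued on each edge, and each boundary edge is assumed to lie in Γ_1 or in Γ_2. *)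

theory Defs
  imports "HOL-Analysis.Analysis"
begin

section \<open>Polynomials and classical derivatives\<close>

definition poly_fun :: "nat \<Rightarrow> (real^'d \<Rightarrow> real) set" where
  "poly_fun r = {p. \<exists>c. p = (\<lambda>x. \<Sum>\<alpha>\<in>{\<alpha>::'d \<Rightarrow> nat. (\<Sum>i\<in>UNIV. \<alpha> i) \<le> r}.
      c \<alpha> * (\<Prod>i\<in>UNIV. (x $ i) ^ \<alpha> i))}"

definition vec_poly_fun :: "nat \<Rightarrow> (real^'d \<Rightarrow> real^'d) set" where
  "vec_poly_fun r = {q. \<forall>i. (\<lambda>x. q x $ i) \<in> poly_fun r}"

text \<open>Polynomials on a flat set are the restrictions of polynomials in the ambient coordinates,
  represented as extensional functions so that equality is equality on the set.\<close>

definition poly_on :: "nat \<Rightarrow> (real^'d) set \<Rightarrow> (real^'d \<Rightarrow> real) set" where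
  "poly_on r e = (\<lambda>p. restrict p e) ` poly_fun r"

definition vec_poly_on :: "nat \<Rightarrow> (real^'d) set \<Rightarrow> (real^'d \<Rightarrow> real^'d) set" where
  "vec_poly_on r e = (\<lambda>q. restrict q e) ` vec_poly_fun r"

definition partial_deriv :: "'d \<Rightarrow> (real^'d \<Rightarrow> real) \<Rightarrow> real^'d \<Rightarrow> real" where
  "partial_deriv i \<phi> x = frechet_derivative \<phi> (at x) (axis i 1)"

definition grad :: "(real^'d \<Rightarrow> real) \<Rightarrow> real^'d \<Rightarrow> real^'d" where
  "grad \<phi> x = (\<chi> i. partial_deriv i \<phi> x)"

definition divergence :: "(real^'d \<Rightarrow> real^'d) \<Rightarrow> real^'d \<Rightarrow> real" where
  "divergence \<psi> x = (\<Sum>i\<in>UNIV. partial_deriv i (\<lambda>y. \<psi> y $ i) x)"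

definition laplacian :: "(real^'d \<Rightarrow> real) \<Rightarrow> real^'d \<Rightarrow> real" where
  "laplacian \<phi> x = (\<Sum>i\<in>UNIV. partial_deriv i (partial_deriv i \<phi>) x)"


section \<open>Surface measure and normals\<close>

text \<open>The \<open>(d-1)\<close>-dimensional Lebesgue measure on a Borel set \<open>S\<close> that spans a hyperplane with unit
  normal \<open>n\<close>: the measure of \<open>A\<close> is the volume of the slab of height one over \<open>S \<inter> A\<close>.  It lives on
  the whole space and is concentrated on \<open>S\<close>; it does not depend on the choices of the sign of \<open>n\<close>
  and of the base point \<open>p\<close>, and it is the zero measure for the empty set.\<close>

definition flat_measure :: "(real^'d) set \<Rightarrow> (real^'d) measure" where
  "flat_measure S =
    (let n = (SOME n. norm n = 1 \<and> (\<forall>x\<in>S. \<forall>y\<in>S. n \<bullet> (x - y) = 0));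
         p = (SOME p. p \<in> S);
         \<pi> = (\<lambda>y. y - (n \<bullet> (y - p)) *\<^sub>R n)
     in completion
          (distr (restrict_space lborel {y. \<pi> y \<in> S \<and> 0 \<le> n \<bullet> (y - p) \<and> n \<bullet> (y - p) \<le> 1}) borel \<pi>))"

definition surface_area :: "(real^'d) set \<Rightarrow> (real^'d) set \<Rightarrow> ennreal" where
  "surface_area \<Omega> \<Gamma> = (\<Sum>F\<in>{F. F facet_of closure \<Omega>}. emeasure (flat_measure (\<Gamma> \<inter> F)) UNIV)"

definition is_outward_normal :: "(real^'d) set \<Rightarrow> (real^'d) set \<Rightarrow> real^'d \<Rightarrow> bool" where
  "is_outward_normal T e n \<longleftrightarrow>
     norm n = 1 \<and> (\<forall>x\<in>e. \<forall>y\<in>e. n \<bullet> (x - y) = 0) \<and>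
     (\<forall>x\<in>rel_interior e. \<exists>\<delta>>0. \<forall>t. 0 < t \<and> t < \<delta> \<longrightarrow>
        x - t *\<^sub>R n \<in> interior T \<and> x + t *\<^sub>R n \<notin> T)"

definition outward_normal :: "(real^'d) set \<Rightarrow> (real^'d) set \<Rightarrow> real^'d" where
  "outward_normal T e = (THE n. is_outward_normal T e n)"


section \<open>Sobolev functions, traces and the continuous Cauchy problem\<close>

definition L2_fun :: "'a measure \<Rightarrow> ('a \<Rightarrow> real) \<Rightarrow> bool" where
  "L2_fun M g \<longleftrightarrow> g \<in> borel_measurable M \<and> integrable M (\<lambda>x. (g x)\<^sup>2)"

definition Linf_vec :: "'a measure \<Rightarrow> ('a \<Rightarrow> real^'d) \<Rightarrow> bool" where
  "Linf_vec M b \<longleftrightarrow> b \<in> borel_measurable M \<and> (\<exists>C. AE x in M. norm (b x) \<le> C)"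

text \<open>First-order weak derivatives are tested, as in Gilbarg--Trudinger, with compactly supported
  \<open>C\<^sup>1\<close> functions.\<close>

definition test_fun :: "(real^'d) set \<Rightarrow> (real^'d \<Rightarrow> real) \<Rightarrow> bool" where
  "test_fun \<Omega> \<phi> \<longleftrightarrow>
     (\<forall>x. \<phi> differentiable (at x)) \<and> (\<forall>i. continuous_on UNIV (partial_deriv i \<phi>)) \<and>
     (\<exists>K. compact K \<and> K \<subseteq> \<Omega> \<and> (\<forall>x. x \<notin> K \<longrightarrow> \<phi> x = 0))"

text \<open>\<open>u \<in> H\<^sup>1(\<Omega>)\<close> with weak gradient \<open>G\<close>.\<close>

definition H1_grad :: "(real^'d) set \<Rightarrow> (real^'d \<Rightarrow> real) \<Rightarrow> (real^'d \<Rightarrow> real^'d) \<Rightarrow> bool" where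
  "H1_grad \<Omega> u G \<longleftrightarrow>
     L2_fun (lebesgue_on \<Omega>) u \<and> (\<forall>i. L2_fun (lebesgue_on \<Omega>) (\<lambda>x. G x $ i)) \<and>
     (\<forall>i \<phi>. test_fun \<Omega> \<phi> \<longrightarrow>
        (\<integral>x. u x * partial_deriv i \<phi> x \<partial>lebesgue_on \<Omega>)
          = - (\<integral>x. G x $ i * \<phi> x \<partial>lebesgue_on \<Omega>))"

text \<open>\<open>u \<in> H\<^sup>2(\<Omega>)\<close> with weak gradient \<open>G\<close> and weak Hessian \<open>H\<close>.\<close>

definition H2_grad_hess ::
  "(real^'d) set \<Rightarrow> (real^'d \<Rightarrow> real) \<Rightarrow> (real^'d \<Rightarrow> real^'d) \<Rightarrow> (real^'d \<Rightarrow> real^'d^'d) \<Rightarrow> bool" where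
  "H2_grad_hess \<Omega> u G H \<longleftrightarrow>
     H1_grad \<Omega> u G \<and> (\<forall>i. H1_grad \<Omega> (\<lambda>x. G x $ i) (\<lambda>x. H x $ i))"

text \<open>The trace on a flat boundary piece \<open>S\<close>: the restriction operator on
  \<open>H\<^sup>1(\<Omega>) \<inter> C(closure \<Omega>)\<close>, extended by continuity from \<open>H\<^sup>1(\<Omega>)\<close> to \<open>L\<^sup>2(S)\<close>.\<close>

definition has_trace :: "(real^'d) set \<Rightarrow> (real^'d) set \<Rightarrow> (real^'d \<Rightarrow> real) \<Rightarrow> (real^'d \<Rightarrow> real) \<Rightarrow> bool" where
  "has_trace \<Omega> S u g \<longleftrightarrow>
     L2_fun (flat_measure S) g \<and>
     (\<exists>G \<phi> \<Phi>. H1_grad \<Omega> u G \<and>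
        (\<forall>m::nat. continuous_on (closure \<Omega>) (\<phi> m) \<and> H1_grad \<Omega> (\<phi> m) (\<Phi> m)) \<and>
        (\<lambda>m. \<integral>x. (\<phi> m x - u x)\<^sup>2 + (norm (\<Phi> m x - G x))\<^sup>2 \<partial>lebesgue_on \<Omega>) \<longlonglongrightarrow> 0 \<and>
        (\<lambda>m. \<integral>x. (\<phi> m x - g x)\<^sup>2 \<partial>flat_measure S) \<longlonglongrightarrow> 0)"

text \<open>Strong (\<open>H\<^sup>2\<close>) solutions; on each facet \<open>F\<close> of the polytope the normal is constant, and the
  Neumann datum is the trace of \<open>\<nabla>u \<bullet> n\<close> on \<open>\<Gamma> \<inter> F\<close>.\<close>

definition cauchy_solution ::
  "(real^'d) set \<Rightarrow> (real^'d) set \<Rightarrow> real \<Rightarrow> (real^'d \<Rightarrow> real^'d) \<Rightarrow> (real^'d \<Rightarrow> real) \<Rightarrow>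
   (real^'d \<Rightarrow> real) \<Rightarrow> (real^'d \<Rightarrow> real) \<Rightarrow> (real^'d \<Rightarrow> real) \<Rightarrow> bool" where
  "cauchy_solution \<Omega> \<Gamma> \<epsilon> b f g\<^sub>1 g\<^sub>2 u \<longleftrightarrow>
     (\<exists>G H. H2_grad_hess \<Omega> u G H \<and>
        (AE x in lebesgue_on \<Omega>. - \<epsilon> * (\<Sum>i\<in>UNIV. H x $ i $ i) + b x \<bullet> G x = f x) \<and>
        (\<forall>F. F facet_of closure \<Omega> \<longrightarrow>
           has_trace \<Omega> (\<Gamma> \<inter> F) u g\<^sub>1 \<and>
           has_trace \<Omega> (\<Gamma> \<inter> F) (\<lambda>x. G x \<bullet> outward_normal (closure \<Omega>) F) g\<^sub>2))"

definition cauchy_uniquely_solvable ::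
  "(real^'d) set \<Rightarrow> (real^'d) set \<Rightarrow> real \<Rightarrow> (real^'d \<Rightarrow> real^'d) \<Rightarrow> (real^'d \<Rightarrow> real) \<Rightarrow>
   (real^'d \<Rightarrow> real) \<Rightarrow> (real^'d \<Rightarrow> real) \<Rightarrow> bool" where
  "cauchy_uniquely_solvable \<Omega> \<Gamma> \<epsilon> b f g\<^sub>1 g\<^sub>2 \<longleftrightarrow>
     (\<exists>u. cauchy_solution \<Omega> \<Gamma> \<epsilon> b f g\<^sub>1 g\<^sub>2 u \<and>
        (\<forall>w. cauchy_solution \<Omega> \<Gamma> \<epsilon> b f g\<^sub>1 g\<^sub>2 w \<longrightarrow> (AE x in lebesgue_on \<Omega>. w x = u x)))"


section \<open>Polytopal meshes\<close>

text \<open>Closed, possibly nonconvex, polyhedral cells of any dimension: elements when full-dimensional,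
  edges (faces in 3D) when of codimension one.\<close>

definition polyhedral_cell :: "(real^'d) set \<Rightarrow> bool" where
  "polyhedral_cell S \<longleftrightarrow>
     (\<exists>\<P>. finite \<P> \<and> (\<forall>P\<in>\<P>. polytope P) \<and> S = \<Union>\<P>) \<and>
     S \<noteq> {} \<and> S = closure (rel_interior S) \<and> connected (rel_interior S)"

definition edges_of :: "(real^'d) set set \<Rightarrow> (real^'d) set \<Rightarrow> (real^'d) set set" where
  "edges_of \<E> T = {e\<in>\<E>. e \<subseteq> frontier T}"

text \<open>Hanging nodes count as vertices, i.e. a flat side of an element may consist of several mesh
  edges; an interior mesh edge is then a common edge of the elements on its two sides.\<close>

definition polytopal_mesh :: "(real^'d) set \<Rightarrow> (real^'d) set set \<Rightarrow> (real^'d) set set \<Rightarrow> bool" where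
  "polytopal_mesh \<Omega> \<T> \<E> \<longleftrightarrow>
     finite \<T> \<and> \<Union>\<T> = closure \<Omega> \<and>
     (\<forall>T\<in>\<T>. polyhedral_cell T \<and> aff_dim T = int CARD('d)) \<and>
     (\<forall>T\<in>\<T>. \<forall>T'\<in>\<T>. T \<noteq> T' \<longrightarrow> interior T \<inter> interior T' = {}) \<and>
     finite \<E> \<and>
     (\<forall>e\<in>\<E>. polyhedral_cell e \<and> aff_dim e = int CARD('d) - 1) \<and>
     (\<forall>e\<in>\<E>. \<forall>e'\<in>\<E>. e \<noteq> e' \<longrightarrow> rel_interior e \<inter> rel_interior e' = {}) \<and>
     (\<forall>T\<in>\<T>. frontier T = \<Union>(edges_of \<E> T)) \<and>
     (\<forall>e\<in>\<E>. \<exists>T\<in>\<T>. e \<in> edges_of \<E> T) \<and>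
     (\<forall>T\<in>\<T>. \<forall>e\<in>edges_of \<E> T. \<exists>n. is_outward_normal T e n)"

definition mesh_resolves_boundary ::
  "(real^'d) set \<Rightarrow> (real^'d) set \<Rightarrow> (real^'d) set \<Rightarrow> (real^'d) set set \<Rightarrow> bool" where
  "mesh_resolves_boundary \<Omega> \<Gamma>\<^sub>1 \<Gamma>\<^sub>2 \<E> \<longleftrightarrow>
     (\<forall>e\<in>\<E>. e \<subseteq> frontier \<Omega> \<longrightarrow> rel_interior e \<subseteq> \<Gamma>\<^sub>1 \<or> rel_interior e \<subseteq> \<Gamma>\<^sub>2)"

text \<open>Since mesh edges are closed and boundary parts relatively open, \<open>e \<subset> \<Gamma>\<close> refers to the
  relative interior.\<close>

definition edges_in :: "(real^'d) set set \<Rightarrow> (real^'d) set \<Rightarrow> (real^'d) set set" where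
  "edges_in \<E> \<Gamma> = {e\<in>\<E>. rel_interior e \<subseteq> \<Gamma>}"

text \<open>The shape-regularity conditions of Wang and Ye for weak Galerkin methods: (A1) elements and edges
  have volume comparable to the powers of their diameters, (A2) edges are not small compared to
  elements, (A3) over every edge an element contains a pyramid of comparable height standing up on
  the edge, (A4) elements have comparable, shape-regular circumscribed simplices of finite overlap.\<close>

definition shape_regular ::
  "real \<Rightarrow> real \<Rightarrow> real \<Rightarrow> real \<Rightarrow> real \<Rightarrow> real \<Rightarrow> real \<Rightarrow> nat \<Rightarrow> (real^'d) set set \<Rightarrow> (real^'d) set set \<Rightarrow> bool" where
  "shape_regular \<rho>\<^sub>v \<rho>\<^sub>e \<kappa> \<sigma> \<theta> \<gamma> \<rho>\<^sub>s N \<T> \<E> \<longleftrightarrow>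
     0 < \<rho>\<^sub>v \<and> 0 < \<rho>\<^sub>e \<and> 0 < \<kappa> \<and> 0 < \<sigma> \<and> 0 \<le> \<theta> \<and> \<theta> < pi / 2 \<and> 0 < \<gamma> \<and> 0 < \<rho>\<^sub>s \<and>
     (\<forall>T\<in>\<T>. \<rho>\<^sub>v * diameter T ^ CARD('d) \<le> measure lebesgue T) \<and>
     (\<forall>e\<in>\<E>. \<rho>\<^sub>e * diameter e ^ (CARD('d) - 1) \<le> measure (flat_measure e) UNIV) \<and>
     (\<forall>T\<in>\<T>. \<forall>e\<in>edges_of \<E> T. \<kappa> * diameter T \<le> diameter e) \<and>
     (\<forall>T\<in>\<T>. \<forall>e\<in>edges_of \<E> T. \<exists>A\<in>T. \<forall>x\<in>e.
        closed_segment A x \<subseteq> T \<and>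
        \<sigma> * diameter T \<le> outward_normal T e \<bullet> (x - A) \<and>
        cos \<theta> * norm (x - A) \<le> outward_normal T e \<bullet> (x - A)) \<and>
     (\<exists>S. (\<forall>T\<in>\<T>. int CARD('d) simplex S T \<and> T \<subseteq> S T \<and>
              diameter (S T) \<le> \<gamma> * diameter T \<and>
              (\<exists>c. cball c (\<rho>\<^sub>s * diameter (S T)) \<subseteq> S T) \<and>
              card {T'\<in>\<T>. S T \<inter> S T' \<noteq> {}} \<le> N))"


section \<open>Weak Galerkin spaces and weak operators\<close>

text \<open>Both edge components are attached to mesh edges, hence single-valued on interior edges.\<close>

record ('d::finite) weak_fun =
  v0 :: "(real^'d) set \<Rightarrow> real^'d \<Rightarrow> real"
  vb :: "(real^'d) set \<Rightarrow> real^'d \<Rightarrow> real"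
  vg :: "(real^'d) set \<Rightarrow> real^'d \<Rightarrow> real^'d"

text \<open>The component \<open>v0 v T\<close> is kept as a polynomial on the whole space, which is determined by its
  values on the full-dimensional \<open>T\<close>.\<close>

definition WG_space :: "nat \<Rightarrow> (real^'d) set set \<Rightarrow> (real^'d) set set \<Rightarrow> 'd weak_fun set" where
  "WG_space k \<T> \<E> = {v. v0 v \<in> (\<Pi>\<^sub>E T\<in>\<T>. poly_fun k) \<and>
     vb v \<in> (\<Pi>\<^sub>E e\<in>\<E>. poly_on k e) \<and> vg v \<in> (\<Pi>\<^sub>E e\<in>\<E>. vec_poly_on (k - 1) e)}"

definition WG_space0 ::
  "nat \<Rightarrow> (real^'d) set \<Rightarrow> (real^'d) set \<Rightarrow> (real^'d) set set \<Rightarrow> (real^'d) set set \<Rightarrow> 'd weak_fun set" where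
  "WG_space0 k \<Omega> \<Gamma>\<^sub>1 \<T> \<E> = {v\<in>WG_space k \<T> \<E>. \<forall>e\<in>edges_in \<E> \<Gamma>\<^sub>1. \<forall>x\<in>e.
     vb v e x = 0 \<and> vg v e x \<bullet> outward_normal (closure \<Omega>) e = 0}"

definition bdry_integral ::
  "(real^'d) set set \<Rightarrow> (real^'d) set \<Rightarrow> ((real^'d) set \<Rightarrow> real^'d \<Rightarrow> real) \<Rightarrow> real" where
  "bdry_integral \<E> T F = (\<Sum>e\<in>edges_of \<E> T. \<integral>x. F e x \<partial>flat_measure e)"

definition weak_laplacian ::
  "nat \<Rightarrow> (real^'d) set set \<Rightarrow> 'd weak_fun \<Rightarrow> (real^'d) set \<Rightarrow> real^'d \<Rightarrow> real" where
  "weak_laplacian k \<E> v T = (THE p. p \<in> poly_fun (k - 1) \<and> (\<forall>w\<in>poly_fun (k - 1).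
     (\<integral>x. p x * w x \<partial>lebesgue_on T) =
       (\<integral>x. v0 v T x * laplacian w x \<partial>lebesgue_on T)
       - bdry_integral \<E> T (\<lambda>e x. vb v e x * (grad w x \<bullet> outward_normal T e))
       + bdry_integral \<E> T (\<lambda>e x. (vg v e x \<bullet> outward_normal T e) * w x)))"

definition weak_gradient ::
  "nat \<Rightarrow> (real^'d) set set \<Rightarrow> 'd weak_fun \<Rightarrow> (real^'d) set \<Rightarrow> real^'d \<Rightarrow> real^'d" where
  "weak_gradient k \<E> v T = (THE q. q \<in> vec_poly_fun (k - 1) \<and> (\<forall>\<psi>\<in>vec_poly_fun (k - 1).
     (\<integral>x. q x \<bullet> \<psi> x \<partial>lebesgue_on T) =
       - (\<integral>x. v0 v T x * divergence \<psi> x \<partial>lebesgue_on T)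
       + bdry_integral \<E> T (\<lambda>e x. vb v e x * (\<psi> x \<bullet> outward_normal T e))))"

definition weak_operator ::
  "nat \<Rightarrow> real \<Rightarrow> (real^'d \<Rightarrow> real^'d) \<Rightarrow> (real^'d) set set \<Rightarrow> 'd weak_fun \<Rightarrow> (real^'d) set \<Rightarrow> real^'d \<Rightarrow> real" where
  "weak_operator k \<epsilon> b \<E> v T x =
     - \<epsilon> * weak_laplacian k \<E> v T x + b x \<bullet> weak_gradient k \<E> v T x"

definition L2_proj :: "nat \<Rightarrow> (real^'d) set \<Rightarrow> (real^'d \<Rightarrow> real) \<Rightarrow> real^'d \<Rightarrow> real" where
  "L2_proj r e g = (THE p. p \<in> poly_on r e \<and> (\<forall>q\<in>poly_on r e.
     (\<integral>x. p x * q x \<partial>flat_measure e) = (\<integral>x. g x * q x \<partial>flat_measure e)))"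


section \<open>The least-squares weak Galerkin scheme\<close>

definition stab_form ::
  "(real^'d) set set \<Rightarrow> (real^'d) set set \<Rightarrow> 'd weak_fun \<Rightarrow> 'd weak_fun \<Rightarrow> real" where
  "stab_form \<T> \<E> u v = (\<Sum>T\<in>\<T>.
     inverse (diameter T ^ 3) *
       bdry_integral \<E> T (\<lambda>e x. (v0 u T x - vb u e x) * (v0 v T x - vb v e x))
     + inverse (diameter T) *
       bdry_integral \<E> T (\<lambda>e x. ((grad (v0 u T) x - vg u e x) \<bullet> outward_normal T e)
                              * ((grad (v0 v T) x - vg v e x) \<bullet> outward_normal T e)))"

definition LSWG_form ::
  "nat \<Rightarrow> real \<Rightarrow> (real^'d \<Rightarrow> real^'d) \<Rightarrow> (real^'d) set set \<Rightarrow> (real^'d) set set \<Rightarrow>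
   'd weak_fun \<Rightarrow> 'd weak_fun \<Rightarrow> real" where
  "LSWG_form k \<epsilon> b \<T> \<E> u v =
     (\<Sum>T\<in>\<T>. \<integral>x. weak_operator k \<epsilon> b \<E> u T x * weak_operator k \<epsilon> b \<E> v T x \<partial>lebesgue_on T)
     + stab_form \<T> \<E> u v"

definition LSWG_solution ::
  "nat \<Rightarrow> (real^'d) set \<Rightarrow> (real^'d) set \<Rightarrow> real \<Rightarrow> (real^'d \<Rightarrow> real^'d) \<Rightarrow> (real^'d \<Rightarrow> real) \<Rightarrow>
   (real^'d \<Rightarrow> real) \<Rightarrow> (real^'d \<Rightarrow> real) \<Rightarrow> (real^'d) set set \<Rightarrow> (real^'d) set set \<Rightarrow> 'd weak_fun \<Rightarrow> bool" where
  "LSWG_solution k \<Omega> \<Gamma>\<^sub>1 \<epsilon> b f g\<^sub>1 g\<^sub>2 \<T> \<E> u \<longleftrightarrow>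
     u \<in> WG_space k \<T> \<E> \<and>
     (\<forall>e\<in>edges_in \<E> \<Gamma>\<^sub>1. \<forall>x\<in>e.
        vb u e x = L2_proj k e g\<^sub>1 x \<and>
        vg u e x \<bullet> outward_normal (closure \<Omega>) e = L2_proj (k - 1) e g\<^sub>2 x) \<and>
     (\<forall>v\<in>WG_space0 k \<Omega> \<Gamma>\<^sub>1 \<T> \<E>.
        LSWG_form k \<epsilon> b \<T> \<E> u v = (\<Sum>T\<in>\<T>. \<integral>x. f x * weak_operator k \<epsilon> b \<E> v T x \<partial>lebesgue_on T))"

text \<open>The weak operators, the bilinear form and the boundary conditions involve \<open>vg\<close> through its
  normal component only.  Weak functions are therefore compared via \<open>v0\<close>, \<open>vb\<close> and \<open>vg \<bullet> n\<close>; the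
  tangential part of \<open>vg\<close> is invisible to the scheme.\<close>

definition same_weak_fun ::
  "(real^'d) set set \<Rightarrow> (real^'d) set set \<Rightarrow> 'd weak_fun \<Rightarrow> 'd weak_fun \<Rightarrow> bool" where
  "same_weak_fun \<T> \<E> u w \<longleftrightarrow>
     v0 u = v0 w \<and> vb u = vb w \<and>
     (\<forall>T\<in>\<T>. \<forall>e\<in>edges_of \<E> T. \<forall>x\<in>e.
        vg u e x \<bullet> outward_normal T e = vg w e x \<bullet> outward_normal T e)"

end

theory Submission
  imports Defs
begin

text \<open>The discrete problem is a finite-dimensional symmetric positive semidefinite system, which is
  consistent because its right-hand side annihilates the kernel of the form.  For uniqueness, let
  \<open>a(v,v) = 0\<close>.  Then \<open>v\<^sub>0 = v\<^sub>b\<close> and \<open>\<nabla>v\<^sub>0 \<bullet> n = v\<^sub>g \<bullet> n\<close> on all edges, so by Green's formula the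
  weak operators of \<open>v\<close> are the classical ones and \<open>\<epsilon> \<bar>\<Delta>v\<^sub>0\<bar> \<le> C \<bar>\<nabla>v\<^sub>0\<bar>\<close> on every element.  A polynomial
  with this property and vanishing Cauchy data on a flat edge is zero; hence \<open>v\<^sub>0\<close> vanishes on an
  element adjacent to \<open>\<Gamma>\<^sub>1\<close> and then, through common edges, on every element.\<close>

section \<open>Polynomials\<close>

text \<open>The coefficient \<open>b\<close> is only essentially bounded, so the equation for
  \<open>v0\<close> holds almost everywhere and has no pointwise meaning. Passing to an inequality
  between polynomials removes \<open>b\<close>: it extends by continuity to every interior point,
  and comparing orders of vanishing at a flat edge replaces a unique continuation theorem for the
  differential equation. Green's formula on a possibly nonconvex cell rests on a divergence theorem
  proved line by line: in a fixed direction almost every line misses the codimension-two skeleton,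
  and on such a line the indicator of the cell is a sum of steps at transversal crossings of edges.
  The disintegration uses a weight of total mass one on each parallel line; this avoids adapted
  coordinates and fits the slab definition of the surface measure. Two sources make the discrete
  system singular: monomials in ambient coordinates become dependent on an edge, and the tangential
  part of \<open>vg\<close> does not enter the form. Hence existence is not deduced from uniqueness
  through an invertible matrix; the two are proved separately, uniqueness modulo
  \<open>same_weak_fun\<close>.\<close>

definition multi_indices :: "nat \<Rightarrow> ('d::finite \<Rightarrow> nat) set" where
  "multi_indices r = {\<alpha>. (\<Sum>i\<in>UNIV. \<alpha> i) \<le> r}"

definition mono_fun :: "('d::finite \<Rightarrow> nat) \<Rightarrow> real^'d \<Rightarrow> real" where
  "mono_fun \<alpha> x = (\<Prod>i\<in>UNIV. (x $ i) ^ \<alpha> i)"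

lemma finite_multi_indices: "finite (multi_indices r :: ('d::finite \<Rightarrow> nat) set)"
proof -
  have "multi_indices r \<subseteq> (\<Pi>\<^sub>E i\<in>(UNIV::'d set). {..r})"
  proof
    fix \<alpha> :: "'d \<Rightarrow> nat" assume "\<alpha> \<in> multi_indices r"
    then have "\<alpha> i \<le> r" for i
      using member_le_sum[of i UNIV \<alpha>] by (auto simp: multi_indices_def intro: order_trans)
    then show "\<alpha> \<in> (\<Pi>\<^sub>E i\<in>(UNIV::'d set). {..r})" by auto
  qed
  then show ?thesis by (rule finite_subset) (auto intro!: finite_PiE)
qed

lemma poly_fun_iff:
  "p \<in> poly_fun r \<longleftrightarrow> (\<exists>c. p = (\<lambda>x. \<Sum>\<alpha>\<in>multi_indices r. c \<alpha> * mono_fun \<alpha> x))"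
  by (simp add: poly_fun_def multi_indices_def mono_fun_def)

lemma poly_fun_zero: "(\<lambda>x. 0) \<in> poly_fun r"
  unfolding poly_fun_iff by (rule exI[of _ "\<lambda>_. 0"]) simp

lemma poly_fun_add: "p \<in> poly_fun r \<Longrightarrow> q \<in> poly_fun r \<Longrightarrow> (\<lambda>x. p x + q x) \<in> poly_fun r"
  unfolding poly_fun_iff
proof (elim exE)
  fix c d assume *: "p = (\<lambda>x. \<Sum>\<alpha>\<in>multi_indices r. c \<alpha> * mono_fun \<alpha> x)"
    "q = (\<lambda>x. \<Sum>\<alpha>\<in>multi_indices r. d \<alpha> * mono_fun \<alpha> x)"
  show "\<exists>c. (\<lambda>x. p x + q x) = (\<lambda>x. \<Sum>\<alpha>\<in>multi_indices r. c \<alpha> * mono_fun \<alpha> x)"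
    by (rule exI[of _ "\<lambda>\<alpha>. c \<alpha> + d \<alpha>"]) (simp add: * sum.distrib distrib_right)
qed

lemma poly_fun_cmul: "p \<in> poly_fun r \<Longrightarrow> (\<lambda>x. a * p x) \<in> poly_fun r"
  unfolding poly_fun_iff
proof (elim exE)
  fix c assume *: "p = (\<lambda>x. \<Sum>\<alpha>\<in>multi_indices r. c \<alpha> * mono_fun \<alpha> x)"
  show "\<exists>c. (\<lambda>x. a * p x) = (\<lambda>x. \<Sum>\<alpha>\<in>multi_indices r. c \<alpha> * mono_fun \<alpha> x)"
    by (rule exI[of _ "\<lambda>\<alpha>. a * c \<alpha>"]) (simp add: * sum_distrib_left mult.assoc)
qed

lemma poly_fun_sum: "(\<And>i. i \<in> I \<Longrightarrow> p i \<in> poly_fun r) \<Longrightarrow> (\<lambda>x. \<Sum>i\<in>I. p i x) \<in> poly_fun r"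
  by (induction I rule: infinite_finite_induct) (auto simp: poly_fun_zero intro: poly_fun_add)

lemma poly_fun_lincomb:
  "(\<And>i. i \<in> I \<Longrightarrow> p i \<in> poly_fun r) \<Longrightarrow> (\<lambda>x. \<Sum>i\<in>I. c i * p i x) \<in> poly_fun r"
  by (intro poly_fun_sum poly_fun_cmul)

lemma poly_fun_diff: "p \<in> poly_fun r \<Longrightarrow> q \<in> poly_fun r \<Longrightarrow> (\<lambda>x. p x - q x) \<in> poly_fun r"
  using poly_fun_add[of p r "\<lambda>x. (-1) * q x"] poly_fun_cmul[of q r "-1"] by simp

lemma mono_fun_in_poly_fun: "\<alpha> \<in> multi_indices r \<Longrightarrow> mono_fun \<alpha> \<in> poly_fun r"
  unfolding poly_fun_iff
proof (rule exI[of _ "\<lambda>\<beta>. if \<beta> = \<alpha> then 1 else 0"], rule ext)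
  fix x :: "real^'a" assume "\<alpha> \<in> multi_indices r"
  then show "mono_fun \<alpha> x = (\<Sum>\<beta>\<in>multi_indices r. (if \<beta> = \<alpha> then 1 else 0) * mono_fun \<beta> x)"
    by (simp add: finite_multi_indices if_distrib[of "\<lambda>c. c * _"] cong: if_cong)
qed

lemma poly_fun_mono:
  assumes "p \<in> poly_fun r" "r \<le> s" shows "p \<in> poly_fun s"
proof -
  obtain c where p: "p = (\<lambda>x. \<Sum>\<alpha>\<in>multi_indices r. c \<alpha> * mono_fun \<alpha> x)"
    using assms poly_fun_iff by blast
  show ?thesis unfolding p
    using assms(2) by (intro poly_fun_lincomb mono_fun_in_poly_fun) (auto simp: multi_indices_def)
qed

text \<open>This degree-free predicate has an induction rule built from sums and products, so
  continuity, differentiability and measurability are derived for it; \<open>poly_fun r\<close> is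
  consulted only where the degree matters.\<close>

lemmas rpf_linear = real_polynomial_function.intros(1)
  and rpf_const = real_polynomial_function.intros(2)
  and rpf_add = real_polynomial_function.intros(3)
  and rpf_mult = real_polynomial_function.intros(4)

lemma rpf_component: "real_polynomial_function (\<lambda>x::real^'d. x $ i)"
  by (intro rpf_linear bounded_linear_vec_nth)

lemma rpf_inner: "real_polynomial_function (\<lambda>x::'a::real_inner. n \<bullet> x)"
  by (intro rpf_linear bounded_linear_inner_right)

lemma rpf_mono_fun: "real_polynomial_function (mono_fun \<alpha>)"
proof -
  have "mono_fun \<alpha> = (\<lambda>x. \<Prod>i\<in>UNIV. (x $ i) ^ \<alpha> i)" by (auto simp: mono_fun_def)
  then show ?thesis
    by (auto intro!: real_polynomial_function_prod real_polynomial_function_power rpf_component)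
qed

lemma rpf_poly_fun: "p \<in> poly_fun r \<Longrightarrow> real_polynomial_function p"
  unfolding poly_fun_iff
  by (auto intro!: real_polynomial_function_sum rpf_mult rpf_mono_fun
      finite_multi_indices)

section \<open>Derivatives of polynomial functions\<close>

lemma rpf_has_derivative:
  "real_polynomial_function f \<Longrightarrow> (f has_derivative frechet_derivative f (at x)) (at x)"
  using differentiable_at_real_polynomial_function frechet_derivative_works by blast

lemma rpf_continuous_on: "real_polynomial_function f \<Longrightarrow> continuous_on S f"
  by (simp add: continuous_at_imp_continuous_on continuous_real_polymonial_function)

lemma rpf_borel: "real_polynomial_function (f::'a::euclidean_space \<Rightarrow> real) \<Longrightarrow> f \<in> borel_measurable borel"
  using rpf_continuous_on borel_measurable_continuous_onI by blast

lemma frechet_derivative_rpf_mult: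
  assumes "real_polynomial_function f" "real_polynomial_function g"
  shows "frechet_derivative (\<lambda>x. f x * g x) (at x) =
    (\<lambda>v. f x * frechet_derivative g (at x) v + frechet_derivative f (at x) v * g x)"
  using has_derivative_mult[OF rpf_has_derivative[OF assms(1)] rpf_has_derivative[OF assms(2)]]
  by (rule frechet_derivative_at[symmetric])

lemma frechet_derivative_rpf_add:
  assumes "real_polynomial_function f" "real_polynomial_function g"
  shows "frechet_derivative (\<lambda>x. f x + g x) (at x) =
    (\<lambda>v. frechet_derivative f (at x) v + frechet_derivative g (at x) v)"
  using has_derivative_add[OF rpf_has_derivative[OF assms(1)] rpf_has_derivative[OF assms(2)]]
  by (rule frechet_derivative_at[symmetric])

lemma rpf_frechet_derivative:
  "real_polynomial_function f \<Longrightarrow> real_polynomial_function (\<lambda>x. frechet_derivative f (at x) v)"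
proof (induction rule: real_polynomial_function.induct)
  case (linear f)
  have "frechet_derivative f (at x) = f" for x
    using linear by (simp add: bounded_linear_imp_has_derivative frechet_derivative_at[symmetric])
  then show ?case by (simp add: rpf_const)
next
  case (const c)
  then show ?case by (simp add: rpf_const)
qed (auto simp: frechet_derivative_rpf_add frechet_derivative_rpf_mult
      intro!: rpf_add rpf_mult)

lemma rpf_partial_deriv: "real_polynomial_function f \<Longrightarrow> real_polynomial_function (partial_deriv i f)"
  using rpf_frechet_derivative[of f "axis i 1"] by (simp add: partial_deriv_def[abs_def])

lemma rpf_laplacian: "real_polynomial_function f \<Longrightarrow> real_polynomial_function (laplacian f)"
  unfolding laplacian_def[abs_def] by (auto intro!: real_polynomial_function_sum rpf_partial_deriv)

lemma partial_deriv_mult: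
  assumes "real_polynomial_function f" "real_polynomial_function g"
  shows "partial_deriv i (\<lambda>x. f x * g x) x = f x * partial_deriv i g x + partial_deriv i f x * g x"
  by (simp add: partial_deriv_def frechet_derivative_rpf_mult assms)

lemma partial_deriv_add:
  assumes "real_polynomial_function f" "real_polynomial_function g"
  shows "partial_deriv i (\<lambda>x. f x + g x) x = partial_deriv i f x + partial_deriv i g x"
  by (simp add: partial_deriv_def frechet_derivative_rpf_add assms)

lemma partial_deriv_const: "partial_deriv i (\<lambda>x. c) x = 0"
  by (simp add: partial_deriv_def)

lemma partial_deriv_cmul:
  "real_polynomial_function f \<Longrightarrow> partial_deriv i (\<lambda>x. c * f x) x = c * partial_deriv i f x"
  using partial_deriv_mult[OF rpf_const[of c], of f] by (simp add: partial_deriv_const)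

lemma partial_deriv_sum:
  assumes "finite I" "\<And>j. j \<in> I \<Longrightarrow> real_polynomial_function (f j)"
  shows "partial_deriv i (\<lambda>x. \<Sum>j\<in>I. f j x) x = (\<Sum>j\<in>I. partial_deriv i (f j) x)"
  using assms
proof (induction I rule: finite_induct)
  case empty
  then show ?case by (simp add: partial_deriv_const)
next
  case (insert j I)
  then show ?case
    by (simp add: partial_deriv_add real_polynomial_function_sum)
qed

lemma partial_deriv_lincomb:
  assumes "finite I" "\<And>j. j \<in> I \<Longrightarrow> real_polynomial_function (f j)"
  shows "partial_deriv i (\<lambda>x. \<Sum>j\<in>I. c j * f j x) x = (\<Sum>j\<in>I. c j * partial_deriv i (f j) x)"
  using assms
  by (simp add: partial_deriv_sum partial_deriv_cmul rpf_mult
      rpf_const)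

lemma laplacian_lincomb:
  assumes "finite I" "\<And>j. j \<in> I \<Longrightarrow> real_polynomial_function (f j)"
  shows "laplacian (\<lambda>x. \<Sum>j\<in>I. c j * f j x) x = (\<Sum>j\<in>I. c j * laplacian (f j) x)"
proof -
  have "partial_deriv i (partial_deriv i (\<lambda>x. \<Sum>j\<in>I. c j * f j x)) x
    = (\<Sum>j\<in>I. c j * partial_deriv i (partial_deriv i (f j)) x)" for i
  proof -
    have "partial_deriv i (\<lambda>x. \<Sum>j\<in>I. c j * f j x) = (\<lambda>x. \<Sum>j\<in>I. c j * partial_deriv i (f j) x)"
      by (intro ext partial_deriv_lincomb) (use assms in auto)
    then show ?thesis
      by (simp only:, intro partial_deriv_lincomb) (use assms rpf_partial_deriv in auto)
  qed
  then show ?thesis unfolding laplacian_def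
    by (simp add: sum_distrib_left) (rule sum.swap)
qed

lemma grad_lincomb:
  assumes "finite I" "\<And>j. j \<in> I \<Longrightarrow> real_polynomial_function (f j)"
  shows "grad (\<lambda>x. \<Sum>j\<in>I. c j * f j x) x = (\<Sum>j\<in>I. c j *\<^sub>R grad (f j) x)"
  using assms by (simp add: vec_eq_iff grad_def partial_deriv_lincomb)

text \<open>The factors other than the \<open>i\<close>-th do not depend on \<open>x $ i\<close> and
  act as a constant. If \<open>\<alpha> i = 0\<close>, the truncated exponent is harmless because
  the coefficient \<open>real (\<alpha> i)\<close> is zero.\<close>

lemma partial_deriv_mono_fun:
  fixes \<alpha> :: "'d::finite \<Rightarrow> nat"
  shows "partial_deriv i (mono_fun \<alpha>) x = real (\<alpha> i) * mono_fun (\<alpha>(i := \<alpha> i - 1)) x"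
proof -
  define R where "R \<beta> x = (\<Prod>j\<in>UNIV - {i}. (x $ j) ^ \<beta> j)" for \<beta> :: "'d \<Rightarrow> nat" and x :: "real^'d"
  have split: "mono_fun \<beta> x = (x $ i) ^ \<beta> i * R \<beta> x" for \<beta> x
    unfolding mono_fun_def R_def by (simp add: prod.remove[of UNIV i])
  have R': "R (\<alpha>(i := \<alpha> i - 1)) x = R \<alpha> x"
    unfolding R_def by (intro prod.cong) auto
  have rpfR: "real_polynomial_function (R \<alpha>)"
    unfolding R_def by (intro real_polynomial_function_prod real_polynomial_function_power rpf_component) auto
  have d1: "((\<lambda>x. (x $ i) ^ \<alpha> i) has_derivative (\<lambda>v. real (\<alpha> i) * (x $ i) ^ (\<alpha> i - 1) * v $ i)) (at x)"
    by (auto intro!: derivative_eq_intros bounded_linear_imp_has_derivative bounded_linear_vec_nth)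
  have d2: "((\<lambda>x. \<Prod>j\<in>UNIV - {i}. (x $ j) ^ \<alpha> j) has_derivative
      (\<lambda>v. \<Sum>j\<in>UNIV - {i}. (real (\<alpha> j) * (x $ j) ^ (\<alpha> j - 1) * v $ j) *
         (\<Prod>l\<in>UNIV - {i} - {j}. (x $ l) ^ \<alpha> l))) (at x)"
    by (rule has_derivative_prod) (auto intro!: derivative_eq_intros bounded_linear_imp_has_derivative bounded_linear_vec_nth)
  have "partial_deriv i (R \<alpha>) x = 0"
    unfolding partial_deriv_def R_def frechet_derivative_at[OF d2, symmetric]
    by (intro sum.neutral) (auto simp: axis_def)
  moreover have "partial_deriv i (\<lambda>x. (x $ i) ^ \<alpha> i) x = real (\<alpha> i) * (x $ i) ^ (\<alpha> i - 1)"
    unfolding partial_deriv_def frechet_derivative_at[OF d1, symmetric] by simp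
  ultimately have "partial_deriv i (\<lambda>x. (x $ i) ^ \<alpha> i * R \<alpha> x) x = real (\<alpha> i) * (x $ i) ^ (\<alpha> i - 1) * R \<alpha> x"
    using rpfR by (subst partial_deriv_mult) (auto intro!: real_polynomial_function_power rpf_component)
  then show ?thesis unfolding split[abs_def] using R' by simp
qed

text \<open>Each monomial either loses one degree or has \<open>\<alpha> i = 0\<close> and is
  annihilated; the second case also covers \<open>r = 0\<close>, where \<open>r - 1\<close> is
  \<open>0\<close> by truncation.\<close>

lemma partial_deriv_in_poly_fun:
  assumes "p \<in> poly_fun r" shows "partial_deriv i p \<in> poly_fun (r - 1)"
proof -
  obtain c where p: "p = (\<lambda>x. \<Sum>\<alpha>\<in>multi_indices r. c \<alpha> * mono_fun \<alpha> x)"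
    using assms poly_fun_iff by blast
  have *: "partial_deriv i p = (\<lambda>x. \<Sum>\<alpha>\<in>multi_indices r. c \<alpha> * (real (\<alpha> i) * mono_fun (\<alpha>(i := \<alpha> i - 1)) x))"
    unfolding p by (rule ext) (simp add: partial_deriv_lincomb finite_multi_indices rpf_mono_fun partial_deriv_mono_fun)
  show ?thesis unfolding *
  proof (rule poly_fun_lincomb)
    fix \<alpha> :: "'a \<Rightarrow> nat" assume \<alpha>: "\<alpha> \<in> multi_indices r"
    show "(\<lambda>x. real (\<alpha> i) * mono_fun (\<alpha>(i := \<alpha> i - 1)) x) \<in> poly_fun (r - 1)"
    proof (cases "\<alpha> i = 0")
      case True then show ?thesis by (simp add: poly_fun_zero)
    next
      case False
      have "(\<Sum>j\<in>UNIV. (\<alpha>(i := \<alpha> i - 1)) j) = (\<Sum>j\<in>UNIV - {i}. \<alpha> j) + (\<alpha> i - 1)"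
        by (subst sum.remove[of _ i]) (auto intro!: sum.cong)
      also have "\<dots> = (\<Sum>j\<in>UNIV. \<alpha> j) - 1"
        using False by (subst (2) sum.remove[of _ i]) auto
      finally have "\<alpha>(i := \<alpha> i - 1) \<in> multi_indices (r - 1)"
        using \<alpha> by (auto simp: multi_indices_def)
      then show ?thesis by (intro poly_fun_cmul mono_fun_in_poly_fun)
    qed
  qed
qed

text \<open>Two differentiations lower the degree twice; the weaker bound is the one that places the
  classical Laplacian of \<open>v0\<close> in the space of the weak Laplacian.\<close>

lemma laplacian_in_poly_fun:
  assumes "p \<in> poly_fun r" shows "laplacian p \<in> poly_fun (r - 1)"
proof -
  have "partial_deriv i (partial_deriv i p) \<in> poly_fun (r - 1)" for i
    using partial_deriv_in_poly_fun[OF partial_deriv_in_poly_fun[OF assms, of i], of i]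
    by (rule poly_fun_mono) auto
  then show ?thesis unfolding laplacian_def[abs_def] by (intro poly_fun_sum)
qed

text \<open>Reduces questions about zeros in several variables to one variable, where a nonzero
  polynomial has finitely many roots.\<close>

lemma rpf_line:
  assumes "real_polynomial_function f"
  shows "\<exists>q. \<forall>t. f (a + t *\<^sub>R b) = poly q t"
  using assms
proof (induction rule: real_polynomial_function.induct)
  case (linear f)
  then interpret bounded_linear f .
  show ?case by (rule exI[of _ "[:f a, f b:]"]) (simp add: add scaleR)
next
  case (const c)
  show ?case by (rule exI[of _ "[:c:]"]) simp
next
  case (add f g)
  then show ?case by (metis poly_add)
next
  case (mult f g)
  then show ?case by (metis poly_mult)
qed

lemma poly_zero_if_interval:
  fixes q :: "real poly"
  assumes "0 < \<delta>" "\<And>t. 0 < t \<Longrightarrow> t < \<delta> \<Longrightarrow> poly q t = 0"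
  shows "q = 0"
proof (rule ccontr)
  assume "q \<noteq> 0"
  then have "finite {t. poly q t = 0}" by (rule poly_roots_finite)
  moreover have "{0<..<\<delta>} \<subseteq> {t. poly q t = 0}" using assms by auto
  ultimately show False using assms(1) by (meson finite_subset infinite_Ioo)
qed

text \<open>The identity theorem on a flat: on the line from a relative interior point
  \<open>y\<close> towards \<open>x\<close> the polynomial vanishes for small parameters, hence
  identically, and the parameter \<open>1\<close> gives \<open>x\<close>.\<close>

lemma rpf_zero_affine_hull:
  assumes f: "real_polynomial_function (f::'a::euclidean_space \<Rightarrow> real)" and e: "rel_interior e \<noteq> {}"
    and z: "\<And>x. x \<in> rel_interior e \<Longrightarrow> f x = 0" and x: "x \<in> affine hull e"
  shows "f x = 0"
proof -
  obtain y where y: "y \<in> rel_interior e" using e by auto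
  obtain r where r: "r > 0" "ball y r \<inter> affine hull e \<subseteq> rel_interior e"
    using openin_rel_interior[of e] y unfolding openin_contains_ball by (metis inf_commute)
  obtain q where q: "\<And>t. f (y + t *\<^sub>R (x - y)) = poly q t" using rpf_line[OF f] by metis
  have "q = 0"
  proof (rule poly_zero_if_interval)
    \<comment> \<open>The \<open>+ 1\<close> keeps the denominator positive when
      \<open>x = y\<close>.\<close>
    show "0 < r / (norm (x - y) + 1)" using r by (simp add: add_nonneg_pos)
    fix t assume t: "0 < t" "t < r / (norm (x - y) + 1)"
    then have "t * (norm (x - y) + 1) < r" by (simp add: pos_less_divide_eq add_nonneg_pos)
    with t have "t * norm (x - y) < r" by (simp add: distrib_left)
    then have "y + t *\<^sub>R (x - y) \<in> ball y r" using t by (simp add: dist_norm)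
    moreover have "y + t *\<^sub>R (x - y) \<in> affine hull e"
    proof -
      have "y \<in> affine hull e" using y rel_interior_subset hull_subset by (metis subsetD)
      then have "(1 - t) *\<^sub>R y + t *\<^sub>R x \<in> affine hull e"
        using x by (intro mem_affine[OF affine_affine_hull]) auto
      moreover have "(1 - t) *\<^sub>R y + t *\<^sub>R x = y + t *\<^sub>R (x - y)" by (simp add: algebra_simps)
      ultimately show ?thesis by simp
    qed
    ultimately show "poly q t = 0" using z r(2) q by (metis IntI subsetD)
  qed
  then show ?thesis using q[of 1] by simp
qed

lemma rpf_zero_on_open:
  assumes "real_polynomial_function (f::'a::euclidean_space \<Rightarrow> real)" "open U" "U \<noteq> {}" "\<And>x. x \<in> U \<Longrightarrow> f x = 0"
  shows "f x = 0"
proof (rule rpf_zero_affine_hull[OF assms(1), of U])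
  show "rel_interior U \<noteq> {}" using assms by (simp add: rel_interior_open)
  show "\<And>x. x \<in> rel_interior U \<Longrightarrow> f x = 0" using assms rel_interior_subset by blast
  show "x \<in> affine hull U" using affine_hull_open assms by blast
qed

section \<open>Unique continuation from a flat boundary piece\<close>

text \<open>Division with remainder by the linear function \<open>n \<bullet> (x - p)\<close>: the
  remainder is the polynomial pulled back along the projection in direction \<open>n\<close>, and
  this form is stable under sums and products.\<close>

lemma rpf_factor:
  fixes n p :: "'a::euclidean_space"
  assumes "real_polynomial_function f"
  shows "\<exists>g. real_polynomial_function g \<and>
    (\<forall>x. f x = f (x - (n \<bullet> (x - p)) *\<^sub>R n) + (n \<bullet> (x - p)) * g x)"
  using assms
proof (induction rule: real_polynomial_function.induct)
  case (linear f)
  then interpret bounded_linear f .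
  show ?case by (rule exI[of _ "\<lambda>x. f n"]) (auto simp: diff scaleR)
next
  case (const c)
  show ?case by (rule exI[of _ "\<lambda>x. 0"]) auto
next
  case (add f1 f2)
  then obtain g1 g2 where g: "real_polynomial_function g1" "real_polynomial_function g2"
    "\<And>x. f1 x = f1 (x - (n \<bullet> (x - p)) *\<^sub>R n) + (n \<bullet> (x - p)) * g1 x"
    "\<And>x. f2 x = f2 (x - (n \<bullet> (x - p)) *\<^sub>R n) + (n \<bullet> (x - p)) * g2 x" by metis
  show ?case
  proof (intro exI[of _ "\<lambda>x. g1 x + g2 x"] conjI allI)
    show "f1 x + f2 x = f1 (x - (n \<bullet> (x - p)) *\<^sub>R n) + f2 (x - (n \<bullet> (x - p)) *\<^sub>R n) +
        (n \<bullet> (x - p)) * (g1 x + g2 x)" for x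
      using g(3)[of x] g(4)[of x] by (simp add: distrib_left)
    show "real_polynomial_function (\<lambda>x. g1 x + g2 x)"
      by (rule rpf_add[OF g(1,2)])
  qed
next
  case (mult f1 f2)
  then obtain g1 g2 where g: "real_polynomial_function g1" "real_polynomial_function g2"
    "\<And>x. f1 x = f1 (x - (n \<bullet> (x - p)) *\<^sub>R n) + (n \<bullet> (x - p)) * g1 x"
    "\<And>x. f2 x = f2 (x - (n \<bullet> (x - p)) *\<^sub>R n) + (n \<bullet> (x - p)) * g2 x" by metis
  have "polynomial_function (\<lambda>x::'a. x - (n \<bullet> (x - p)) *\<^sub>R n)"
    using rpf_inner[of n]
    by (intro polynomial_function_diff polynomial_function_id polynomial_function_mult
        polynomial_function_const)
      (auto simp: inner_diff_right real_polynomial_function_eq[symmetric])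
  then have c: "real_polynomial_function (\<lambda>x. f2 (x - (n \<bullet> (x - p)) *\<^sub>R n))"
    using real_polynomial_function_compose[OF _ mult.hyps(2)] by (simp add: o_def)
  show ?case
  \<comment> \<open>The two factors are replaced by their projected values one after the other,
    first \<open>f2\<close>, then \<open>f1\<close>; the two errors add up to this quotient.\<close>
  proof (intro exI[of _ "\<lambda>x. f1 x * g2 x + f2 (x - (n \<bullet> (x - p)) *\<^sub>R n) * g1 x"] conjI allI)
    show "f1 x * f2 x = f1 (x - (n \<bullet> (x - p)) *\<^sub>R n) * f2 (x - (n \<bullet> (x - p)) *\<^sub>R n) +
        (n \<bullet> (x - p)) * (f1 x * g2 x + f2 (x - (n \<bullet> (x - p)) *\<^sub>R n) * g1 x)" for x
      using g(3)[of x] g(4)[of x] by algebra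
    show "real_polynomial_function (\<lambda>x. f1 x * g2 x + f2 (x - (n \<bullet> (x - p)) *\<^sub>R n) * g1 x)"
      by (rule rpf_add[OF rpf_mult[OF mult.hyps(1) g(2)]
            rpf_mult[OF c g(1)]])
  qed
qed

text \<open>With the power \<open>m\<close> pulled out, the second summand of the bracket vanishes
  on the hyperplane; this isolates the leading coefficient in the order of vanishing.\<close>

lemma partial_deriv_power_inner:
  fixes n p :: "real^'d"
  assumes h: "real_polynomial_function h"
  shows "partial_deriv i (\<lambda>x. (n \<bullet> (x - p)) ^ Suc m * h x) x =
    (n \<bullet> (x - p)) ^ m * (real (Suc m) * n $ i * h x + (n \<bullet> (x - p)) * partial_deriv i h x)"
proof -
  have l: "real_polynomial_function (\<lambda>x. n \<bullet> (x - p))"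
    using rpf_inner[of n] by (simp add: inner_diff_right real_polynomial_function_diff rpf_const)
  have "((\<lambda>x. n \<bullet> (x - p)) has_derivative (\<lambda>v. n \<bullet> v)) (at x)"
    by (auto intro!: derivative_eq_intros)
  from has_derivative_power[OF this, of "Suc m"]
  have "((\<lambda>x. (n \<bullet> (x - p)) ^ Suc m) has_derivative (\<lambda>v. real (Suc m) * (n \<bullet> v) * (n \<bullet> (x - p)) ^ m)) (at x)"
    by (simp del: power_Suc add: mult_ac)
  then have "partial_deriv i (\<lambda>x. (n \<bullet> (x - p)) ^ Suc m) x = real (Suc m) * n $ i * (n \<bullet> (x - p)) ^ m"
    unfolding partial_deriv_def by (simp add: frechet_derivative_at[symmetric] inner_axis)
  then show ?thesis
    using l h by (subst partial_deriv_mult) (auto simp: distrib_left distrib_right mult_ac intro!: real_polynomial_function_power)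
qed

text \<open>If \<open>u\<close> has vanishing Cauchy data on \<open>e\<close> and is not zero, write \<open>u = l\<^sup>m g\<close> with \<open>l\<close> the signed
  distance to the hyperplane, \<open>m \<ge> 2\<close> and \<open>g\<close> not vanishing identically on \<open>e\<close>.  Then \<open>\<Delta>u\<close> is of exact
  order \<open>m - 2\<close> in \<open>l\<close> whereas \<open>\<nabla>u\<close> is of order \<open>m - 1\<close>.\<close>

lemma polynomial_unique_continuation:
  fixes u :: "real^'d \<Rightarrow> real" and n p :: "real^'d"
  assumes u: "real_polynomial_function u" and n: "norm n = 1"
    and e: "rel_interior e \<noteq> {}" and H: "affine hull e = {x. n \<bullet> (x - p) = 0}"
    and dirichlet: "\<And>x. x \<in> rel_interior e \<Longrightarrow> u x = 0"
    and neumann: "\<And>x. x \<in> rel_interior e \<Longrightarrow> grad u x \<bullet> n = 0"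
    and ineq: "\<And>y. y \<in> rel_interior e \<Longrightarrow> \<exists>\<delta>>0. \<forall>t. 0 < t \<and> t < \<delta> \<longrightarrow>
       \<bar>laplacian u (y - t *\<^sub>R n)\<bar> \<le> C * (\<Sum>i\<in>UNIV. \<bar>partial_deriv i u (y - t *\<^sub>R n)\<bar>)"
  shows "u x = 0"
proof -
  define l where "l x = n \<bullet> (x - p)" for x :: "real^'d"
  have lin: "real_polynomial_function l"
    unfolding l_def using rpf_inner[of n]
    by (simp add: inner_diff_right real_polynomial_function_diff rpf_const)
  have le: "l y = 0" if "y \<in> rel_interior e" for y
    using H that rel_interior_subset hull_subset[of e affine] unfolding l_def by blast
  have nn: "n \<bullet> n = 1" using n by (simp add: norm_eq_1)
  \<comment> \<open>Zero on the relative interior of \<open>e\<close> means zero on the whole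
    hyperplane, so the projected value in \<open>rpf_factor\<close> drops out and \<open>l\<close>
    divides \<open>f\<close>.\<close>
  have factor: "\<exists>g. real_polynomial_function g \<and> (\<forall>x. f x = l x * g x)"
    if f: "real_polynomial_function f" and 0: "\<And>x. x \<in> rel_interior e \<Longrightarrow> f x = 0" for f
  proof -
    obtain g where g: "real_polynomial_function g"
      "\<And>x. f x = f (x - (n \<bullet> (x - p)) *\<^sub>R n) + (n \<bullet> (x - p)) * g x"
      using rpf_factor[OF f] by metis
    have "x - (n \<bullet> (x - p)) *\<^sub>R n \<in> affine hull e" for x
      unfolding H by (simp add: inner_diff_right nn)
    then have "f (x - (n \<bullet> (x - p)) *\<^sub>R n) = 0" for x
      using rpf_zero_affine_hull[OF f e 0] by blast
    then show ?thesis using g unfolding l_def by (metis add_0)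
  qed
  have pd: "partial_deriv i (\<lambda>x. l x ^ Suc m * h x) x =
    l x ^ m * (real (Suc m) * n $ i * h x + l x * partial_deriv i h x)"
    if "real_polynomial_function h" for h m i x
    unfolding l_def by (rule partial_deriv_power_inner[OF that])
  \<comment> \<open>Instead of an exact order of vanishing, divisibility by every power of
    \<open>l\<close> is shown. The base case consumes both Cauchy data, one factor \<open>l\<close>
    for each.\<close>
  have step: "\<exists>g. real_polynomial_function g \<and> (\<forall>x. u x = l x ^ (m + 2) * g x)" for m
  proof (induction m)
    case 0
    obtain q where q: "real_polynomial_function q" "\<And>x. u x = l x * q x" using factor[OF u dirichlet] by metis
    have "q y = 0" if y: "y \<in> rel_interior e" for y
    proof -
      have "u = (\<lambda>x. l x ^ Suc 0 * q x)" using q by auto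
      then have "partial_deriv i u y = n $ i * q y" for i
        using pd[OF q(1), of i 0 y] le[OF y] by simp
      then have "grad u y = q y *\<^sub>R n" by (simp add: grad_def vec_eq_iff)
      then show ?thesis using neumann[OF y] nn by simp
    qed
    then obtain g where "real_polynomial_function g" "\<And>x. q x = l x * g x" using factor[OF q(1)] by metis
    then show ?case using q(2) by (auto simp: power2_eq_square)
  next
    case (Suc m)
    then obtain g where g: "real_polynomial_function g" and ug: "u = (\<lambda>x. l x ^ Suc (Suc m) * g x)" by auto
    \<comment> \<open>The gradient has the components \<open>l x ^ Suc m * A i x\<close> and the
      Laplacian is \<open>l x ^ m * B x\<close>. On \<open>e\<close> all summands with a factor
      \<open>l\<close> vanish, and \<open>B\<close> becomes
      \<open>(m + 1) * (m + 2) * g\<close>.\<close>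
    define A where "A i x = real (Suc (Suc m)) * n $ i * g x + l x * partial_deriv i g x" for i x
    have A: "real_polynomial_function (A i)" for i
      unfolding A_def using g lin
      by (intro rpf_add rpf_mult rpf_const
          rpf_partial_deriv) auto
    have du: "partial_deriv i u = (\<lambda>x. l x ^ Suc m * A i x)" for i
      unfolding ug by (rule ext, subst pd[OF g]) (simp add: A_def)
    define B where "B x = (\<Sum>i\<in>UNIV. real (Suc m) * n $ i * A i x + l x * partial_deriv i (A i) x)" for x
    have B: "real_polynomial_function B"
      unfolding B_def using A lin
      by (intro real_polynomial_function_sum rpf_add rpf_mult
          rpf_const rpf_partial_deriv) auto
    have lap: "laplacian u x = l x ^ m * B x" for x
      unfolding laplacian_def du pd[OF A] B_def by (simp add: sum_distrib_left)
    have "g y = 0" if y: "y \<in> rel_interior e" for y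
    proof -
      obtain \<delta> where \<delta>: "\<delta> > 0" "\<And>t. 0 < t \<Longrightarrow> t < \<delta> \<Longrightarrow>
        \<bar>laplacian u (y - t *\<^sub>R n)\<bar> \<le> C * (\<Sum>i\<in>UNIV. \<bar>partial_deriv i u (y - t *\<^sub>R n)\<bar>)"
        using ineq[OF y] by blast
      have lt: "l (y - t *\<^sub>R n) = - t" for t
        using le[OF y] nn by (simp add: l_def inner_diff_right)
      \<comment> \<open>On the inner normal ray \<open>l\<close> equals \<open>- t\<close>.
        Cancelling \<open>t ^ m\<close> leaves one factor \<open>t\<close> on the right, so the
        limit at \<open>y\<close> forces \<open>B y = 0\<close>.\<close>
      have bnd: "\<bar>B (y - t *\<^sub>R n)\<bar> \<le> t * (C * (\<Sum>i\<in>UNIV. \<bar>A i (y - t *\<^sub>R n)\<bar>))" if "0 < t" "t < \<delta>" for t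
      proof -
        have "t ^ m * \<bar>B (y - t *\<^sub>R n)\<bar> \<le> C * (\<Sum>i\<in>UNIV. t ^ Suc m * \<bar>A i (y - t *\<^sub>R n)\<bar>)"
          using \<delta>(2)[OF that] that by (simp add: lap du lt abs_mult power_abs)
        also have "\<dots> = t ^ m * (t * (C * (\<Sum>i\<in>UNIV. \<bar>A i (y - t *\<^sub>R n)\<bar>)))"
          by (simp add: sum_distrib_left mult_ac)
        finally show ?thesis using that by simp
      qed
      have cont: "((\<lambda>t. f (y - t *\<^sub>R n)) \<longlongrightarrow> f y) (at_right 0)" if "real_polynomial_function f" for f
      proof -
        have "isCont f y" using that continuous_real_polymonial_function by blast
        moreover have "((\<lambda>t. y - t *\<^sub>R n) \<longlongrightarrow> y) (at_right 0)"
          by (auto intro!: tendsto_eq_intros)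
        ultimately show ?thesis by (rule isCont_tendsto_compose)
      qed
      have "\<bar>B y\<bar> \<le> 0 * (C * (\<Sum>i\<in>UNIV. \<bar>A i y\<bar>))"
      proof (rule tendsto_le[OF trivial_limit_at_right_real])
        show "((\<lambda>t. t * (C * (\<Sum>i\<in>UNIV. \<bar>A i (y - t *\<^sub>R n)\<bar>))) \<longlongrightarrow> 0 * (C * (\<Sum>i\<in>UNIV. \<bar>A i y\<bar>))) (at_right 0)"
          by (intro tendsto_intros cont A)
        show "((\<lambda>t. \<bar>B (y - t *\<^sub>R n)\<bar>) \<longlongrightarrow> \<bar>B y\<bar>) (at_right 0)" by (intro tendsto_intros cont B)
        show "\<forall>\<^sub>F t in at_right 0. \<bar>B (y - t *\<^sub>R n)\<bar> \<le> t * (C * (\<Sum>i\<in>UNIV. \<bar>A i (y - t *\<^sub>R n)\<bar>))"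
          unfolding eventually_at_right_field using \<delta>(1) bnd by blast
      qed
      then have "B y = 0" by simp
      moreover have "B y = (\<Sum>i\<in>UNIV. real (Suc m) * n $ i * (real (Suc (Suc m)) * n $ i * g y))"
        unfolding B_def A_def using le[OF y] by simp
      also have "\<dots> = real (Suc m) * real (Suc (Suc m)) * g y * (n \<bullet> n)"
        unfolding inner_vec_def by (simp add: sum_distrib_left mult_ac)
      finally show ?thesis using \<open>B y = 0\<close> nn by simp
    qed
    then obtain g' where "real_polynomial_function g'" "\<And>x. g x = l x * g' x" using factor[OF g] by metis
    then show ?case using ug by (auto simp: mult_ac)
  qed
  show ?thesis
  proof -
    define x0 where "x0 = x - l x *\<^sub>R n"
    have x0: "x = x0 + l x *\<^sub>R n" by (simp add: x0_def)
    have l0: "l (x0 + t *\<^sub>R n) = t" for t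
      unfolding x0_def l_def by (simp add: inner_diff_right inner_add_right nn)
    obtain q where q: "\<And>t. u (x0 + t *\<^sub>R n) = poly q t" using rpf_line[OF u] by metis
    \<comment> \<open>On the normal line through \<open>x\<close> the function \<open>l\<close> is
      the parameter itself. A power larger than the degree of the restriction \<open>q\<close>
      divides \<open>q\<close> only if \<open>q\<close> is zero.\<close>
    obtain g where g: "real_polynomial_function g" "\<And>x. u x = l x ^ (degree q + 2) * g x"
      using step by metis
    obtain q' where q': "\<And>t. g (x0 + t *\<^sub>R n) = poly q' t" using rpf_line[OF g(1)] by metis
    have "poly q = poly (monom 1 (degree q + 2) * q')"
      by (rule ext) (simp only: q[symmetric] g(2) l0 q' poly_mult poly_monom mult_1)
    then have eq: "q = monom 1 (degree q + 2) * q'" by (simp only: poly_eq_poly_eq_iff)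
    have "q = 0"
    proof (rule ccontr)
      assume "q \<noteq> 0"
      then have "q' \<noteq> 0" using eq by auto
      then have "degree q = degree q + 2 + degree q'"
        by (subst eq, subst degree_mult_eq) (auto simp: monom_eq_0_iff degree_monom_eq)
      then show False by simp
    qed
    then show ?thesis using q[of "l x"] x0 by simp
  qed
qed

section \<open>Positive semidefinite linear systems\<close>

lemma psd_quadratic_zero:
  fixes a b :: real
  assumes "\<And>t. 0 \<le> 2 * t * a + t\<^sup>2 * b"
  shows "a = 0"
proof (rule ccontr)
  assume a: "a \<noteq> 0"
  \<comment> \<open>\<open>d\<close> is positive and exceeds \<open>b\<close> whatever the sign of
    \<open>b\<close>, which makes the value at \<open>t\<close> negative.\<close>
  define d where "d = \<bar>b\<bar> + 1"
  define t where "t = - a / d"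
  have d: "0 < d" "b < d" by (auto simp: d_def)
  have "2 * t * a + t\<^sup>2 * b = a\<^sup>2 / d * (b / d - 2)"
    unfolding t_def power2_eq_square by (simp add: algebra_simps)
  moreover have "b / d - 2 < 0" using d by (simp add: divide_less_eq)
  moreover have "0 < a\<^sup>2 / d" using a d by (intro divide_pos_pos) auto
  ultimately have "2 * t * a + t\<^sup>2 * b < 0" by (simp only: mult_pos_neg)
  then show False using assms[of t] by linarith
qed

text \<open>Induction on the index set: the new unknown is found through the Schur complement \<open>s\<close>; if \<open>s = 0\<close>
  then the system is consistent because the right-hand side annihilates the kernel.\<close>

lemma psd_system_solvable:
  fixes A :: "'i \<Rightarrow> 'i \<Rightarrow> real" and l :: "'i \<Rightarrow> real"
  assumes "finite I" "\<And>i j. i \<in> I \<Longrightarrow> j \<in> I \<Longrightarrow> A i j = A j i"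
    and "\<And>c. 0 \<le> (\<Sum>i\<in>I. \<Sum>j\<in>I. c i * c j * A i j)"
    and "\<And>c. (\<Sum>i\<in>I. \<Sum>j\<in>I. c i * c j * A i j) = 0 \<Longrightarrow> (\<Sum>i\<in>I. c i * l i) = 0"
  shows "\<exists>c. \<forall>i\<in>I. (\<Sum>j\<in>I. c j * A i j) = l i"
  using assms
proof (induction I arbitrary: l rule: finite_induct)
  case empty
  then show ?case by simp
next
  case (insert k I)
  let ?J = "insert k I"
  define B where "B c d = (\<Sum>i\<in>?J. \<Sum>j\<in>?J. c i * d j * A i j)" for c d :: "'i \<Rightarrow> real"
  have sym: "A i j = A j i" if "i \<in> ?J" "j \<in> ?J" for i j using insert.prems(1) that by blast
  have psd: "0 \<le> B c c" for c using insert.prems(2) unfolding B_def by blast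
  have restr: "(\<Sum>i\<in>I. \<Sum>j\<in>I. c i * c j * A i j) = B (c(k := 0)) (c(k := 0))" for c
    unfolding B_def using insert.hyps by (auto intro!: sum.cong)
  have restr1: "(\<Sum>i\<in>I. c i * m i) = (\<Sum>i\<in>?J. (c(k := 0)) i * m i)" for c m :: "'i \<Rightarrow> real"
    using insert.hyps by (auto intro!: sum.cong)
  \<comment> \<open>For \<open>B c c = 0\<close> the quadratic in \<open>t\<close> along the
    \<open>k\<close>-th unit vector is nonnegative without constant term, so its linear coefficient
    vanishes. Hence column \<open>k\<close> is itself an admissible right-hand side for the
    induction hypothesis.\<close>
  have kernel: "(\<Sum>i\<in>?J. c i * A i k) = 0" if "B c c = 0" for c
  proof (rule psd_quadratic_zero)
    fix t :: real
    let ?e = "\<lambda>i. if i = k then 1 else 0 :: real"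
    have e: "(\<Sum>j\<in>?J. ?e j * g j) = g k" for g :: "'i \<Rightarrow> real"
      using insert.hyps by (simp add: if_distrib[of "\<lambda>x. x * _"] cong: if_cong)
    have b1: "B c ?e = (\<Sum>i\<in>?J. c i * A i k)"
    proof -
      have "B c ?e = (\<Sum>i\<in>?J. c i * (\<Sum>j\<in>?J. ?e j * A i j))"
        unfolding B_def by (simp add: sum_distrib_left mult.assoc)
      then show ?thesis by (simp only: e)
    qed
    have b2: "B ?e c = (\<Sum>i\<in>?J. c i * A i k)"
    proof -
      have "B ?e c = (\<Sum>i\<in>?J. ?e i * (\<Sum>j\<in>?J. c j * A i j))"
        unfolding B_def by (simp add: sum_distrib_left mult.assoc)
      also have "\<dots> = (\<Sum>j\<in>?J. c j * A k j)" by (rule e)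
      also have "\<dots> = (\<Sum>i\<in>?J. c i * A i k)" by (rule sum.cong) (use sym in auto)
      finally show ?thesis .
    qed
    have "0 \<le> B (\<lambda>i. c i + t * ?e i) (\<lambda>i. c i + t * ?e i)" by (rule psd)
    also have "B (\<lambda>i. c i + t * ?e i) (\<lambda>i. c i + t * ?e i) = B c c + t * B c ?e + t * B ?e c + t\<^sup>2 * B ?e ?e"
      unfolding B_def sum_distrib_left sum.distrib[symmetric]
      by (intro sum.cong refl) (simp add: algebra_simps power2_eq_square)
    finally show "0 \<le> 2 * t * (\<Sum>i\<in>?J. c i * A i k) + t\<^sup>2 * B ?e ?e"
      using that b1 b2 by simp
  qed
  have ex: "\<exists>c. \<forall>i\<in>I. (\<Sum>j\<in>I. c j * A i j) = m i"
    if "\<And>c. B (c(k := 0)) (c(k := 0)) = 0 \<Longrightarrow> (\<Sum>i\<in>?J. (c(k := 0)) i * m i) = 0" for m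
  proof (rule insert.IH)
    show "A i j = A j i" if "i \<in> I" "j \<in> I" for i j using sym that by blast
    show "0 \<le> (\<Sum>i\<in>I. \<Sum>j\<in>I. c i * c j * A i j)" for c unfolding restr by (rule psd)
    show "(\<Sum>i\<in>I. c i * m i) = 0" if "(\<Sum>i\<in>I. \<Sum>j\<in>I. c i * c j * A i j) = 0" for c
      using that \<open>\<And>c. B (c(k := 0)) (c(k := 0)) = 0 \<Longrightarrow> (\<Sum>i\<in>?J. (c(k := 0)) i * m i) = 0\<close>[of c]
      unfolding restr restr1[of c m] by blast
  qed
  obtain c where c: "\<And>i. i \<in> I \<Longrightarrow> (\<Sum>j\<in>I. c j * A i j) = l i"
    using ex[of l] insert.prems(3) unfolding B_def by blast
  obtain d where d: "\<And>i. i \<in> I \<Longrightarrow> (\<Sum>j\<in>I. d j * A i j) = A i k"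
    using ex[of "\<lambda>i. A i k"] kernel by blast
  \<comment> \<open>\<open>c\<close> and \<open>d\<close> solve the system without \<open>k\<close>
    for the right-hand sides \<open>l\<close> and column \<open>k\<close>. Eliminating the old
    unknowns leaves the scalar equation \<open>t * s = r\<close>.\<close>
  define s where "s = A k k - (\<Sum>j\<in>I. d j * A k j)"
  define r where "r = l k - (\<Sum>j\<in>I. c j * A k j)"
  have r: "r = l k - (\<Sum>j\<in>I. d j * l j)"
  proof -
    have "(\<Sum>j\<in>I. d j * l j) = (\<Sum>j\<in>I. \<Sum>i\<in>I. d j * (c i * A j i))"
      by (simp add: c[symmetric] sum_distrib_left)
    also have "\<dots> = (\<Sum>i\<in>I. \<Sum>j\<in>I. d j * (c i * A j i))" by (rule sum.swap)
    also have "\<dots> = (\<Sum>i\<in>I. c i * (\<Sum>j\<in>I. d j * A i j))"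
      unfolding sum_distrib_left by (intro sum.cong refl) (use sym in \<open>auto simp: mult_ac\<close>)
    also have "\<dots> = (\<Sum>i\<in>I. c i * A k i)" using d sym by (auto intro!: sum.cong)
    finally show ?thesis unfolding r_def by simp
  qed
  have "\<exists>t. t * s = r"
  proof (cases "s = 0")
    case True
    \<comment> \<open>The unit vector of \<open>k\<close> minus \<open>d\<close> satisfies
      \<open>B v v = s\<close>. If \<open>s = 0\<close>, it is in the kernel, and the hypothesis on
      \<open>l\<close> gives \<open>r = 0\<close>, so any \<open>t\<close> works.\<close>
    define v where "v i = (if i = k then 1 else - d i)" for i
    have vI: "(\<Sum>j\<in>?J. v j * g j) = g k - (\<Sum>j\<in>I. d j * g j)" for g
    proof -
      have "(\<Sum>j\<in>I. v j * g j) = (\<Sum>j\<in>I. - (d j * g j))"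
        using insert.hyps by (intro sum.cong) (auto simp: v_def)
      then show ?thesis using insert.hyps by (simp add: v_def sum_negf)
    qed
    have "B v v = (\<Sum>i\<in>?J. v i * (\<Sum>j\<in>?J. v j * A i j))"
      unfolding B_def by (simp only: sum_distrib_left mult.assoc)
    also have "\<dots> = s - (\<Sum>i\<in>I. d i * (A i k - (\<Sum>j\<in>I. d j * A i j)))"
      unfolding vI s_def by simp
    also have "\<dots> = 0" using d True by simp
    finally have "(\<Sum>i\<in>?J. v i * l i) = 0" using insert.prems(3) unfolding B_def by blast
    then have "r = 0" using r unfolding vI by simp
    then show ?thesis using True by auto
  next
    case False
    then show ?thesis by (intro exI[of _ "r / s"]) simp
  qed
  then obtain t where t: "t * s = r" by blast
  show ?case
  proof (intro exI[of _ "\<lambda>i. if i = k then t else c i - t * d i"] ballI)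
    fix i assume i: "i \<in> ?J"
    have "(\<Sum>j\<in>?J. (if j = k then t else c j - t * d j) * A i j)
      = t * A i k + (\<Sum>j\<in>I. (if j = k then t else c j - t * d j) * A i j)"
      using insert.hyps by simp
    also have "(\<Sum>j\<in>I. (if j = k then t else c j - t * d j) * A i j) = (\<Sum>j\<in>I. c j * A i j - t * (d j * A i j))"
      using insert.hyps by (intro sum.cong) (auto simp: algebra_simps)
    also have "\<dots> = (\<Sum>j\<in>I. c j * A i j) - t * (\<Sum>j\<in>I. d j * A i j)"
      by (simp add: sum_subtractf sum_distrib_left)
    finally have eq: "(\<Sum>j\<in>?J. (if j = k then t else c j - t * d j) * A i j) =
      t * A i k + ((\<Sum>j\<in>I. c j * A i j) - t * (\<Sum>j\<in>I. d j * A i j))" .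
    show "(\<Sum>j\<in>?J. (if j = k then t else c j - t * d j) * A i j) = l i"
    proof (cases "i = k")
      case True
      then show ?thesis using t unfolding eq s_def r_def by (simp add: algebra_simps)
    next
      case False
      then show ?thesis using i c d unfolding eq by simp
    qed
  qed
qed

section \<open>Disintegration along a direction and the flat measure\<close>

lemma nn_integral_lborel_translate:
  fixes c :: "'a::euclidean_space"
  assumes [measurable]: "f \<in> borel_measurable borel"
  shows "(\<integral>\<^sup>+x. f (x + c) \<partial>lborel) = (\<integral>\<^sup>+x. f x \<partial>lborel)"
proof -
  have "(\<integral>\<^sup>+x. f x \<partial>lborel) = (\<integral>\<^sup>+x. f x \<partial>(distr lborel borel ((+) c)))"
    by (simp add: lborel_distr_plus)
  also have "\<dots> = (\<integral>\<^sup>+x. f (c + x) \<partial>lborel)"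
    by (subst nn_integral_distr) auto
  finally show ?thesis by (simp add: add.commute)
qed

lemma nn_integral_lborel_swap:
  fixes f :: "'a::euclidean_space \<Rightarrow> 'b::euclidean_space \<Rightarrow> ennreal"
  assumes "case_prod f \<in> borel_measurable (borel \<Otimes>\<^sub>M borel)"
  shows "(\<integral>\<^sup>+y. (\<integral>\<^sup>+x. f x y \<partial>lborel) \<partial>lborel) = (\<integral>\<^sup>+x. (\<integral>\<^sup>+y. f x y \<partial>lborel) \<partial>lborel)"
  using assms by (intro lborel_pair.Fubini') (simp cong: measurable_cong_sets add: sets_pair_measure_cong[OF sets_lborel sets_lborel])

text \<open>A normalisation on each line parallel to \<open>v\<close>. Such a weight picks points of
  every line with total mass one, and so integrates over the quotient by \<open>v\<close> without
  coordinates on it.\<close>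

definition unit_weight :: "'a::euclidean_space \<Rightarrow> ('a \<Rightarrow> ennreal) \<Rightarrow> bool" where
  "unit_weight v w \<longleftrightarrow> w \<in> borel_measurable borel \<and> (\<forall>x. (\<integral>\<^sup>+s. w (x + s *\<^sub>R v) \<partial>lborel) = 1)"

text \<open>Tonelli and translation invariance: shifting by \<open>s *\<^sub>R v\<close> turns the
  weight into \<open>w (x - s *\<^sub>R v)\<close>, whose integral over \<open>s\<close> is
  one.\<close>

lemma nn_integral_disintegrate:
  fixes v :: "'a::euclidean_space"
  assumes w: "unit_weight v w" and [measurable]: "F \<in> borel_measurable borel"
  shows "(\<integral>\<^sup>+x. w x * (\<integral>\<^sup>+s. F (x + s *\<^sub>R v) \<partial>lborel) \<partial>lborel) = (\<integral>\<^sup>+x. F x \<partial>lborel)"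
proof -
  have [measurable]: "w \<in> borel_measurable borel" and w1: "\<And>x. (\<integral>\<^sup>+s. w (x + s *\<^sub>R v) \<partial>lborel) = 1"
    using w by (auto simp: unit_weight_def)
  have "(\<integral>\<^sup>+x. w x * (\<integral>\<^sup>+s. F (x + s *\<^sub>R v) \<partial>lborel) \<partial>lborel)
    = (\<integral>\<^sup>+x. (\<integral>\<^sup>+s. w x * F (x + s *\<^sub>R v) \<partial>lborel) \<partial>lborel)"
    by (simp add: nn_integral_cmult)
  also have "\<dots> = (\<integral>\<^sup>+s. (\<integral>\<^sup>+x. w x * F (x + s *\<^sub>R v) \<partial>lborel) \<partial>lborel)"
    by (rule nn_integral_lborel_swap[symmetric]) measurable
  also have "\<dots> = (\<integral>\<^sup>+s. (\<integral>\<^sup>+x. w (x - s *\<^sub>R v) * F x \<partial>lborel) \<partial>lborel)"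
  proof (rule nn_integral_cong)
    fix s :: real
    show "(\<integral>\<^sup>+x. w x * F (x + s *\<^sub>R v) \<partial>lborel) = (\<integral>\<^sup>+x. w (x - s *\<^sub>R v) * F x \<partial>lborel)"
      using nn_integral_lborel_translate[of "\<lambda>x. w (x - s *\<^sub>R v) * F x" "s *\<^sub>R v"] by simp
  qed
  also have "\<dots> = (\<integral>\<^sup>+x. (\<integral>\<^sup>+s. w (x - s *\<^sub>R v) * F x \<partial>lborel) \<partial>lborel)"
    by (rule nn_integral_lborel_swap) measurable
  also have "\<dots> = (\<integral>\<^sup>+x. F x \<partial>lborel)"
  proof (rule nn_integral_cong)
    fix x :: 'a
    have "(\<integral>\<^sup>+s. w (x - s *\<^sub>R v) \<partial>lborel) = (\<integral>\<^sup>+s. w (x + s *\<^sub>R v) \<partial>lborel)"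
      using nn_integral_real_affine[of "\<lambda>s. w (x + s *\<^sub>R v)" "-1" 0] by simp
    then show "(\<integral>\<^sup>+s. w (x - s *\<^sub>R v) * F x \<partial>lborel) = F x"
      by (simp add: nn_integral_multc w1)
  qed
  finally show ?thesis .
qed

text \<open>The projection along \<open>v\<close>, oblique in general; \<open>v = n\<close> with
  \<open>norm n = 1\<close> gives the orthogonal one that occurs in \<open>flat_measure\<close>. For
  \<open>n \<bullet> v = 0\<close> division by zero makes it the identity.\<close>

definition hyper_proj :: "'a::real_inner \<Rightarrow> 'a \<Rightarrow> 'a \<Rightarrow> 'a \<Rightarrow> 'a" where
  "hyper_proj n p v x = x - ((n \<bullet> (x - p)) / (n \<bullet> v)) *\<^sub>R v"

lemma hyper_proj_borel[measurable]:
  fixes n :: "'a::euclidean_space" shows "hyper_proj n p v \<in> borel_measurable borel"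
  unfolding hyper_proj_def[abs_def] divide_inverse
  by (intro borel_measurable_continuous_onI continuous_intros)

lemma hyper_proj_translate:
  "n \<bullet> v \<noteq> 0 \<Longrightarrow> hyper_proj n p v (x + s *\<^sub>R v) = hyper_proj n p v x"
  by (simp add: hyper_proj_def inner_diff_right inner_add_right add_divide_distrib diff_divide_distrib algebra_simps)

lemma hyper_proj_in: "n \<bullet> v \<noteq> 0 \<Longrightarrow> n \<bullet> (hyper_proj n p v x - p) = 0"
  by (simp add: hyper_proj_def inner_diff_right)

text \<open>The quotient grows at unit rate along \<open>v\<close>, so each line spends parameter
  length one in the slab.\<close>

lemma unit_weight_slab:
  fixes n v p :: "'a::euclidean_space"
  assumes "n \<bullet> v \<noteq> 0"
  shows "unit_weight v (\<lambda>x. indicator {0..1} ((n \<bullet> (x - p)) / (n \<bullet> v)))"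
  unfolding unit_weight_def
proof (intro conjI allI)
  fix x :: 'a
  have "(n \<bullet> (x + s *\<^sub>R v - p)) / (n \<bullet> v) = (n \<bullet> (x - p)) / (n \<bullet> v) + 1 * s" for s
    using assms by (simp add: inner_diff_right inner_add_right add_divide_distrib diff_divide_distrib)
  then show "(\<integral>\<^sup>+s. indicator {0..1} ((n \<bullet> (x + s *\<^sub>R v - p)) / (n \<bullet> v)) \<partial>lborel) = 1"
    using nn_integral_real_affine[of "indicator {0..1}" 1 "(n \<bullet> (x - p)) / (n \<bullet> v)"] by simp
qed measurable

text \<open>Averaging along \<open>v\<close> and projecting along \<open>v\<close> onto a hyperplane with unit normal \<open>n\<close> gives the
  surface measure up to the factor \<open>\<bar>n \<bullet> v\<bar>\<close>, independently of the weight.\<close>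

lemma nn_integral_hyper_proj:
  fixes n v p :: "'a::euclidean_space"
  assumes n: "norm n = 1" and nv: "n \<bullet> v \<noteq> 0" and w: "unit_weight v w"
    and [measurable]: "g \<in> borel_measurable borel"
  shows "(\<integral>\<^sup>+x. w x * g (hyper_proj n p v x) \<partial>lborel) =
    ennreal \<bar>n \<bullet> v\<bar> * (\<integral>\<^sup>+x. indicator {0..1} (n \<bullet> (x - p)) * g (hyper_proj n p n x) \<partial>lborel)"
proof -
  have nn: "n \<bullet> n = 1" using n by (simp add: norm_eq_1)
  define wv where "wv x = (indicator {0..1} ((n \<bullet> (x - p)) / (n \<bullet> v)) :: ennreal)" for x
  define wn where "wn x = (indicator {0..1} (n \<bullet> (x - p)) :: ennreal)" for x
  have wv: "unit_weight v wv" unfolding wv_def by (rule unit_weight_slab[OF nv])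
  have wn: "unit_weight n wn" using unit_weight_slab[of n n p] unfolding wn_def by (simp add: nn)
  have [measurable]: "w \<in> borel_measurable borel" using w by (simp add: unit_weight_def)
  have [measurable]: "wv \<in> borel_measurable borel" using wv by (simp add: unit_weight_def)
  have [measurable]: "wn \<in> borel_measurable borel" using wn by (simp add: unit_weight_def)
  have w1: "(\<integral>\<^sup>+s. w (x + s *\<^sub>R v) \<partial>lborel) = 1" for x using w by (simp add: unit_weight_def)
  \<comment> \<open>The tangential offset between the oblique and the orthogonal projection of a
    point at height \<open>s\<close> over the hyperplane.\<close>
  define c where "c s = s *\<^sub>R n - (s / (n \<bullet> v)) *\<^sub>R v" for s
  have nc: "n \<bullet> c s = 0" for s using nv by (simp add: c_def inner_diff_right nn)
  define K where "K = (\<integral>\<^sup>+x. wn x * g (hyper_proj n p n x) \<partial>lborel)"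
  \<comment> \<open>The projection is constant along \<open>v\<close>, so any unit weight may be
    traded for the slab weight \<open>wv\<close>; this is the independence of the weight.\<close>
  have "(\<integral>\<^sup>+x. w x * g (hyper_proj n p v x) \<partial>lborel)
    = (\<integral>\<^sup>+x. wv x * (\<integral>\<^sup>+s. w (x + s *\<^sub>R v) * g (hyper_proj n p v (x + s *\<^sub>R v)) \<partial>lborel) \<partial>lborel)"
    by (rule nn_integral_disintegrate[OF wv, symmetric]) measurable
  also have "\<dots> = (\<integral>\<^sup>+x. wv x * g (hyper_proj n p v x) \<partial>lborel)"
    by (simp add: hyper_proj_translate[OF nv] nn_integral_multc w1)
  also have "\<dots> = (\<integral>\<^sup>+x. wn x * (\<integral>\<^sup>+s. wv (x + s *\<^sub>R n) * g (hyper_proj n p v (x + s *\<^sub>R n)) \<partial>lborel) \<partial>lborel)"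
    by (rule nn_integral_disintegrate[OF wn, symmetric]) measurable
  also have "\<dots> = (\<integral>\<^sup>+x. wn x * (\<integral>\<^sup>+s. indicator {0..1} (s / (n \<bullet> v)) * g (hyper_proj n p n x + c s) \<partial>lborel) \<partial>lborel)"
  proof (rule nn_integral_cong)
    fix x :: 'a
    have e: "x + (- (n \<bullet> (x - p)) + 1 * s) *\<^sub>R n = hyper_proj n p n x + s *\<^sub>R n" for s
      by (simp add: hyper_proj_def nn algebra_simps)
    have e2: "n \<bullet> (hyper_proj n p n x + s *\<^sub>R n - p) = s" for s
      using hyper_proj_in[of n n p x] by (simp add: nn inner_diff_right inner_add_right)
    have e3: "hyper_proj n p v (hyper_proj n p n x + s *\<^sub>R n) = hyper_proj n p n x + c s" for s
      unfolding hyper_proj_def[of n p v] e2 by (simp add: c_def)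
    have "(\<integral>\<^sup>+s. wv (x + s *\<^sub>R n) * g (hyper_proj n p v (x + s *\<^sub>R n)) \<partial>lborel)
      = (\<integral>\<^sup>+s. indicator {0..1} (s / (n \<bullet> v)) * g (hyper_proj n p n x + c s) \<partial>lborel)"
    proof -
      let ?f = "\<lambda>s. wv (x + s *\<^sub>R n) * g (hyper_proj n p v (x + s *\<^sub>R n))"
      have "(\<integral>\<^sup>+s. ?f s \<partial>lborel) = ennreal \<bar>1\<bar> * (\<integral>\<^sup>+s. ?f (- (n \<bullet> (x - p)) + 1 * s) \<partial>lborel)"
        by (rule nn_integral_real_affine) simp_all
      then show ?thesis unfolding e e3 wv_def e2 by simp
    qed
    then show "wn x * (\<integral>\<^sup>+s. wv (x + s *\<^sub>R n) * g (hyper_proj n p v (x + s *\<^sub>R n)) \<partial>lborel) =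
      wn x * (\<integral>\<^sup>+s. indicator {0..1} (s / (n \<bullet> v)) * g (hyper_proj n p n x + c s) \<partial>lborel)" by simp
  qed
  also have "\<dots> = (\<integral>\<^sup>+x. (\<integral>\<^sup>+s. wn x * (indicator {0..1} (s / (n \<bullet> v)) * g (hyper_proj n p n x + c s)) \<partial>lborel) \<partial>lborel)"
    unfolding c_def by (simp add: nn_integral_cmult)
  also have "\<dots> = (\<integral>\<^sup>+s. (\<integral>\<^sup>+x. wn x * (indicator {0..1} (s / (n \<bullet> v)) * g (hyper_proj n p n x + c s)) \<partial>lborel) \<partial>lborel)"
    unfolding c_def by (rule nn_integral_lborel_swap[symmetric]) measurable
  \<comment> \<open>\<open>c s\<close> is parallel to the hyperplane, so translating by it leaves
    \<open>wn\<close> unchanged and absorbs the offset. The parameter interval that remains has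
    length \<open>\<bar>n \<bullet> v\<bar>\<close>.\<close>
  also have "\<dots> = (\<integral>\<^sup>+s. indicator {0..1} (s / (n \<bullet> v)) * K \<partial>lborel)"
  proof (rule nn_integral_cong)
    fix s :: real
    have "(\<integral>\<^sup>+x. wn x * g (hyper_proj n p n x + c s) \<partial>lborel)
      = (\<integral>\<^sup>+x. wn (x + c s) * g (hyper_proj n p n (x + c s)) \<partial>lborel)"
      by (intro nn_integral_cong) (simp add: wn_def hyper_proj_def inner_add_right inner_diff_right nc algebra_simps)
    also have "\<dots> = K" unfolding K_def
      by (rule nn_integral_lborel_translate) measurable
    finally show "(\<integral>\<^sup>+x. wn x * (indicator {0..1} (s / (n \<bullet> v)) * g (hyper_proj n p n x + c s)) \<partial>lborel)
      = indicator {0..1} (s / (n \<bullet> v)) * K"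
      by (cases "s / (n \<bullet> v) \<in> {0..1}") simp_all
  qed
  also have "\<dots> = (\<integral>\<^sup>+s. indicator {0..1} (s / (n \<bullet> v)) \<partial>lborel) * K"
    by (rule nn_integral_multc) measurable
  also have "(\<integral>\<^sup>+s. indicator {0..1} (s / (n \<bullet> v)) \<partial>lborel) = ennreal \<bar>n \<bullet> v\<bar>"
    using nv by (subst nn_integral_real_affine[of _ "n \<bullet> v" 0]) auto
  finally show ?thesis by (simp add: K_def wn_def)
qed

section \<open>Integration against the flat measure as integration over slabs\<close>

lemma flat_measureE:
  fixes S :: "(real^'d) set"
  assumes "S \<noteq> {}" "norm m = 1" "\<And>x y. x \<in> S \<Longrightarrow> y \<in> S \<Longrightarrow> m \<bullet> (x - y) = 0"
  obtains n p where "norm n = 1" "p \<in> S" "\<And>x. x \<in> S \<Longrightarrow> n \<bullet> (x - p) = 0"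
    "flat_measure S = completion (distr (restrict_space lborel
        {y. hyper_proj n p n y \<in> S \<and> 0 \<le> n \<bullet> (y - p) \<and> n \<bullet> (y - p) \<le> 1}) borel (hyper_proj n p n))"
proof -
  define n where "n = (SOME n. norm n = 1 \<and> (\<forall>x\<in>S. \<forall>y\<in>S. n \<bullet> (x - y) = 0))"
  define p where "p = (SOME p. p \<in> S)"
  have n: "norm n = 1 \<and> (\<forall>x\<in>S. \<forall>y\<in>S. n \<bullet> (x - y) = 0)"
    unfolding n_def by (rule someI[of _ m]) (use assms in auto)
  have p: "p \<in> S" unfolding p_def using assms(1) by (meson ex_in_conv someI_ex)
  have "hyper_proj n p n = (\<lambda>y. y - (n \<bullet> (y - p)) *\<^sub>R n)"
    using n by (auto simp: hyper_proj_def norm_eq_1)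
  then have "flat_measure S = completion (distr (restrict_space lborel
        {y. hyper_proj n p n y \<in> S \<and> 0 \<le> n \<bullet> (y - p) \<and> n \<bullet> (y - p) \<le> 1}) borel (hyper_proj n p n))"
    unfolding flat_measure_def Let_def n_def[symmetric] p_def[symmetric] by simp
  then show ?thesis using that n p by blast
qed

lemma nn_integral_flat_aux:
  fixes S :: "(real^'d) set"
  assumes [measurable]: "S \<in> sets borel" "g \<in> borel_measurable borel"
  shows "(\<integral>\<^sup>+x. g x \<partial>completion (distr (restrict_space lborel
      {y. hyper_proj n p n y \<in> S \<and> 0 \<le> n \<bullet> (y - p) \<and> n \<bullet> (y - p) \<le> 1}) borel (hyper_proj n p n)))
   = (\<integral>\<^sup>+x. indicator {0..1} (n \<bullet> (x - p)) * (indicator S (hyper_proj n p n x) * g (hyper_proj n p n x)) \<partial>lborel)"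
proof -
  have [measurable]: "{y. hyper_proj n p n y \<in> S \<and> 0 \<le> n \<bullet> (y - p) \<and> n \<bullet> (y - p) \<le> 1} \<in> sets borel"
    by measurable
  show ?thesis
    by (subst nn_integral_completion, subst nn_integral_distr)
      (auto simp: nn_integral_restrict_space intro!: nn_integral_cong measurable_restrict_space1
        split: split_indicator)
qed

text \<open>Requiring the affine hull to be the whole hyperplane determines the normal up to sign,
  which makes the choices in \<open>flat_measure\<close> comparable with a prescribed pair
  \<open>m\<close>, \<open>q\<close>.\<close>

definition spans_hyperplane :: "(real^'d) set \<Rightarrow> real^'d \<Rightarrow> real^'d \<Rightarrow> bool" where
  "spans_hyperplane S m q \<longleftrightarrow> norm m = 1 \<and> affine hull S = {x. m \<bullet> (x - q) = 0}"

text \<open>The component \<open>d\<close> of \<open>n\<close> orthogonal to \<open>m\<close> is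
  tangent to the hyperplane, on which \<open>x \<mapsto> n \<bullet> x\<close> is constant. Hence
  \<open>n \<bullet> d = 0\<close>, so \<open>d = 0\<close> and \<open>n\<close> is a multiple of
  \<open>m\<close>.\<close>

lemma spans_hyperplane_normal_unique:
  fixes S :: "(real^'d) set"
  assumes "spans_hyperplane S m q" "norm n = 1" "p \<in> S" "\<And>x. x \<in> S \<Longrightarrow> n \<bullet> (x - p) = 0"
  shows "n = m \<or> n = - m"
proof -
  have mm: "m \<bullet> m = 1" "n \<bullet> n = 1" using assms by (auto simp: spans_hyperplane_def norm_eq_1)
  have H: "affine hull S = {x. m \<bullet> (x - q) = 0}" using assms by (simp add: spans_hyperplane_def)
  have "affine {x. n \<bullet> x = n \<bullet> p}" by (rule affine_hyperplane)
  then have "affine hull S \<subseteq> {x. n \<bullet> x = n \<bullet> p}"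
    using assms(4) by (intro hull_minimal) (auto simp: inner_diff_right)
  then have sub: "n \<bullet> x = n \<bullet> p" if "m \<bullet> (x - q) = 0" for x using that unfolding H by blast
  have p: "m \<bullet> (p - q) = 0" using hull_inc[OF assms(3), of affine] H by simp
  define d where "d = n - (n \<bullet> m) *\<^sub>R m"
  have "m \<bullet> (p + d - q) = 0"
    using p mm by (simp add: d_def inner_diff_right inner_add_right inner_commute)
  then have "n \<bullet> d = 0" using sub[of "p + d"] by (simp add: inner_add_right)
  then have sq: "(n \<bullet> m)\<^sup>2 = 1" using mm by (simp add: d_def inner_diff_right power2_eq_square)
  then have "d \<bullet> d = 0" using mm \<open>n \<bullet> d = 0\<close>
    by (simp add: d_def inner_diff_right inner_diff_left power2_eq_square inner_commute)
  then have "n = (n \<bullet> m) *\<^sub>R m" by (simp add: d_def)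
  moreover have "n \<bullet> m = 1 \<or> n \<bullet> m = -1" using sq by (simp add: power2_eq_1_iff)
  ultimately show ?thesis by (metis scaleR_minus1_left scaleR_one)
qed

lemma hyper_proj_change:
  fixes m :: "'a::real_inner"
  assumes "n = m \<or> n = - m" "m \<bullet> (p - q) = 0"
  shows "hyper_proj n p v = hyper_proj m q v"
proof -
  have e: "m \<bullet> p = m \<bullet> q" using assms(2) by (simp add: inner_diff_right)
  show ?thesis using assms(1)
  proof
    assume "n = - m"
    then have "(n \<bullet> (x - p)) / (n \<bullet> v) = (m \<bullet> (x - q)) / (m \<bullet> v)" for x
      by (simp add: inner_diff_right e minus_divide_left)
    then show ?thesis by (simp add: fun_eq_iff hyper_proj_def)
  qed (simp add: fun_eq_iff hyper_proj_def inner_diff_right e)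
qed

text \<open>The surface integral seen from an arbitrary transversal direction. The divergence
  theorem takes \<open>v\<close> as the direction of differentiation, and
  \<open>\<bar>m \<bullet> v\<bar>\<close> becomes the normal component.\<close>

lemma nn_integral_flat_measure:
  fixes S :: "(real^'d) set"
  assumes S: "spans_hyperplane S m q" and [measurable]: "S \<in> sets borel" "g \<in> borel_measurable borel"
    and nv: "m \<bullet> v \<noteq> 0" and w: "unit_weight v w"
  shows "(\<integral>\<^sup>+x. w x * (indicator S (hyper_proj m q v x) * g (hyper_proj m q v x)) \<partial>lborel) =
    ennreal \<bar>m \<bullet> v\<bar> * (\<integral>\<^sup>+x. g x \<partial>flat_measure S)"
proof -
  have H: "affine hull S = {x. m \<bullet> (x - q) = 0}" and m: "norm m = 1"
    using S by (simp_all add: spans_hyperplane_def)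
  have "q \<in> affine hull S" using H by simp
  then have ne: "S \<noteq> {}" by auto
  have inH: "m \<bullet> (x - q) = 0" if "x \<in> S" for x using hull_inc[OF that, of affine] H by simp
  have orth: "m \<bullet> (x - y) = 0" if "x \<in> S" "y \<in> S" for x y
    using inH[OF that(1)] inH[OF that(2)] by (simp add: inner_diff_right)
  obtain n p where np: "norm n = 1" "p \<in> S" "\<And>x. x \<in> S \<Longrightarrow> n \<bullet> (x - p) = 0"
    and fm: "flat_measure S = completion (distr (restrict_space lborel
        {y. hyper_proj n p n y \<in> S \<and> 0 \<le> n \<bullet> (y - p) \<and> n \<bullet> (y - p) \<le> 1}) borel (hyper_proj n p n))"
    using flat_measureE[OF ne m orth] by blast
  have nm: "n = m \<or> n = - m" by (rule spans_hyperplane_normal_unique[OF S np(1,2,3)])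
  have hp: "hyper_proj m q v = hyper_proj n p v"
    using hyper_proj_change[OF nm inH[OF np(2)]] by simp
  have abs: "\<bar>m \<bullet> v\<bar> = \<bar>n \<bullet> v\<bar>" using nm by auto
  show ?thesis unfolding hp abs
    by (subst nn_integral_hyper_proj[OF np(1) _ w, where g="\<lambda>y. indicator S y * g y"])
      (use nv nm in \<open>auto simp: fm nn_integral_flat_aux\<close>)
qed

lemma sets_flat_measure:
  fixes S :: "(real^'d) set"
  assumes "S \<in> sets borel" "A \<in> sets borel"
  shows "A \<in> sets (flat_measure S)"
  unfolding flat_measure_def Let_def using assms by (intro sets_completionI_sets) simp

lemma space_flat_measure[simp]: "space (flat_measure S) = UNIV"
  by (simp add: flat_measure_def Let_def)

lemma borel_measurable_flat_measure:
  "g \<in> borel_measurable borel \<Longrightarrow> g \<in> borel_measurable (flat_measure S)"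
  unfolding flat_measure_def Let_def by (intro measurable_completion) simp

lemma spans_hyperplane_self: "spans_hyperplane S m q \<Longrightarrow> m \<bullet> m = 1"
  by (simp add: spans_hyperplane_def norm_eq_1)

lemma spans_hyperplane_in: "spans_hyperplane S m q \<Longrightarrow> x \<in> S \<Longrightarrow> m \<bullet> (x - q) = 0"
  using hull_inc[of x S affine] by (simp add: spans_hyperplane_def)

text \<open>The normal and the base point chosen by \<open>SOME\<close> in the definition are immaterial.\<close>

lemma nn_integral_flat_measure_slab:
  fixes S :: "(real^'d) set"
  assumes S: "spans_hyperplane S m q" and [measurable]: "S \<in> sets borel" "g \<in> borel_measurable borel"
  shows "(\<integral>\<^sup>+x. g x \<partial>flat_measure S) = (\<integral>\<^sup>+x. indicator {0..1} (m \<bullet> (x - q)) *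
      (indicator S (hyper_proj m q m x) * g (hyper_proj m q m x)) \<partial>lborel)"
  using nn_integral_flat_measure[OF S assms(2,3), of m "\<lambda>x. indicator {0..1} (m \<bullet> (x - q))"]
    unit_weight_slab[of m m q] spans_hyperplane_self[OF S] by simp

lemma emeasure_flat_measure:
  fixes S :: "(real^'d) set"
  assumes S: "spans_hyperplane S m q" and [measurable]: "S \<in> sets borel" "A \<in> sets borel"
  shows "emeasure (flat_measure S) A = emeasure lborel {x. 0 \<le> m \<bullet> (x - q) \<and> m \<bullet> (x - q) \<le> 1 \<and>
     hyper_proj m q m x \<in> S \<and> hyper_proj m q m x \<in> A}" (is "_ = emeasure lborel ?X")
proof -
  have "?X \<in> sets borel" by measurable
  have "emeasure (flat_measure S) A = (\<integral>\<^sup>+x. indicator A x \<partial>flat_measure S)"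
    by (simp add: sets_flat_measure assms)
  also have "\<dots> = (\<integral>\<^sup>+x. indicator ?X x \<partial>lborel)"
  proof -
    have "indicator {0..1} (m \<bullet> (x - q)) * (indicator S (hyper_proj m q m x) * indicator A (hyper_proj m q m x))
      = (indicator ?X x :: ennreal)" for x by (auto split: split_indicator)
    then show ?thesis by (subst nn_integral_flat_measure_slab[OF S]) auto
  qed
  also have "\<dots> = emeasure lborel ?X" by (rule nn_integral_indicator) simp
  finally show ?thesis .
qed

text \<open>A Borel surface set is null exactly if the slab of height one over it is, so
  almost-everywhere statements on a face become statements about Lebesgue measure in the ambient
  space.\<close>

lemma AE_flat_measure_iff:
  fixes S :: "(real^'d) set"
  assumes S: "spans_hyperplane S m q" and [measurable]: "S \<in> sets borel" "Measurable.pred borel P"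
  shows "(AE x in flat_measure S. P x) \<longleftrightarrow> (AE x in lborel.
     0 \<le> m \<bullet> (x - q) \<and> m \<bullet> (x - q) \<le> 1 \<and> hyper_proj m q m x \<in> S \<longrightarrow> P (hyper_proj m q m x))"
proof -
  have A: "{x. \<not> P x} \<in> sets borel" by measurable
  have B: "{x. \<not> (0 \<le> m \<bullet> (x - q) \<and> m \<bullet> (x - q) \<le> 1 \<and> hyper_proj m q m x \<in> S \<longrightarrow> P (hyper_proj m q m x))} \<in> sets borel"
    by measurable
  show ?thesis
    using AE_iff_measurable[of "{x. \<not> P x}" "flat_measure S" P] sets_flat_measure[OF assms(2) A]
      AE_iff_measurable[of "{x. \<not> (0 \<le> m \<bullet> (x - q) \<and> m \<bullet> (x - q) \<le> 1 \<and> hyper_proj m q m x \<in> S \<longrightarrow> P (hyper_proj m q m x))}" lborel]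
      B emeasure_flat_measure[OF S assms(2) A] by (simp add: conj_assoc)
qed

lemma AE_flat_measure_in:
  assumes S: "spans_hyperplane S m q" and "S \<in> sets borel"
  shows "AE x in flat_measure S. x \<in> S"
proof -
  have [measurable]: "S \<in> sets borel" by fact
  show ?thesis by (subst AE_flat_measure_iff[OF S]) (auto)
qed

lemma flat_measure_finite:
  fixes S :: "(real^'d) set"
  assumes S: "spans_hyperplane S m q" and "S \<in> sets borel" and bdd: "bounded S"
  shows "finite_measure (flat_measure S)"
proof
  have [measurable]: "S \<in> sets borel" by fact
  obtain B where B: "\<And>x. x \<in> S \<Longrightarrow> norm x \<le> B" using bdd by (auto simp: bounded_iff)
  have m: "m \<bullet> m = 1" "norm m = 1" using S by (auto simp: spans_hyperplane_def norm_eq_1)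
  let ?X = "{x. 0 \<le> m \<bullet> (x - q) \<and> m \<bullet> (x - q) \<le> 1 \<and> hyper_proj m q m x \<in> S \<and> hyper_proj m q m x \<in> UNIV}"
  \<comment> \<open>A slab point differs from its projection by at most one unit along
    \<open>m\<close>.\<close>
  have "norm x \<le> B + 1" if "x \<in> ?X" for x
  proof -
    have "x = hyper_proj m q m x + (m \<bullet> (x - q)) *\<^sub>R m" by (simp add: hyper_proj_def m)
    then have "norm x \<le> norm (hyper_proj m q m x) + norm ((m \<bullet> (x - q)) *\<^sub>R m)" by (metis norm_triangle_ineq)
    also have "\<dots> \<le> B + 1" using that B m by (intro add_mono) auto
    finally show ?thesis .
  qed
  then have "?X \<subseteq> cball 0 (B + 1)" by (auto simp: dist_norm)
  then have "emeasure lborel ?X \<le> emeasure lborel (cball (0::real^'d) (B + 1))"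
    by (intro emeasure_mono) auto
  also have "\<dots> < \<infinity>" using emeasure_bounded_finite bounded_cball by blast
  finally show "emeasure (flat_measure S) (space (flat_measure S)) \<noteq> \<infinity>"
    using emeasure_flat_measure[OF S, of UNIV] by simp
qed

lemma integrable_flat_measure:
  fixes S :: "(real^'d) set" and g :: "real^'d \<Rightarrow> real"
  assumes S: "spans_hyperplane S m q" "S \<in> sets borel" "bounded S"
    and "g \<in> borel_measurable (flat_measure S)" "\<And>x. x \<in> S \<Longrightarrow> \<bar>g x\<bar> \<le> B"
  shows "integrable (flat_measure S) g"
proof -
  interpret finite_measure "flat_measure S" by (rule flat_measure_finite[OF S])
  show ?thesis
    using AE_flat_measure_in[OF S(1,2)] assms by (intro integrable_const_bound[of _ B]) auto
qed

lemma rpf_bounded_on: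
  fixes g :: "'a::euclidean_space \<Rightarrow> real"
  assumes "real_polynomial_function g" "bounded S"
  shows "\<exists>B. \<forall>x\<in>S. \<bar>g x\<bar> \<le> B"
proof -
  have "compact (g ` closure S)"
    using assms by (intro compact_continuous_image rpf_continuous_on) (auto simp: compact_closure)
  then obtain B where "\<And>y. y \<in> g ` closure S \<Longrightarrow> norm y \<le> B" using compact_imp_bounded bounded_iff by metis
  then show ?thesis using closure_subset by (intro exI[of _ B]) auto
qed

lemma integrable_flat_measure_rpf:
  fixes S :: "(real^'d) set"
  assumes S: "spans_hyperplane S m q" "S \<in> sets borel" "bounded S" and g: "real_polynomial_function g"
  shows "integrable (flat_measure S) g"
  using rpf_bounded_on[OF g S(3)]
  by (auto intro!: integrable_flat_measure[OF S] borel_measurable_flat_measure rpf_borel g)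

text \<open>Positive and negative parts reduce to the nonnegative formula; integrability transfers
  through the same identity applied to the absolute value of \<open>g\<close>.\<close>

lemma integral_flat_measure:
  fixes S :: "(real^'d) set" and g :: "real^'d \<Rightarrow> real" and w :: "real^'d \<Rightarrow> real"
  assumes S: "spans_hyperplane S m q" and Sb: "S \<in> sets borel" and g: "g \<in> borel_measurable borel"
    and int: "integrable (flat_measure S) g"
    and nv: "m \<bullet> v \<noteq> 0" and w: "unit_weight v (\<lambda>x. ennreal (w x))" and w0: "\<And>x. 0 \<le> w x" and wb: "w \<in> borel_measurable borel"
  shows "integrable lborel (\<lambda>x. w x * (indicator S (hyper_proj m q v x) * g (hyper_proj m q v x)))"
      (is "integrable lborel ?F")
    and "(\<integral>x. w x * (indicator S (hyper_proj m q v x) * g (hyper_proj m q v x)) \<partial>lborel)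
      = \<bar>m \<bullet> v\<bar> * (\<integral>x. g x \<partial>flat_measure S)"
proof -
  have [measurable]: "S \<in> sets borel" "g \<in> borel_measurable borel" "w \<in> borel_measurable borel" by fact+
  have nn: "(\<integral>\<^sup>+x. ennreal (w x * (indicator S (hyper_proj m q v x) * h (hyper_proj m q v x))) \<partial>lborel)
      = ennreal \<bar>m \<bullet> v\<bar> * (\<integral>\<^sup>+x. ennreal (h x) \<partial>flat_measure S)"
    if [measurable]: "h \<in> borel_measurable borel" for h
  proof -
    have "ennreal (w x * (indicator S (hyper_proj m q v x) * h (hyper_proj m q v x)))
      = ennreal (w x) * (indicator S (hyper_proj m q v x) * ennreal (h (hyper_proj m q v x)))" for x
      using w0[of x] by (cases "hyper_proj m q v x \<in> S") (auto simp: ennreal_mult')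
    then show ?thesis using nn_integral_flat_measure[OF S Sb _ nv w, of "\<lambda>x. ennreal (h x)"] by simp
  qed
  have F: "integrable lborel ?F"
  proof (rule integrableI_bounded)
    have "norm (?F x) = w x * (indicator S (hyper_proj m q v x) * \<bar>g (hyper_proj m q v x)\<bar>)" for x
      using w0 by (simp add: abs_mult)
    then have "(\<integral>\<^sup>+x. ennreal (norm (?F x)) \<partial>lborel) = ennreal \<bar>m \<bullet> v\<bar> * (\<integral>\<^sup>+x. ennreal \<bar>g x\<bar> \<partial>flat_measure S)"
      using nn[of "\<lambda>x. \<bar>g x\<bar>"] by simp
    also have "\<dots> < \<infinity>" using int by (auto simp: integrable_iff_bounded ennreal_mult_less_top)
    finally show "(\<integral>\<^sup>+x. ennreal (norm (?F x)) \<partial>lborel) < \<infinity>" .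
  qed measurable
  then show "integrable lborel ?F" .
  have neg: "- ?F x = w x * (indicator S (hyper_proj m q v x) * - g (hyper_proj m q v x))" for x by simp
  show "(\<integral>x. ?F x \<partial>lborel) = \<bar>m \<bullet> v\<bar> * (\<integral>x. g x \<partial>flat_measure S)"
    unfolding real_lebesgue_integral_def[OF F] real_lebesgue_integral_def[OF int] neg
    by (subst nn, simp, subst nn, simp) (simp add: enn2real_mult right_diff_distrib)
qed

lemma negligible_aff_dim:
  fixes Z :: "(real^'d) set"
  assumes "aff_dim Z < int CARD('d)"
  shows "negligible Z"
proof -
  obtain n b where "n \<noteq> 0" "Z \<subseteq> {x. n \<bullet> x = b}"
    using aff_lowdim_subset_hyperplane[of Z] assms by auto
  then show ?thesis using negligible_hyperplane[of n b] negligible_subset by blast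
qed

text \<open>All these lines lie in the affine hull of \<open>Z\<close> and one further point, which
  raises the dimension by at most one. Codimension two thus leaves a null set.\<close>

lemma negligible_lines_through:
  fixes Z :: "(real^'d) set"
  assumes "aff_dim Z \<le> int CARD('d) - 2"
  shows "negligible {x. \<exists>s. x + s *\<^sub>R v \<in> Z}"
proof (cases "Z = {}")
  case False
  then obtain a where a: "a \<in> Z" by blast
  let ?A = "affine hull (insert (a + v) Z)"
  have "aff_dim ?A \<le> int CARD('d) - 1" using assms by (simp add: aff_dim_insert)
  then have "negligible ?A" by (intro negligible_aff_dim) simp
  moreover have "{x. \<exists>s. x + s *\<^sub>R v \<in> Z} \<subseteq> ?A"
  proof safe
    fix x s assume z: "x + s *\<^sub>R v \<in> Z"
    have in3: "x + s *\<^sub>R v \<in> ?A" "a \<in> ?A" "a + v \<in> ?A" using z a by (auto intro: hull_inc)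
    have "(x + s *\<^sub>R v) + s *\<^sub>R (a - (a + v)) \<in> ?A"
      using mem_affine_3_minus[OF affine_affine_hull in3] by blast
    then show "x \<in> ?A" by (simp add: algebra_simps)
  qed
  ultimately show ?thesis by (rule negligible_subset)
qed simp

lemma AE_lborel_negligible:
  fixes Z :: "'a::euclidean_space set"
  assumes "negligible Z"
  shows "AE x in lborel. x \<notin> Z"
proof -
  have "Z \<in> null_sets (completion lborel)" using assms by (simp add: negligible_iff_null_sets)
  then have "AE x in completion lborel. x \<notin> Z" by (rule AE_not_in)
  then show ?thesis by (simp add: AE_completion_iff)
qed

text \<open>If \<open>g x\<close> were nonzero, it would stay so on a relative neighbourhood of
  \<open>x\<close>, and the slab over that neighbourhood contains a nonempty open set, which is not
  null.\<close>

lemma AE_flat_measure_zero_imp: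
  fixes S :: "(real^'d) set"
  assumes S: "spans_hyperplane S m q" "S \<in> sets borel" and g: "real_polynomial_function g"
    and ae: "AE x in flat_measure S. g x = 0" and x: "x \<in> rel_interior S"
  shows "g x = 0"
proof (rule ccontr)
  assume gx: "g x \<noteq> 0"
  have m: "m \<bullet> m = 1" "norm m = 1" using S by (auto simp: spans_hyperplane_def norm_eq_1)
  have xq: "m \<bullet> (x - q) = 0"
    using spans_hyperplane_in[OF S(1)] rel_interior_subset x by blast
  obtain r where r: "r > 0" "ball x r \<inter> affine hull S \<subseteq> S"
    using x mem_rel_interior_ball by blast
  have [measurable]: "g \<in> borel_measurable borel" "S \<in> sets borel" using g rpf_borel S by auto
  let ?U = "{y. 0 < m \<bullet> (y - q) \<and> m \<bullet> (y - q) < 1 \<and> dist x (hyper_proj m q m y) < r \<and> g (hyper_proj m q m y) \<noteq> 0}"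
  have hpc: "continuous_on UNIV (hyper_proj m q m)"
    unfolding hyper_proj_def[abs_def] divide_inverse by (intro continuous_intros)
  have gc: "continuous_on UNIV (\<lambda>y. g (hyper_proj m q m y))"
    using continuous_on_compose2[OF rpf_continuous_on[OF g, of UNIV] hpc] by simp
  have "open ?U"
    by (intro open_Collect_conj open_Collect_less open_Collect_neq continuous_intros gc hpc)
  \<comment> \<open>Half height puts the point over \<open>x\<close> strictly inside the
    slab.\<close>
  moreover have "x + (1/2) *\<^sub>R m \<in> ?U"
  proof -
    have "hyper_proj m q m (x + (1/2) *\<^sub>R m) = x"
      using hyper_proj_translate[of m m q x "1/2"] m xq by (simp add: hyper_proj_def)
    then show ?thesis using r gx xq m by (simp add: inner_diff_right inner_add_right)
  qed
  moreover have "AE y in lborel. y \<notin> ?U"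
  proof -
    have "AE y in lborel. 0 \<le> m \<bullet> (y - q) \<and> m \<bullet> (y - q) \<le> 1 \<and> hyper_proj m q m y \<in> S \<longrightarrow> g (hyper_proj m q m y) = 0"
      using ae by (subst (asm) AE_flat_measure_iff[OF S]) auto
    moreover have "hyper_proj m q m y \<in> S" if "dist x (hyper_proj m q m y) < r" for y
    proof -
      have "hyper_proj m q m y \<in> affine hull S"
        using S(1) hyper_proj_in[of m m q y] m by (simp add: spans_hyperplane_def)
      then show ?thesis using r(2) that by auto
    qed
    ultimately show ?thesis by (auto elim!: eventually_mono)
  qed
  ultimately show False
    using open_not_negligible[of ?U] AE_iff_null_sets[of ?U lborel]
    by (auto simp: negligible_iff_null_sets intro: null_sets_completionI)
qed

text \<open>The inner integral need not converge for every \<open>x\<close>. Positive and negative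
  parts are therefore disintegrated in \<open>ennreal\<close> and subtracted only where both are
  finite, which is almost everywhere after weighting.\<close>

lemma integral_disintegrate:
  fixes v :: "'a::euclidean_space" and F w :: "'a \<Rightarrow> real"
  assumes w: "unit_weight v (\<lambda>x. ennreal (w x))" and w0: "\<And>x. 0 \<le> w x" and wb: "w \<in> borel_measurable borel"
    and F: "integrable lborel F"
  shows "(\<integral>x. w x * (\<integral>s. F (x + s *\<^sub>R v) \<partial>lborel) \<partial>lborel) = (\<integral>x. F x \<partial>lborel)"
proof -
  have [measurable]: "F \<in> borel_measurable borel" using F by (simp add: borel_measurable_integrable)
  have [measurable]: "w \<in> borel_measurable borel" by fact
  define P where "P G x = (\<integral>\<^sup>+s. ennreal (G (x + s *\<^sub>R v)) \<partial>lborel)" for G :: "'a \<Rightarrow> real" and x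
  have D: "(\<integral>\<^sup>+x. ennreal (w x) * P G x \<partial>lborel) = (\<integral>\<^sup>+x. ennreal (G x) \<partial>lborel)"
    if [measurable]: "G \<in> borel_measurable borel" for G
    unfolding P_def by (rule nn_integral_disintegrate[OF w]) measurable
  have [measurable]: "P G \<in> borel_measurable borel" if [measurable]: "G \<in> borel_measurable borel" for G
    unfolding P_def by measurable
  let ?N = "\<lambda>x. - F x"
  have fin: "(\<integral>\<^sup>+x. ennreal (F x) \<partial>lborel) < \<infinity>" "(\<integral>\<^sup>+x. ennreal (?N x) \<partial>lborel) < \<infinity>"
    using integrableD(2)[OF F] integrableD(3)[OF F] by (auto simp: less_top)
  have aeP: "AE x in lborel. ennreal (w x) * P G x \<noteq> \<infinity>"
    if [measurable]: "G \<in> borel_measurable borel" and "(\<integral>\<^sup>+x. ennreal (G x) \<partial>lborel) < \<infinity>" for G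
    using that by (intro nn_integral_noteq_infinite) (auto simp: D)
  have int: "integrable lborel (\<lambda>x. enn2real (ennreal (w x) * P G x))"
      "(\<integral>x. enn2real (ennreal (w x) * P G x) \<partial>lborel) = enn2real (\<integral>\<^sup>+x. ennreal (G x) \<partial>lborel)"
    if [measurable]: "G \<in> borel_measurable borel" and f: "(\<integral>\<^sup>+x. ennreal (G x) \<partial>lborel) < \<infinity>" for G
  proof -
    have e: "(\<integral>\<^sup>+x. ennreal (enn2real (ennreal (w x) * P G x)) \<partial>lborel) = (\<integral>\<^sup>+x. ennreal (G x) \<partial>lborel)"
      unfolding D[OF that(1), symmetric]
      by (rule nn_integral_cong_AE) (use aeP[OF that] in \<open>auto elim!: eventually_mono simp: less_top\<close>)
    show "integrable lborel (\<lambda>x. enn2real (ennreal (w x) * P G x))"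
      using f e by (intro integrableI_nonneg) auto
    show "(\<integral>x. enn2real (ennreal (w x) * P G x) \<partial>lborel) = enn2real (\<integral>\<^sup>+x. ennreal (G x) \<partial>lborel)"
      by (subst integral_eq_nn_integral) (auto simp: e)
  qed
  have "(\<integral>x. w x * (\<integral>s. F (x + s *\<^sub>R v) \<partial>lborel) \<partial>lborel)
    = (\<integral>x. enn2real (ennreal (w x) * P F x) - enn2real (ennreal (w x) * P ?N x) \<partial>lborel)"
  proof (rule integral_cong_AE)
    have "AE x in lborel. ennreal (w x) * P F x \<noteq> \<infinity>" "AE x in lborel. ennreal (w x) * P ?N x \<noteq> \<infinity>"
      by (rule aeP; use fin in simp)+
    then show "AE x in lborel. w x * (\<integral>s. F (x + s *\<^sub>R v) \<partial>lborel) =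
        enn2real (ennreal (w x) * P F x) - enn2real (ennreal (w x) * P ?N x)"
    proof eventually_elim
      case (elim x)
      show ?case
      \<comment> \<open>Where the weight vanishes the inner integrand may fail to be integrable, but
        its value is multiplied by zero.\<close>
      proof (cases "w x = 0")
        case False
        then have wx: "0 < ennreal (w x)" using w0[of x] by (simp add: order_less_le)
        then have PN: "P F x \<noteq> \<infinity>" "P ?N x \<noteq> \<infinity>"
          using elim by (auto simp: ennreal_mult_eq_top_iff)
        have i: "integrable lborel (\<lambda>s. F (x + s *\<^sub>R v))"
          unfolding real_integrable_def using PN by (simp add: P_def)
        show ?thesis
          using w0[of x] unfolding real_lebesgue_integral_def[OF i] P_def[symmetric]
          by (simp add: P_def enn2real_mult right_diff_distrib)
      qed simp
    qed
  qed measurable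
  also have "\<dots> = enn2real (\<integral>\<^sup>+x. ennreal (F x) \<partial>lborel) - enn2real (\<integral>\<^sup>+x. ennreal (?N x) \<partial>lborel)"
    using fin by (subst Bochner_Integration.integral_diff) (auto intro!: int simp: int(2))
  also have "\<dots> = (\<integral>x. F x \<partial>lborel)" using F by (rule real_lebesgue_integral_def[symmetric])
  finally show ?thesis .
qed

section \<open>Polyhedral cells and the codimension-two skeleton\<close>

lemma polyhedral_cell_compact: "polyhedral_cell S \<Longrightarrow> compact S"
  unfolding polyhedral_cell_def by (auto simp: polytope_imp_compact)

lemma polyhedral_cell_borel: "polyhedral_cell S \<Longrightarrow> S \<in> sets borel"
  by (simp add: borel_compact polyhedral_cell_compact)

lemma polyhedral_cell_rel_interior_nonempty: "polyhedral_cell S \<Longrightarrow> rel_interior S \<noteq> {}"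
  unfolding polyhedral_cell_def by (metis closure_empty)

lemma polyhedral_cell_closure: "polyhedral_cell S \<Longrightarrow> closure (rel_interior S) = S"
  unfolding polyhedral_cell_def by simp

text \<open>A piece of the dimension of \<open>e\<close> has the same affine hull, so its relative
  interior lies in that of \<open>e\<close>. Relative boundary points are thus on facets of such
  pieces or on pieces of lower dimension.\<close>

lemma polyhedral_cell_skeleton:
  fixes e :: "(real^'d) set"
  assumes e: "polyhedral_cell e" "aff_dim e = int CARD('d) - 1"
  shows "\<exists>\<Z>. finite \<Z> \<and> (\<forall>Z\<in>\<Z>. aff_dim Z \<le> int CARD('d) - 2) \<and> e - rel_interior e \<subseteq> \<Union>\<Z>"
proof -
  obtain \<P> where P: "finite \<P>" "\<And>P. P \<in> \<P> \<Longrightarrow> polytope P" "e = \<Union>\<P>"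
    using e(1) unfolding polyhedral_cell_def by blast
  define \<Z> where "\<Z> = {P\<in>\<P>. aff_dim P \<le> int CARD('d) - 2} \<union>
     (\<Union>P\<in>{P\<in>\<P>. aff_dim P = int CARD('d) - 1}. {F. F facet_of P})"
  have "finite \<Z>" unfolding \<Z>_def using P finite_polyhedron_facets polytope_imp_polyhedron by auto
  moreover have "aff_dim Z \<le> int CARD('d) - 2" if "Z \<in> \<Z>" for Z
    using that unfolding \<Z>_def facet_of_def by auto
  moreover have "x \<in> \<Union>\<Z>" if x: "x \<in> e" "x \<notin> rel_interior e" for x
  proof -
    obtain Q where Q: "Q \<in> \<P>" "x \<in> Q" using x P by blast
    have sub: "Q \<subseteq> e" using Q P by blast
    have le: "aff_dim Q \<le> int CARD('d) - 1" using aff_dim_subset[OF sub] e by simp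
    show ?thesis
    proof (cases "aff_dim Q = int CARD('d) - 1")
      case True
      then have "affine hull Q = affine hull e" using aff_dim_eq_full_gen[OF sub] e by simp
      then have "x \<in> Q - rel_interior Q" using subset_rel_interior[OF sub] x Q by blast
      then obtain F where "F facet_of Q" "x \<in> F"
        using rel_boundary_of_polyhedron[of Q] P(2) Q(1) polytope_imp_polyhedron by auto
      then show ?thesis unfolding \<Z>_def using True Q(1) by blast
    next
      case False
      then have "Q \<in> \<Z>" unfolding \<Z>_def using Q le by auto
      then show ?thesis using Q by blast
    qed
  qed
  ultimately show ?thesis by blast
qed

text \<open>Besides the relative boundaries, intersections of edges in different hyperplanes are
  removed. Two coplanar edges cannot meet elsewhere: near a common point the relative interior of
  one would contain relative interior points of the other.\<close>

lemma cells_skeleton: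
  fixes \<E> :: "(real^'d) set set"
  assumes fin: "finite \<E>"
    and cell: "\<And>e. e \<in> \<E> \<Longrightarrow> polyhedral_cell e" "\<And>e. e \<in> \<E> \<Longrightarrow> aff_dim e = int CARD('d) - 1"
    and disj: "\<And>e e'. e \<in> \<E> \<Longrightarrow> e' \<in> \<E> \<Longrightarrow> e \<noteq> e' \<Longrightarrow> rel_interior e \<inter> rel_interior e' = {}"
  obtains \<Z> where "finite \<Z>" "\<And>Z. Z \<in> \<Z> \<Longrightarrow> aff_dim Z \<le> int CARD('d) - 2"
    "\<And>x e. e \<in> \<E> \<Longrightarrow> x \<in> e \<Longrightarrow> x \<notin> \<Union>\<Z> \<Longrightarrow> x \<in> rel_interior e"
    "\<And>x e e'. e \<in> \<E> \<Longrightarrow> e' \<in> \<E> \<Longrightarrow> x \<in> e \<Longrightarrow> x \<in> e' \<Longrightarrow> x \<notin> \<Union>\<Z> \<Longrightarrow> e = e'"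
proof -
  define is_skel where "is_skel e \<Z> \<longleftrightarrow> finite \<Z> \<and> (\<forall>Z\<in>\<Z>. aff_dim Z \<le> int CARD('d) - 2) \<and> e - rel_interior e \<subseteq> \<Union>\<Z>"
    for e :: "(real^'d) set" and \<Z>
  have "\<exists>\<Z>. is_skel e \<Z>" if "e \<in> \<E>" for e
    unfolding is_skel_def by (rule polyhedral_cell_skeleton[OF cell[OF that]])
  then obtain \<Z>e where "\<And>e. e \<in> \<E> \<Longrightarrow> is_skel e (\<Z>e e)" by metis
  then have Ze: "\<And>e. e \<in> \<E> \<Longrightarrow> finite (\<Z>e e)"
      "\<And>e Z. e \<in> \<E> \<Longrightarrow> Z \<in> \<Z>e e \<Longrightarrow> aff_dim Z \<le> int CARD('d) - 2"
      "\<And>e. e \<in> \<E> \<Longrightarrow> e - rel_interior e \<subseteq> \<Union>(\<Z>e e)" unfolding is_skel_def by blast+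
  define \<Z> where "\<Z> = (\<Union>e\<in>\<E>. \<Z>e e) \<union>
    (\<lambda>(e, e'). e \<inter> e') ` {(e, e'). e \<in> \<E> \<and> e' \<in> \<E> \<and> affine hull e \<noteq> affine hull e'}"
  have "finite {(e, e'). e \<in> \<E> \<and> e' \<in> \<E> \<and> affine hull e \<noteq> affine hull e'}"
    by (rule finite_subset[of _ "\<E> \<times> \<E>"]) (use fin in auto)
  then have 1: "finite \<Z>" unfolding \<Z>_def using fin Ze(1) by auto
  have dim: "aff_dim (e \<inter> e') \<le> int CARD('d) - 2"
    if e: "e \<in> \<E>" "e' \<in> \<E>" "affine hull e \<noteq> affine hull e'" for e e'
  proof -
    \<comment> \<open>Both edges have the same dimension, so an intersection spanning one hull would
      span the other and make the hulls equal.\<close>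
    have "affine hull (e \<inter> e') \<noteq> affine hull e"
    proof
      assume eq: "affine hull (e \<inter> e') = affine hull e"
      then have "aff_dim (e \<inter> e') = aff_dim e'" using e cell(2) by (metis aff_dim_affine_hull)
      then have "affine hull (e \<inter> e') = affine hull e'" using aff_dim_eq_full_gen[of "e \<inter> e'" e'] by simp
      then show False using eq e by simp
    qed
    then have "affine hull (e \<inter> e') \<subset> affine hull e" using hull_mono[of "e \<inter> e'" e affine] by blast
    then have "aff_dim (e \<inter> e') < aff_dim e" by (rule aff_dim_psubset)
    then show ?thesis using cell(2)[OF e(1)] by simp
  qed
  have 2: "aff_dim Z \<le> int CARD('d) - 2" if "Z \<in> \<Z>" for Z
  proof -
    consider e where "e \<in> \<E>" "Z \<in> \<Z>e e"
      | e e' where "e \<in> \<E>" "e' \<in> \<E>" "affine hull e \<noteq> affine hull e'" "Z = e \<inter> e'"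
      using \<open>Z \<in> \<Z>\<close> unfolding \<Z>_def by blast
    then show ?thesis
    proof cases
      case 1 then show ?thesis by (rule Ze(2))
    next
      case 2 show ?thesis unfolding 2(4) by (rule dim[OF 2(1,2,3)])
    qed
  qed
  have 3: "x \<in> rel_interior e" if "e \<in> \<E>" "x \<in> e" "x \<notin> \<Union>\<Z>" for x e
  proof (rule ccontr)
    assume "x \<notin> rel_interior e"
    then have "x \<in> \<Union>(\<Z>e e)" using Ze(3)[OF that(1)] that(2) by blast
    moreover have "\<Union>(\<Z>e e) \<subseteq> \<Union>\<Z>" unfolding \<Z>_def using that(1) by (intro Union_mono) auto
    ultimately show False using that(3) by (meson subsetD)
  qed
  have 4: "e = e'" if e: "e \<in> \<E>" "e' \<in> \<E>" "x \<in> e" "x \<in> e'" "x \<notin> \<Union>\<Z>" for x e e'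
  proof (rule ccontr)
    assume ne: "e \<noteq> e'"
    have hull: "affine hull e = affine hull e'"
    proof (rule ccontr)
      assume "affine hull e \<noteq> affine hull e'"
      then have "e \<inter> e' \<in> \<Z>" unfolding \<Z>_def using e by (intro UnI2 image_eqI[of _ _ "(e, e')"]) auto
      then show False using e(3,4,5) by (meson IntI UnionI)
    qed
    obtain r where r: "r > 0" "ball x r \<inter> affine hull e \<subseteq> rel_interior e"
      using openin_rel_interior[of e] 3[OF e(1,3,5)] unfolding openin_contains_ball by (metis inf_commute)
    have "x \<in> closure (rel_interior e')" using polyhedral_cell_closure[OF cell(1)[OF e(2)]] e by simp
    then obtain y where y: "y \<in> rel_interior e'" "dist y x < r" using r(1) closure_approachable by blast
    have "y \<in> affine hull e" using y(1) rel_interior_subset hull_subset hull by (metis subsetD)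
    then have "y \<in> rel_interior e" using r(2) y(2) by (auto simp: dist_commute)
    then show False using y(1) disj[OF e(1,2) ne] by blast
  qed
  show ?thesis by (rule that[OF 1 2 3 4])
qed

lemma spans_hyperplane_cell:
  fixes e :: "(real^'d) set"
  assumes "aff_dim e = int CARD('d) - 1" "norm n = 1" "\<And>x y. x \<in> e \<Longrightarrow> y \<in> e \<Longrightarrow> n \<bullet> (x - y) = 0" "q \<in> e"
  shows "spans_hyperplane e n q"
proof -
  have eq: "{x. n \<bullet> (x - q) = 0} = {x. n \<bullet> x = n \<bullet> q}" by (auto simp: inner_diff_right)
  have n0: "n \<noteq> 0" using assms by auto
  have "affine hull e = {x. n \<bullet> x = n \<bullet> q}"
  proof (rule affine_dim_equal)
    have "e \<subseteq> {x. n \<bullet> x = n \<bullet> q}" using assms(3)[OF _ assms(4)] by (auto simp: inner_diff_right)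
    then show "affine hull e \<subseteq> {x. n \<bullet> x = n \<bullet> q}" by (intro hull_minimal affine_hyperplane)
    show "aff_dim (affine hull e) = aff_dim {x. n \<bullet> x = n \<bullet> q}" using assms(1) n0 by simp
  qed (use assms(4) affine_hyperplane in auto)
  then show ?thesis using assms(2) unfolding spans_hyperplane_def eq by simp
qed

lemma is_outward_normal_spans:
  fixes e :: "(real^'d) set"
  assumes "aff_dim e = int CARD('d) - 1" "is_outward_normal T e n" "q \<in> e"
  shows "spans_hyperplane e n q"
  using assms by (intro spans_hyperplane_cell) (auto simp: is_outward_normal_def)

text \<open>The direction is determined up to sign, and opposite signs would put one point both into
  the interior of \<open>T\<close> and outside \<open>T\<close>. This gives the \<open>THE\<close>
  in \<open>outward_normal\<close> its meaning.\<close>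

lemma is_outward_normal_unique:
  fixes e :: "(real^'d) set"
  assumes "aff_dim e = int CARD('d) - 1" "rel_interior e \<noteq> {}" "is_outward_normal T e n" "is_outward_normal T e m"
  shows "n = m"
proof -
  obtain x where x: "x \<in> rel_interior e" using assms(2) by blast
  then have xe: "x \<in> e" using rel_interior_subset by blast
  have "n = m \<or> n = - m"
    by (rule spans_hyperplane_normal_unique[OF is_outward_normal_spans[OF assms(1,4) xe], of n x])
      (use assms(3) xe in \<open>auto simp: is_outward_normal_def\<close>)
  moreover have "n \<noteq> - m"
  proof
    assume nm: "n = - m"
    obtain d1 where d1: "d1 > 0" "\<And>t. 0 < t \<Longrightarrow> t < d1 \<Longrightarrow> x - t *\<^sub>R n \<in> interior T"
      using assms(3) x unfolding is_outward_normal_def by blast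
    obtain d2 where d2: "d2 > 0" "\<And>t. 0 < t \<Longrightarrow> t < d2 \<Longrightarrow> x + t *\<^sub>R m \<notin> T"
      using assms(4) x unfolding is_outward_normal_def by blast
    define t where "t = min d1 d2 / 2"
    have "0 < t" "t < d1" "t < d2" using d1(1) d2(1) by (auto simp: t_def)
    then show False using d1(2)[of t] d2(2)[of t] nm interior_subset by auto
  qed
  ultimately show ?thesis by blast
qed

lemma outward_normal_eq:
  fixes e :: "(real^'d) set"
  assumes "aff_dim e = int CARD('d) - 1" "rel_interior e \<noteq> {}" "is_outward_normal T e n"
  shows "outward_normal T e = n"
  unfolding outward_normal_def using assms is_outward_normal_unique by (intro the_equality) blast+

section \<open>The divergence theorem on polyhedral cells\<close>

text \<open>A frontier point outside the exceptional pieces \<open>\<Z>\<close> lies in the relative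
  interior of exactly one edge. \<open>\<Z>\<close> may exceed the element's own skeleton, so that
  of the whole mesh can be used.\<close>

locale cell_boundary =
  fixes T :: "(real^'d) set" and \<F> :: "(real^'d) set set" and \<nu> :: "(real^'d) set \<Rightarrow> real^'d"
    and \<Z> :: "(real^'d) set set"
  assumes T: "compact T"
    and fin: "finite \<F>"
    and cell: "\<And>e. e \<in> \<F> \<Longrightarrow> polyhedral_cell e" "\<And>e. e \<in> \<F> \<Longrightarrow> aff_dim e = int CARD('d) - 1"
    and frontier: "frontier T = \<Union>\<F>"
    and normal: "\<And>e. e \<in> \<F> \<Longrightarrow> is_outward_normal T e (\<nu> e)"
    and skel: "finite \<Z>" "\<And>Z. Z \<in> \<Z> \<Longrightarrow> aff_dim Z \<le> int CARD('d) - 2"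
    and skel_int: "\<And>x e. e \<in> \<F> \<Longrightarrow> x \<in> e \<Longrightarrow> x \<notin> \<Union>\<Z> \<Longrightarrow> x \<in> rel_interior e"
    and skel_unique: "\<And>x e e'. e \<in> \<F> \<Longrightarrow> e' \<in> \<F> \<Longrightarrow> x \<in> e \<Longrightarrow> x \<in> e' \<Longrightarrow> x \<notin> \<Union>\<Z> \<Longrightarrow> e = e'"
begin

definition base :: "(real^'d) set \<Rightarrow> real^'d" where
  "base e = (SOME q. q \<in> e)"

lemma base: "e \<in> \<F> \<Longrightarrow> base e \<in> e"
  unfolding base_def using polyhedral_cell_rel_interior_nonempty[OF cell(1)] rel_interior_subset
  by (metis all_not_in_conv someI_ex subsetD)

lemma spans: "e \<in> \<F> \<Longrightarrow> spans_hyperplane e (\<nu> e) (base e)"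
  using is_outward_normal_spans[OF cell(2) normal base] by blast

text \<open>Near \<open>z\<close> the frontier consists of points of \<open>e\<close> only. Each
  open half ball is connected and free of frontier points, hence entirely inside or outside
  \<open>T\<close>; a point on the normal through \<open>z\<close> decides which.\<close>

lemma local_half_space:
  assumes e: "e \<in> \<F>" "z \<in> e" "z \<notin> \<Union>\<Z>"
  shows "\<exists>r>0. \<forall>y. dist z y < r \<longrightarrow>
    (\<nu> e \<bullet> (y - z) < 0 \<longrightarrow> y \<in> interior T) \<and> (\<nu> e \<bullet> (y - z) > 0 \<longrightarrow> y \<notin> T)"
proof -
  have "closed (\<Union>(\<F> - {e}))" using fin cell(1) polyhedral_cell_compact
    by (intro closed_Union) (auto intro: compact_imp_closed)
  moreover have "z \<notin> \<Union>(\<F> - {e})" using skel_unique e by blast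
  ultimately obtain r where r: "r > 0" "ball z r \<subseteq> - \<Union>(\<F> - {e})"
    using open_contains_ball[of "- \<Union>(\<F> - {e})"] unfolding open_closed double_compl by blast
  have fr: "\<nu> e \<bullet> (y - z) = 0" if "y \<in> ball z r" "y \<in> frontier T" for y
  proof -
    have "y \<in> e" using that r(2) frontier by blast
    then show ?thesis using normal[OF e(1)] e(2) unfolding is_outward_normal_def by blast
  qed
  have n1: "\<nu> e \<bullet> \<nu> e = 1" using spans_hyperplane_self[OF spans[OF e(1)]] .
  obtain d where d: "d > 0" "\<And>t. 0 < t \<Longrightarrow> t < d \<Longrightarrow> z - t *\<^sub>R \<nu> e \<in> interior T \<and> z + t *\<^sub>R \<nu> e \<notin> T"
    using normal[OF e(1)] skel_int[OF e] unfolding is_outward_normal_def by blast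
  define t where "t = min d r / 2"
  have t: "0 < t" "t < d" "t < r" using d(1) r(1) by (auto simp: t_def)
  define Bm where "Bm = ball z r \<inter> {y. \<nu> e \<bullet> y < \<nu> e \<bullet> z}"
  define Bp where "Bp = ball z r \<inter> {y. \<nu> e \<bullet> y > \<nu> e \<bullet> z}"
  have norm1: "norm (\<nu> e) = 1" using n1 by (simp add: norm_eq_1)
  have conn: "connected Bm" "connected Bp" unfolding Bm_def Bp_def
    by (auto intro!: convex_connected convex_Int convex_halfspace_lt convex_halfspace_gt)
  have nofr: "Bm \<inter> frontier T = {}" "Bp \<inter> frontier T = {}"
    unfolding Bm_def Bp_def using fr by (force simp: inner_diff_right)+
  have zm: "z - t *\<^sub>R \<nu> e \<in> Bm" "z + t *\<^sub>R \<nu> e \<in> Bp"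
    using t norm1 n1 unfolding Bm_def Bp_def by (auto simp: dist_norm inner_diff_right inner_add_right)
  have "Bm - T = {}"
    using connected_Int_frontier[OF conn(1), of T] nofr(1) zm(1) d(2)[OF t(1,2)] interior_subset by blast
  then have m: "Bm \<subseteq> interior T"
    using nofr(1) compact_imp_closed[OF T] unfolding frontier_def by auto
  have "Bp \<inter> T = {}"
    using connected_Int_frontier[OF conn(2), of T] nofr(2) zm(2) d(2)[OF t(1,2)] by blast
  then show ?thesis using m r(1) unfolding Bm_def Bp_def
    by (intro exI[of _ r]) (auto simp: inner_diff_right)
qed

section \<open>Signed crossings of a generic line with the boundary of \<open>T\<close>\<close>

context
  fixes v x :: "real^'d"
  assumes v: "v \<noteq> 0"
    and generic: "\<And>s. x + s *\<^sub>R v \<notin> \<Union>\<Z>"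
    and transversal: "\<And>e. e \<in> \<F> \<Longrightarrow> \<nu> e \<bullet> v = 0 \<Longrightarrow> \<nu> e \<bullet> (x - base e) \<noteq> 0"
begin

text \<open>Edges parallel to \<open>v\<close> are left out; by \<open>transversal\<close> the line
  misses their hyperplanes.\<close>

definition "hits = {e\<in>\<F>. \<nu> e \<bullet> v \<noteq> 0 \<and> hyper_proj (\<nu> e) (base e) v x \<in> e}"

definition "time e = - ((\<nu> e \<bullet> (x - base e)) / (\<nu> e \<bullet> v))"

lemma time: "hyper_proj (\<nu> e) (base e) v x = x + time e *\<^sub>R v"
  by (simp add: hyper_proj_def time_def)

lemma time_unique:
  assumes "e \<in> \<F>" "\<nu> e \<bullet> v \<noteq> 0" "x + s *\<^sub>R v \<in> e"
  shows "s = time e"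
proof -
  have "\<nu> e \<bullet> (x + s *\<^sub>R v - base e) = 0" using spans_hyperplane_in[OF spans assms(3)] assms(1) by blast
  then show ?thesis using assms(2) by (simp add: time_def inner_diff_right inner_add_right field_simps)
qed

text \<open>Leaving \<open>T\<close> counts \<open>+1\<close>, entering \<open>-1\<close>, opposite
  to the change of the indicator. As \<open>T\<close> is closed, an exit takes effect only after the
  crossing and an entry at the crossing, hence the strict and the weak inequality.\<close>

definition jump :: "(real^'d) set \<Rightarrow> real \<Rightarrow> real" where
  "jump e s = (if \<nu> e \<bullet> v > 0 then (if s > time e then 1 else 0) else (if s \<ge> time e then -1 else 0))"

definition level :: "real \<Rightarrow> real" where
  "level s = indicator T (x + s *\<^sub>R v) + (\<Sum>e\<in>hits. jump e s)"

lemma finite_hits: "finite hits" unfolding hits_def using fin by simp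

lemma jump_locally_constant:
  assumes "time e \<noteq> s" shows "\<forall>\<^sub>F t in nhds s. jump e t = jump e s"
proof (cases "time e < s")
  case True
  then have "\<forall>\<^sub>F t in nhds s. time e < t" by (intro eventually_nhds_in_open[of "{time e<..}", simplified]) auto
  then show ?thesis by eventually_elim (use True in \<open>auto simp: jump_def\<close>)
next
  case False
  then have "\<forall>\<^sub>F t in nhds s. t < time e" using assms by (intro eventually_nhds_in_open[of "{..<time e}", simplified]) auto
  then show ?thesis by eventually_elim (use False assms in \<open>auto simp: jump_def\<close>)
qed

text \<open>Off the frontier no summand changes. At a frontier point only one edge is crossed, by
  uniqueness outside \<open>\<Z>\<close>, and the half-space description shows that the change of
  the indicator cancels its jump.\<close>

lemma level_locally_constant: "\<forall>\<^sub>F s in nhds s0. level s = level s0"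
proof -
  have line: "((\<lambda>s. x + s *\<^sub>R v) \<longlongrightarrow> x + s0 *\<^sub>R v) (nhds s0)"
    using tendsto_at_within_iff_tendsto_nhds[of "\<lambda>s. x + s *\<^sub>R v" s0 UNIV]
    by (auto intro!: tendsto_eq_intros)
  show ?thesis
  proof (cases "x + s0 *\<^sub>R v \<in> frontier T")
    case False
    have "time e \<noteq> s0" if "e \<in> hits" for e
      using that False frontier unfolding hits_def time by auto
    then have "\<forall>\<^sub>F s in nhds s0. \<forall>e\<in>hits. jump e s = jump e s0"
      using finite_hits by (intro eventually_ball_finite ballI jump_locally_constant) auto
    moreover have "\<forall>\<^sub>F s in nhds s0. indicator T (x + s *\<^sub>R v) = (indicator T (x + s0 *\<^sub>R v) :: real)"
    proof (cases "x + s0 *\<^sub>R v \<in> T")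
      case True
      then have "x + s0 *\<^sub>R v \<in> interior T" using False compact_imp_closed[OF T] by (simp add: frontier_def)
      then have "\<forall>\<^sub>F s in nhds s0. x + s *\<^sub>R v \<in> interior T"
        using line topological_tendstoD open_interior by blast
      then show ?thesis by eventually_elim (use True interior_subset in \<open>auto simp: indicator_def\<close>)
    next
      case False
      then have "\<forall>\<^sub>F s in nhds s0. x + s *\<^sub>R v \<in> - T"
        using line topological_tendstoD[of _ _ _ "- T"] compact_imp_closed[OF T] by auto
      then show ?thesis by eventually_elim (use False in \<open>auto simp: indicator_def\<close>)
    qed
    ultimately show ?thesis by eventually_elim (simp add: level_def)
  next
    case True
    define z where "z = x + s0 *\<^sub>R v"
    obtain e where e: "e \<in> \<F>" "z \<in> e" using True frontier by (auto simp: z_def)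
    have zZ: "z \<notin> \<Union>\<Z>" using generic z_def by simp
    have zT: "z \<in> T" using True compact_imp_closed[OF T] by (auto simp: z_def frontier_def)
    have nv: "\<nu> e \<bullet> v \<noteq> 0"
    proof
      assume 0: "\<nu> e \<bullet> v = 0"
      have "\<nu> e \<bullet> (z - base e) = 0" using spans_hyperplane_in[OF spans e(2)] e(1) by blast
      then have "\<nu> e \<bullet> (x - base e) = 0" using 0 by (simp add: z_def inner_diff_right inner_add_right)
      then show False using transversal[OF e(1) 0] by simp
    qed
    have te: "time e = s0" using time_unique[OF e(1) nv, of s0] e(2) z_def by simp
    have eh: "e \<in> hits" using e nv te unfolding hits_def time z_def by simp
    have "time e' \<noteq> s0" if "e' \<in> hits - {e}" for e'
    proof
      assume "time e' = s0"
      then have "z \<in> e'" using that by (auto simp: hits_def time z_def)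
      then show False using skel_unique[of e' e z] that e zZ by (auto simp: hits_def)
    qed
    then have ev1: "\<forall>\<^sub>F s in nhds s0. \<forall>e'\<in>hits - {e}. jump e' s = jump e' s0"
      using finite_hits by (intro eventually_ball_finite ballI jump_locally_constant) auto
    obtain r where r: "r > 0" "\<And>y. dist z y < r \<Longrightarrow> \<nu> e \<bullet> (y - z) < 0 \<Longrightarrow> y \<in> interior T"
      "\<And>y. dist z y < r \<Longrightarrow> \<nu> e \<bullet> (y - z) > 0 \<Longrightarrow> y \<notin> T"
      using local_half_space[OF e zZ] by blast
    have "\<forall>\<^sub>F s in nhds s0. x + s *\<^sub>R v \<in> ball z r"
      by (rule topological_tendstoD[OF line open_ball]) (use r(1) in \<open>simp add: z_def\<close>)
    then have ev2: "\<forall>\<^sub>F s in nhds s0. indicator T (x + s *\<^sub>R v) + jump e s = indicator T z + jump e s0"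
    proof eventually_elim
      case (elim s)
      have ys: "\<nu> e \<bullet> (x + s *\<^sub>R v - z) = (s - s0) * (\<nu> e \<bullet> v)"
        by (simp add: z_def inner_diff_right inner_add_right algebra_simps)
      consider "s = s0" | "(s - s0) * (\<nu> e \<bullet> v) < 0" | "(s - s0) * (\<nu> e \<bullet> v) > 0"
        using nv by (metis linorder_neqE_linordered_idom mult_eq_0_iff right_minus_eq)
      then show ?case
      proof cases
        case 1
        then show ?thesis by (simp add: z_def)
      next
        case 2
        then have "x + s *\<^sub>R v \<in> T" using r(2)[of "x + s *\<^sub>R v"] elim ys interior_subset by auto
        then show ?thesis using 2 zT nv by (auto simp: jump_def te mult_less_0_iff)
      next
        case 3
        then have "x + s *\<^sub>R v \<notin> T" using r(3)[of "x + s *\<^sub>R v"] elim ys by auto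
        then show ?thesis using 3 zT nv by (auto simp: jump_def te zero_less_mult_iff)
      qed
    qed
    have lev: "level s = (indicator T (x + s *\<^sub>R v) + jump e s) + (\<Sum>e'\<in>hits - {e}. jump e' s)" for s
      unfolding level_def using eh finite_hits by (simp add: sum.remove[of hits e])
    show ?thesis using ev1 ev2
      by eventually_elim (simp add: lev z_def)
  qed
qed

lemma line_bounded:
  obtains R where "R > 0" "\<And>s. \<bar>s\<bar> \<ge> R \<Longrightarrow> x + s *\<^sub>R v \<notin> T" "\<And>e. e \<in> hits \<Longrightarrow> \<bar>time e\<bar> < R"
proof -
  obtain B where B: "\<And>y. y \<in> T \<Longrightarrow> norm y \<le> B" using compact_imp_bounded[OF T] bounded_iff by metis
  \<comment> \<open>From this parameter on, \<open>\<bar>s\<bar> * norm v\<close> exceeds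
    \<open>\<bar>B\<bar> + norm x\<close>, so the point is outside the ball that contains
    \<open>T\<close>.\<close>
  define R0 where "R0 = (\<bar>B\<bar> + norm x + 1) / norm v"
  have nv: "norm v > 0" using v by simp
  have out: "x + s *\<^sub>R v \<notin> T" if "\<bar>s\<bar> \<ge> R0" for s
  proof
    assume "x + s *\<^sub>R v \<in> T"
    then have "norm (x + s *\<^sub>R v) \<le> B" using B by blast
    moreover have "norm (s *\<^sub>R v) \<le> norm (x + s *\<^sub>R v) + norm x"
      using norm_triangle_ineq4[of "x + s *\<^sub>R v" x] by simp
    moreover have "\<bar>B\<bar> + norm x + 1 \<le> \<bar>s\<bar> * norm v" using that nv by (simp add: R0_def pos_divide_le_eq)
    ultimately show False by simp
  qed
  have "\<bar>time e\<bar> < R0" if "e \<in> hits" for e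
  proof (rule ccontr)
    assume "\<not> \<bar>time e\<bar> < R0"
    then have "x + time e *\<^sub>R v \<notin> T" using out by simp
    moreover have "x + time e *\<^sub>R v \<in> frontier T" using that frontier by (auto simp: hits_def time)
    ultimately show False using compact_imp_closed[OF T] by (auto simp: frontier_def)
  qed
  moreover have "R0 > 0" using nv by (auto simp: R0_def intro!: divide_pos_pos add_nonneg_pos)
  ultimately show ?thesis using that out by blast
qed

text \<open>A locally constant function on the real line has derivative zero and is constant; far
  before the first crossing every summand is zero.\<close>

lemma level_zero: "level s = 0"
proof -
  have "(level has_real_derivative 0) (at s)" for s
    using level_locally_constant[of s]
    by (subst DERIV_cong_ev[OF refl _ refl, of _ "\<lambda>_. level s"]) auto
  then have "level s = level t" for t by (intro DERIV_isconst_all) auto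
  moreover obtain R where "R > 0" "\<And>s. \<bar>s\<bar> \<ge> R \<Longrightarrow> x + s *\<^sub>R v \<notin> T" "\<And>e. e \<in> hits \<Longrightarrow> \<bar>time e\<bar> < R"
    by (rule line_bounded) blast
  then have R: "\<And>s. \<bar>s\<bar> \<ge> R \<Longrightarrow> x + s *\<^sub>R v \<notin> T" "R > 0" and j: "\<And>e. e \<in> hits \<Longrightarrow> - R < time e"
    by fastforce+
  have "jump e (- R) = 0" if "e \<in> hits" for e using j[OF that] by (simp add: jump_def)
  then have "level (- R) = 0" using R(1)[of "- R"] R(2) unfolding level_def by simp
  ultimately show ?thesis by metis
qed

text \<open>By \<open>level_zero\<close> the indicator is minus the sum of the jumps, and up to
  \<open>R\<close> each jump is a signed indicator of \<open>{time e..R}\<close> except at crossing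
  times. The fundamental theorem leaves the values at the crossings; the common value at
  \<open>R\<close> cancels because the signs sum to zero.\<close>

lemma line_integral:
  fixes \<phi> \<phi>' :: "real^'d \<Rightarrow> real"
  assumes deriv: "\<And>y. (\<phi> has_derivative D y) (at y)" "\<And>y. D y v = \<phi>' y" and cont: "continuous_on UNIV \<phi>'"
  shows "(\<integral>s. indicator T (x + s *\<^sub>R v) * \<phi>' (x + s *\<^sub>R v) \<partial>lborel)
    = (\<Sum>e\<in>hits. sgn (\<nu> e \<bullet> v) * \<phi> (hyper_proj (\<nu> e) (base e) v x))"
proof -
  obtain R where R: "R > 0" "\<And>s. \<bar>s\<bar> \<ge> R \<Longrightarrow> x + s *\<^sub>R v \<notin> T" "\<And>e. e \<in> hits \<Longrightarrow> \<bar>time e\<bar> < R"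
    by (rule line_bounded) blast
  define f where "f s = \<phi>' (x + s *\<^sub>R v)" for s
  define F where "F s = \<phi> (x + s *\<^sub>R v)" for s
  have dF: "(F has_real_derivative f s) (at s)" for s
  proof -
    have "((\<lambda>s. x + s *\<^sub>R v) has_derivative (\<lambda>h. h *\<^sub>R v)) (at s)" by (auto intro!: derivative_eq_intros)
    from has_derivative_compose[OF this deriv(1)]
    have "(F has_derivative (\<lambda>h. D (x + s *\<^sub>R v) (h *\<^sub>R v))) (at s)" unfolding F_def .
    moreover have "D (x + s *\<^sub>R v) (h *\<^sub>R v) = h * f s" for h
      using has_derivative_bounded_linear[OF deriv(1)[of "x + s *\<^sub>R v"]]
      by (simp add: linear_simps deriv(2) f_def)
    ultimately show ?thesis by (simp add: has_field_derivative_def mult_commute_abs)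
  qed
  have cf: "continuous_on UNIV f" unfolding f_def
    by (intro continuous_on_compose2[OF cont] continuous_intros) auto
  then have cf': "isCont f s" for s by (simp add: continuous_on_eq_continuous_at)
  \<comment> \<open>Evaluation of \<open>level\<close> beyond the last crossing: the line has
    entered and left equally often.\<close>
  have signs: "(\<Sum>e\<in>hits. sgn (\<nu> e \<bullet> v)) = 0"
  proof -
    have "jump e R = sgn (\<nu> e \<bullet> v)" if "e \<in> hits" for e
      using that R(3)[OF that] by (auto simp: jump_def hits_def sgn_if)
    then have "level R = (\<Sum>e\<in>hits. sgn (\<nu> e \<bullet> v))"
      unfolding level_def using R(1,2) by simp
    then show ?thesis by (simp add: level_zero)
  qed
  have hb: "has_bochner_integral lborel (\<lambda>s. \<Sum>e\<in>hits. - sgn (\<nu> e \<bullet> v) * (f s * indicator {time e..R} s))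
      (\<Sum>e\<in>hits. - sgn (\<nu> e \<bullet> v) * (F R - F (time e)))"
  proof (intro has_bochner_integral_sum has_bochner_integral_mult_right)
    fix e assume "e \<in> hits"
    then have "time e \<le> R" using R(3) by force
    then show "has_bochner_integral lborel (\<lambda>s. f s * indicator {time e..R} s) (F R - F (time e))"
      by (rule has_bochner_integral_FTC_Icc_real) (use dF cf' in auto)
  qed
  have ae: "AE s in lborel. \<forall>e\<in>hits. s \<noteq> time e"
    using finite_hits by (intro AE_finite_allI AE_lborel_singleton)
  have "(\<integral>s. indicator T (x + s *\<^sub>R v) * f s \<partial>lborel) = (\<integral>s. (\<Sum>e\<in>hits. - sgn (\<nu> e \<bullet> v) * (f s * indicator {time e..R} s)) \<partial>lborel)"
  proof (rule integral_cong_AE)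
    have [measurable]: "T \<in> sets borel" using T by (simp add: borel_compact)
    have [measurable]: "f \<in> borel_measurable borel" using cf by (rule borel_measurable_continuous_onI)
    show "(\<lambda>s. indicator T (x + s *\<^sub>R v) * f s) \<in> borel_measurable lborel" by measurable
    show "(\<lambda>s. \<Sum>e\<in>hits. - sgn (\<nu> e \<bullet> v) * (f s * indicator {time e..R} s)) \<in> borel_measurable lborel" by measurable
    show "AE s in lborel. indicator T (x + s *\<^sub>R v) * f s = (\<Sum>e\<in>hits. - sgn (\<nu> e \<bullet> v) * (f s * indicator {time e..R} s))"
      using ae
    proof eventually_elim
      case (elim s)
      show ?case
      proof (cases "s \<le> R")
        case True
        have "jump e s = sgn (\<nu> e \<bullet> v) * indicator {time e..R} s" if "e \<in> hits" for e
          using that elim True by (auto simp: jump_def hits_def sgn_if indicator_def)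
        then have "(\<Sum>e\<in>hits. - sgn (\<nu> e \<bullet> v) * (f s * indicator {time e..R} s)) = - (\<Sum>e\<in>hits. jump e s) * f s"
          by (simp add: sum_distrib_left sum_distrib_right sum_negf mult_ac)
        moreover have "indicator T (x + s *\<^sub>R v) = - (\<Sum>e\<in>hits. jump e s)"
          using level_zero[of s] unfolding level_def by simp
        ultimately show ?thesis by simp
      next
        case False
        then show ?thesis using R(1) R(2)[of s] by (simp add: indicator_def)
      qed
    qed
  qed
  also have "\<dots> = (\<Sum>e\<in>hits. - sgn (\<nu> e \<bullet> v) * (F R - F (time e)))"
    using hb by (rule has_bochner_integral_integral_eq)
  also have "\<dots> = (\<Sum>e\<in>hits. sgn (\<nu> e \<bullet> v) * F (time e)) - F R * (\<Sum>e\<in>hits. sgn (\<nu> e \<bullet> v))"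
    by (simp add: sum_distrib_left sum_subtractf[symmetric] algebra_simps)
  finally show ?thesis unfolding signs by (simp add: F_def f_def time)
qed

end

text \<open>Disintegration along \<open>v\<close> reduces the volume integral to lines, whose
  crossings are \<open>hyper_proj\<close> points. Turning these back into surface integrals costs
  \<open>\<bar>\<nu> e \<bullet> v\<bar>\<close>, which together with the sign of the crossing is
  the normal component of \<open>v\<close>.\<close>

theorem divergence_theorem:
  fixes \<phi> :: "real^'d \<Rightarrow> real"
  assumes \<phi>: "real_polynomial_function \<phi>"
  shows "(\<integral>x. indicator T x * frechet_derivative \<phi> (at x) v \<partial>lborel) = (\<Sum>e\<in>\<F>. (v \<bullet> \<nu> e) * (\<integral>x. \<phi> x \<partial>flat_measure e))"
proof (cases "v = 0")
  case True
  have "frechet_derivative \<phi> (at x) 0 = 0" for x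
    using has_derivative_bounded_linear[OF rpf_has_derivative[OF \<phi>]] by (simp add: linear_simps)
  then show ?thesis using True by simp
next
  case v: False
  define \<phi>' where "\<phi>' x = frechet_derivative \<phi> (at x) v" for x
  have rp': "real_polynomial_function \<phi>'" unfolding \<phi>'_def using \<phi> by (rule rpf_frechet_derivative)
  define w :: "real^'d \<Rightarrow> real" where "w x = indicator {0..1} ((v \<bullet> (x - 0)) / (v \<bullet> v))" for x
  have w: "unit_weight v (\<lambda>x. ennreal (w x))"
    using unit_weight_slab[of v v 0] v unfolding w_def by (simp add: ennreal_indicator)
  have w0: "0 \<le> w x" for x by (simp add: w_def)
  have wb: "w \<in> borel_measurable borel" unfolding w_def by measurable
  have T_borel[measurable]: "T \<in> sets borel" using T by (simp add: borel_compact)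
  have [measurable]: "\<phi>' \<in> borel_measurable borel" "\<phi> \<in> borel_measurable borel" using rp' \<phi> by (auto intro: rpf_borel)
  have int: "integrable lborel (\<lambda>x. indicator T x * \<phi>' x)"
    using borel_integrable_compact[OF T, of \<phi>'] rpf_continuous_on[OF rp'] by simp
  \<comment> \<open>The exceptional points are those whose line meets the skeleton and, next, those
    in the hyperplane of an edge. Avoiding the latter secures transversality for edges parallel to
    \<open>v\<close>.\<close>
  have negl: "negligible (\<Union>Z\<in>\<Z>. {x. \<exists>s. x + s *\<^sub>R v \<in> Z})"
    by (intro negligible_Union) (auto intro!: skel negligible_lines_through)
  have negl2: "negligible (\<Union>e\<in>\<F>. {x. \<nu> e \<bullet> x = \<nu> e \<bullet> base e})"
  proof (rule negligible_Union)
    fix X assume "X \<in> (\<lambda>e. {x. \<nu> e \<bullet> x = \<nu> e \<bullet> base e}) ` \<F>"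
    then obtain e where e: "e \<in> \<F>" "X = {x. \<nu> e \<bullet> x = \<nu> e \<bullet> base e}" by blast
    then have "\<nu> e \<noteq> 0" using spans_hyperplane_self[OF spans] by fastforce
    then show "negligible X" unfolding e(2) by (intro negligible_hyperplane) simp
  qed (use fin in simp)
  let ?G = "\<lambda>e x. w x * (indicator e (hyper_proj (\<nu> e) (base e) v x) * \<phi> (hyper_proj (\<nu> e) (base e) v x))"
  let ?F' = "{e\<in>\<F>. \<nu> e \<bullet> v \<noteq> 0}"
  have eb: "e \<in> sets borel" "bounded e" if "e \<in> \<F>" for e
    using polyhedral_cell_borel[OF cell(1)[OF that]] compact_imp_bounded[OF polyhedral_cell_compact[OF cell(1)[OF that]]] by auto
  have ge: "integrable lborel (?G e)" "(\<integral>x. ?G e x \<partial>lborel) = \<bar>\<nu> e \<bullet> v\<bar> * (\<integral>x. \<phi> x \<partial>flat_measure e)"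
    if "e \<in> ?F'" for e
    using that integral_flat_measure[OF spans eb(1) rpf_borel[OF \<phi>] integrable_flat_measure_rpf[OF spans eb \<phi>] _ w w0 wb]
    by auto
  have "(\<integral>x. indicator T x * \<phi>' x \<partial>lborel) = (\<integral>x. w x * (\<integral>s. indicator T (x + s *\<^sub>R v) * \<phi>' (x + s *\<^sub>R v) \<partial>lborel) \<partial>lborel)"
    by (rule integral_disintegrate[OF w w0 wb int, symmetric])
  also have "\<dots> = (\<integral>x. (\<Sum>e\<in>?F'. sgn (\<nu> e \<bullet> v) * ?G e x) \<partial>lborel)"
  proof (rule integral_cong_AE)
    note [measurable] = wb
    show "(\<lambda>x. w x * (\<integral>s. indicator T (x + s *\<^sub>R v) * \<phi>' (x + s *\<^sub>R v) \<partial>lborel)) \<in> borel_measurable lborel"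
      by measurable
    show "(\<lambda>x. (\<Sum>e\<in>?F'. sgn (\<nu> e \<bullet> v) * ?G e x)) \<in> borel_measurable lborel"
      by (intro borel_measurable_integrable Bochner_Integration.integrable_sum integrable_mult_right ge(1))
    show "AE x in lborel. w x * (\<integral>s. indicator T (x + s *\<^sub>R v) * \<phi>' (x + s *\<^sub>R v) \<partial>lborel) =
      (\<Sum>e\<in>?F'. sgn (\<nu> e \<bullet> v) * ?G e x)"
      using AE_lborel_negligible[OF negl] AE_lborel_negligible[OF negl2]
    proof eventually_elim
      case (elim x)
      have g: "x + s *\<^sub>R v \<notin> \<Union>\<Z>" for s using elim(1) by blast
      have t: "\<nu> e \<bullet> (x - base e) \<noteq> 0" if "e \<in> \<F>" for e using elim(2) that by (auto simp: inner_diff_right)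
      have "(\<integral>s. indicator T (x + s *\<^sub>R v) * \<phi>' (x + s *\<^sub>R v) \<partial>lborel)
        = (\<Sum>e\<in>hits v x. sgn (\<nu> e \<bullet> v) * \<phi> (hyper_proj (\<nu> e) (base e) v x))"
        by (rule line_integral[OF v g t _ _ rpf_continuous_on[OF rp']])
          (auto simp: \<phi>'_def intro!: rpf_has_derivative \<phi>)
      \<comment> \<open>Edges missed by the line contribute zero through the indicator; the index
        set no longer depends on \<open>x\<close>, so sum and integral can be exchanged.\<close>
      also have "\<dots> = (\<Sum>e\<in>?F'. sgn (\<nu> e \<bullet> v) * (indicator e (hyper_proj (\<nu> e) (base e) v x) * \<phi> (hyper_proj (\<nu> e) (base e) v x)))"
        using fin by (intro sum.mono_neutral_cong_left) (auto simp: hits_def[OF v g t] indicator_def split: if_splits)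
      finally show ?case by (simp add: sum_distrib_left mult_ac)
    qed
  qed
  also have "\<dots> = (\<Sum>e\<in>?F'. sgn (\<nu> e \<bullet> v) * (\<integral>x. ?G e x \<partial>lborel))"
    using ge(1) by (subst Bochner_Integration.integral_sum) auto
  also have "\<dots> = (\<Sum>e\<in>?F'. (v \<bullet> \<nu> e) * (\<integral>x. \<phi> x \<partial>flat_measure e))"
    by (rule sum.cong) (auto simp: ge(2) sgn_if inner_commute)
  also have "\<dots> = (\<Sum>e\<in>\<F>. (v \<bullet> \<nu> e) * (\<integral>x. \<phi> x \<partial>flat_measure e))"
    using fin by (intro sum.mono_neutral_left) (auto simp: inner_commute)
  finally show ?thesis unfolding \<phi>'_def .
qed

end

section \<open>Integrals of polynomials and Riesz representation\<close>

text \<open>Monomials may be linearly dependent in \<open>L^2\<close> of \<open>M\<close>, as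
  happens on an edge, so their Gram matrix is only semidefinite. The hypothesis \<open>ker\<close>
  supplies the consistency.\<close>

lemma poly_riesz:
  fixes M :: "(real^'d) measure" and l :: "(real^'d \<Rightarrow> real) \<Rightarrow> real"
  assumes int: "\<And>p. real_polynomial_function p \<Longrightarrow> integrable M p"
    and lin: "\<And>c. l (\<lambda>x. \<Sum>\<alpha>\<in>multi_indices r. c \<alpha> * mono_fun \<alpha> x) = (\<Sum>\<alpha>\<in>multi_indices r. c \<alpha> * l (mono_fun \<alpha>))"
    and ker: "\<And>p. p \<in> poly_fun r \<Longrightarrow> (\<integral>x. p x * p x \<partial>M) = 0 \<Longrightarrow> l p = 0"
  shows "\<exists>p\<in>poly_fun r. \<forall>q\<in>poly_fun r. (\<integral>x. p x * q x \<partial>M) = l q"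
proof -
  let ?I = "multi_indices r :: ('d \<Rightarrow> nat) set"
  define A where "A \<alpha> \<beta> = (\<integral>x. mono_fun \<alpha> x * mono_fun \<beta> x \<partial>M)" for \<alpha> \<beta> :: "'d \<Rightarrow> nat"
  define P where "P c = (\<lambda>x. \<Sum>\<alpha>\<in>?I. c \<alpha> * mono_fun \<alpha> x)" for c :: "('d \<Rightarrow> nat) \<Rightarrow> real"
  have P: "P c \<in> poly_fun r" for c unfolding P_def poly_fun_iff by blast
  have i: "integrable M (\<lambda>x. mono_fun \<alpha> x * mono_fun \<beta> x)" for \<alpha> \<beta> :: "'d \<Rightarrow> nat"
    by (intro int rpf_mult rpf_mono_fun)
  have A: "(\<integral>x. P c x * P d x \<partial>M) = (\<Sum>\<alpha>\<in>?I. \<Sum>\<beta>\<in>?I. c \<alpha> * d \<beta> * A \<alpha> \<beta>)" for c d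
  proof -
    have "P c x * P d x = (\<Sum>\<alpha>\<in>?I. \<Sum>\<beta>\<in>?I. c \<alpha> * d \<beta> * (mono_fun \<alpha> x * mono_fun \<beta> x))" for x
      unfolding P_def sum_product by (simp add: mult_ac)
    then show ?thesis using i
      by (simp add: A_def Bochner_Integration.integral_sum Bochner_Integration.integrable_sum)
  qed
  have "\<exists>c. \<forall>\<alpha>\<in>?I. (\<Sum>\<beta>\<in>?I. c \<beta> * A \<alpha> \<beta>) = l (mono_fun \<alpha>)"
  proof (rule psd_system_solvable[OF finite_multi_indices])
    show "A \<alpha> \<beta> = A \<beta> \<alpha>" for \<alpha> \<beta> by (simp add: A_def mult.commute)
    show "0 \<le> (\<Sum>\<alpha>\<in>?I. \<Sum>\<beta>\<in>?I. c \<alpha> * c \<beta> * A \<alpha> \<beta>)" for c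
      unfolding A[symmetric] by (rule integral_nonneg_AE) simp
    show "(\<Sum>\<alpha>\<in>?I. c \<alpha> * l (mono_fun \<alpha>)) = 0"
      if "(\<Sum>\<alpha>\<in>?I. \<Sum>\<beta>\<in>?I. c \<alpha> * c \<beta> * A \<alpha> \<beta>) = 0" for c
    proof -
      have "(\<integral>x. P c x * P c x \<partial>M) = 0" using that by (simp only: A)
      then have "l (P c) = 0" by (rule ker[OF P])
      then show ?thesis unfolding P_def lin .
    qed
  qed
  then obtain c where c: "\<And>\<alpha>. \<alpha> \<in> ?I \<Longrightarrow> (\<Sum>\<beta>\<in>?I. c \<beta> * A \<alpha> \<beta>) = l (mono_fun \<alpha>)" by blast
  have "(\<integral>x. P c x * q x \<partial>M) = l q" if "q \<in> poly_fun r" for q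
  proof -
    obtain d where q: "q = P d" using \<open>q \<in> poly_fun r\<close> unfolding poly_fun_iff P_def by blast
    have "(\<integral>x. P c x * P d x \<partial>M) = (\<integral>x. P d x * P c x \<partial>M)" by (simp add: mult.commute)
    also have "\<dots> = (\<Sum>\<alpha>\<in>?I. d \<alpha> * (\<Sum>\<beta>\<in>?I. c \<beta> * A \<alpha> \<beta>))"
      unfolding A by (simp add: sum_distrib_left mult.assoc)
    also have "\<dots> = l (P d)" unfolding P_def lin using c by simp
    finally show ?thesis using q by simp
  qed
  then show ?thesis using P by blast
qed

text \<open>Edge components are \<open>undefined\<close> off their edge, hence equal to a polynomial
  only up to a null set; completeness turns this into measurability.\<close>

lemma measurable_completion_cong:
  fixes f g :: "'a \<Rightarrow> 'b::topological_space"
  assumes f: "f \<in> borel_measurable (completion M)" and N: "N \<in> null_sets (completion M)"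
    and eq: "\<And>x. x \<in> space M \<Longrightarrow> x \<notin> N \<Longrightarrow> g x = f x"
  shows "g \<in> borel_measurable (completion M)"
proof (rule measurableI)
  fix A :: "'b set" assume A: "A \<in> sets borel"
  have "g -` A \<inter> space (completion M) = (f -` A \<inter> space (completion M) - N) \<union> (g -` A \<inter> space (completion M) \<inter> N)"
    using eq by auto
  moreover have "f -` A \<inter> space (completion M) - N \<in> sets (completion M)"
    by (intro sets.Diff measurable_sets[OF f A] null_setsD2[OF N])
  moreover have "g -` A \<inter> space (completion M) \<inter> N \<in> null_sets (completion M)"
    by (rule null_sets_completion_subset[OF _ N]) auto
  ultimately show "g -` A \<inter> space (completion M) \<in> sets (completion M)"
    using sets.Un null_setsD2 by metis
qed simp

text \<open>Values off \<open>e\<close> are left arbitrary, so the notion is stable under sums and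
  products, whereas products of the extensional functions in \<open>poly_on\<close> need not be
  extensional.\<close>

definition edge_poly :: "(real^'d) set \<Rightarrow> (real^'d \<Rightarrow> real) \<Rightarrow> bool" where
  "edge_poly e g \<longleftrightarrow> (\<exists>p. real_polynomial_function p \<and> (\<forall>x\<in>e. g x = p x))"

lemma edge_poly_rpf: "real_polynomial_function g \<Longrightarrow> edge_poly e g"
  unfolding edge_poly_def by blast

lemma edge_poly_restrict: "real_polynomial_function g \<Longrightarrow> edge_poly e (restrict g e)"
  unfolding edge_poly_def by (intro exI[of _ g]) auto

lemma edge_poly_add: "edge_poly e g \<Longrightarrow> edge_poly e h \<Longrightarrow> edge_poly e (\<lambda>x. g x + h x)"
  unfolding edge_poly_def
proof (elim exE conjE)
  fix p q assume "real_polynomial_function p" "real_polynomial_function q" "\<forall>x\<in>e. g x = p x" "\<forall>x\<in>e. h x = q x"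
  then show "\<exists>p. real_polynomial_function p \<and> (\<forall>x\<in>e. g x + h x = p x)"
    by (intro exI[of _ "\<lambda>x. p x + q x"]) auto
qed

lemma edge_poly_mult: "edge_poly e g \<Longrightarrow> edge_poly e h \<Longrightarrow> edge_poly e (\<lambda>x. g x * h x)"
  unfolding edge_poly_def
proof (elim exE conjE)
  fix p q assume "real_polynomial_function p" "real_polynomial_function q" "\<forall>x\<in>e. g x = p x" "\<forall>x\<in>e. h x = q x"
  then show "\<exists>p. real_polynomial_function p \<and> (\<forall>x\<in>e. g x * h x = p x)"
    by (intro exI[of _ "\<lambda>x. p x * q x"]) auto
qed

lemma edge_poly_const: "edge_poly e (\<lambda>x. c)"
  by (intro edge_poly_rpf rpf_const)

lemma edge_poly_diff: "edge_poly e g \<Longrightarrow> edge_poly e h \<Longrightarrow> edge_poly e (\<lambda>x. g x - h x)"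
  using edge_poly_add[of e g "\<lambda>x. (-1) * h x"] edge_poly_mult[OF edge_poly_const[of e "-1"], of h] by simp

lemma edge_poly_sum: "(\<And>i. i \<in> I \<Longrightarrow> edge_poly e (g i)) \<Longrightarrow> edge_poly e (\<lambda>x. \<Sum>i\<in>I. g i x)"
  by (induction I rule: infinite_finite_induct) (auto simp: edge_poly_const intro: edge_poly_add)

lemma edge_poly_inner:
  "(\<And>i. edge_poly e (\<lambda>x. q x $ i)) \<Longrightarrow> edge_poly e (\<lambda>x. q x \<bullet> n)"
  unfolding inner_vec_def by (auto intro!: edge_poly_sum edge_poly_mult edge_poly_const)

lemma edge_poly_grad: "real_polynomial_function w \<Longrightarrow> edge_poly e (\<lambda>x. grad w x \<bullet> n)"
  by (intro edge_poly_inner) (auto simp: grad_def intro!: edge_poly_rpf rpf_partial_deriv)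

locale mesh_edge =
  fixes e :: "(real^'d) set" and n q :: "real^'d"
  assumes cell: "polyhedral_cell e" and spans: "spans_hyperplane e n q"
begin

lemma flat_complete: "\<exists>M. flat_measure e = completion M \<and> space M = UNIV"
  unfolding flat_measure_def Let_def by auto

lemma edge_borel: "e \<in> sets borel" and edge_bounded: "bounded e"
  using cell polyhedral_cell_borel compact_imp_bounded polyhedral_cell_compact by blast+

lemma edge_poly_measurable:
  assumes "edge_poly e g" shows "g \<in> borel_measurable (flat_measure e)"
proof -
  obtain p where p: "real_polynomial_function p" "\<And>x. x \<in> e \<Longrightarrow> g x = p x" using assms unfolding edge_poly_def by blast
  obtain M where M: "flat_measure e = completion M" "space M = UNIV" using flat_complete by blast
  have "- e \<in> null_sets (flat_measure e)"
    using AE_flat_measure_in[OF spans edge_borel] sets_flat_measure[OF edge_borel, of "- e"] edge_borel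
    by (subst AE_iff_null_sets) auto
  then show ?thesis
    using measurable_completion_cong[of p M "- e" g] p borel_measurable_flat_measure[OF rpf_borel[OF p(1)], of e]
    unfolding M by auto
qed

lemma edge_poly_integrable:
  assumes "edge_poly e g" shows "integrable (flat_measure e) g"
proof -
  obtain p where p: "real_polynomial_function p" "\<And>x. x \<in> e \<Longrightarrow> g x = p x" using assms unfolding edge_poly_def by blast
  obtain B where "\<And>x. x \<in> e \<Longrightarrow> \<bar>p x\<bar> \<le> B" using rpf_bounded_on[OF p(1) edge_bounded] by blast
  then show ?thesis
    using p(2) by (intro integrable_flat_measure[OF spans edge_borel edge_bounded edge_poly_measurable[OF assms], of B]) auto
qed

lemma edge_integral_cong:
  assumes "edge_poly e g" "\<And>x. x \<in> e \<Longrightarrow> g x = h x"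
  shows "(\<integral>x. g x \<partial>flat_measure e) = (\<integral>x. h x \<partial>flat_measure e)"
proof (rule integral_cong_AE)
  have "edge_poly e h" using assms unfolding edge_poly_def by auto
  then show "g \<in> borel_measurable (flat_measure e)" "h \<in> borel_measurable (flat_measure e)"
    using assms by (auto intro: edge_poly_measurable)
  show "AE x in flat_measure e. g x = h x"
    using AE_flat_measure_in[OF spans edge_borel] assms(2) by (auto elim: eventually_mono)
qed

text \<open>A vanishing square integral gives zero almost everywhere, then on the relative interior
  by continuity, then on the affine hull by the identity theorem, so also on the relative boundary
  of the closed edge.\<close>

lemma edge_poly_zero:
  assumes g: "edge_poly e g" and z: "(\<integral>x. g x * g x \<partial>flat_measure e) = 0" and x: "x \<in> e"
  shows "g x = 0"
proof -
  obtain p where p: "real_polynomial_function p" "\<And>x. x \<in> e \<Longrightarrow> g x = p x" using g unfolding edge_poly_def by blast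
  have "(\<integral>x. p x * p x \<partial>flat_measure e) = 0"
    using edge_integral_cong[of "\<lambda>x. g x * g x" "\<lambda>x. p x * p x"] p z edge_poly_mult[OF g g] by auto
  then have "AE x in flat_measure e. p x = 0"
    using integral_nonneg_eq_0_iff_AE[of "flat_measure e" "\<lambda>x. p x * p x"]
      edge_poly_integrable[OF edge_poly_rpf, of "\<lambda>x. p x * p x"] p(1) by auto
  then have z: "p y = 0" if "y \<in> rel_interior e" for y
    using AE_flat_measure_zero_imp[OF spans edge_borel p(1) _ that] by blast
  have "p x = 0"
    by (rule rpf_zero_affine_hull[OF p(1) polyhedral_cell_rel_interior_nonempty[OF cell] z hull_inc[OF x]])
  then show ?thesis using p(2) x by simp
qed

end

lemma L2_fun_mult:
  fixes g h :: "'a \<Rightarrow> real"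
  assumes "L2_fun M g" "L2_fun M h" shows "integrable M (\<lambda>x. g x * h x)"
proof (rule Bochner_Integration.integrable_bound)
  show "integrable M (\<lambda>x. (g x)\<^sup>2 + (h x)\<^sup>2)" using assms unfolding L2_fun_def by auto
  show "(\<lambda>x. g x * h x) \<in> borel_measurable M" using assms unfolding L2_fun_def by auto
  show "AE x in M. norm (g x * h x) \<le> norm ((g x)\<^sup>2 + (h x)\<^sup>2)"
  proof (rule AE_I2)
    fix x
    have "0 \<le> (\<bar>g x\<bar> - \<bar>h x\<bar>)\<^sup>2" by simp
    also have "\<dots> = (g x)\<^sup>2 + (h x)\<^sup>2 - 2 * (\<bar>g x\<bar> * \<bar>h x\<bar>)" by (simp add: power2_diff)
    finally have "2 * (\<bar>g x\<bar> * \<bar>h x\<bar>) \<le> (g x)\<^sup>2 + (h x)\<^sup>2" by simp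
    moreover have "0 \<le> \<bar>g x\<bar> * \<bar>h x\<bar>" by simp
    ultimately have "\<bar>g x\<bar> * \<bar>h x\<bar> \<le> (g x)\<^sup>2 + (h x)\<^sup>2" by linarith
    then show "norm (g x * h x) \<le> norm ((g x)\<^sup>2 + (h x)\<^sup>2)" by (simp add: abs_mult)
  qed
qed

lemma lebesgue_on_integral:
  fixes g :: "'a::euclidean_space \<Rightarrow> real"
  assumes [measurable]: "S \<in> sets borel" "g \<in> borel_measurable borel"
  shows "(\<integral>x. g x \<partial>lebesgue_on S) = (\<integral>x. indicator S x * g x \<partial>lborel)"
  by (subst integral_restrict_space) (auto simp: integral_completion)

lemma integrable_lebesgue_on_rpf:
  fixes S :: "(real^'d) set"
  assumes "compact S" "real_polynomial_function g" shows "integrable (lebesgue_on S) g"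
  using borel_integrable_compact[OF assms(1) rpf_continuous_on[OF assms(2)]] borel_compact[OF assms(1)]
  by (subst integrable_restrict_space) (auto simp: integrable_completion rpf_borel assms borel_measurable_integrable)

section \<open>Weak functions on a polytopal mesh\<close>

locale wg_mesh =
  fixes \<Omega> :: "(real^'d) set" and \<T> \<E> :: "(real^'d) set set" and k :: nat and \<epsilon> :: real
    and b :: "real^'d \<Rightarrow> real^'d"
  assumes domain: "open \<Omega>" "bounded \<Omega>" "convex \<Omega>"
    and mesh: "polytopal_mesh \<Omega> \<T> \<E>"
    and b: "Linf_vec (lebesgue_on \<Omega>) b"
begin

abbreviation "edges \<equiv> edges_of \<E>"
abbreviation "nrm \<equiv> outward_normal"

lemmas mesh_conjs = mesh[unfolded polytopal_mesh_def]
lemmas finite_T = mesh_conjs[THEN conjunct1]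
lemmas mesh_cover = mesh_conjs[THEN conjunct2, THEN conjunct1]
lemmas T_cell = mesh_conjs[THEN conjunct2, THEN conjunct2, THEN conjunct1, rule_format, THEN conjunct1]
  and T_dim = mesh_conjs[THEN conjunct2, THEN conjunct2, THEN conjunct1, rule_format, THEN conjunct2]
lemmas mesh_conjs2 = mesh_conjs[THEN conjunct2, THEN conjunct2, THEN conjunct2]
lemmas T_disjoint = mesh_conjs2[THEN conjunct1, rule_format]
lemmas finite_E = mesh_conjs2[THEN conjunct2, THEN conjunct1]
lemmas mesh_conjs3 = mesh_conjs2[THEN conjunct2, THEN conjunct2]
lemmas E_cell = mesh_conjs3[THEN conjunct1, rule_format, THEN conjunct1]
  and E_dim = mesh_conjs3[THEN conjunct1, rule_format, THEN conjunct2]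
lemmas E_disjoint = mesh_conjs3[THEN conjunct2, THEN conjunct1, rule_format]
lemmas mesh_conjs4 = mesh_conjs3[THEN conjunct2, THEN conjunct2]
lemmas frontier_T = mesh_conjs4[THEN conjunct1, rule_format]
lemmas E_edges = mesh_conjs4[THEN conjunct2, THEN conjunct1, rule_format]
lemmas normal_ex = mesh_conjs4[THEN conjunct2, THEN conjunct2, rule_format]

lemma edgesD: "e \<in> edges T \<Longrightarrow> e \<in> \<E>" and edges_frontier: "e \<in> edges T \<Longrightarrow> e \<subseteq> frontier T"
  by (auto simp: edges_of_def)

lemma finite_edges: "finite (edges T)" unfolding edges_of_def using finite_E by simp

lemma T_compact: "T \<in> \<T> \<Longrightarrow> compact T" using T_cell polyhedral_cell_compact by blast

lemma T_borel: "T \<in> \<T> \<Longrightarrow> T \<in> sets borel" using T_compact borel_compact by blast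

lemma T_closure_interior: "T \<in> \<T> \<Longrightarrow> closure (interior T) = T"
  and T_interior: "T \<in> \<T> \<Longrightarrow> interior T \<noteq> {}"
proof -
  assume T: "T \<in> \<T>"
  then have "rel_interior T = interior T"
    using T_dim aff_dim_eq_full[of T] rel_interior_interior by simp
  then show "closure (interior T) = T" "interior T \<noteq> {}"
    using polyhedral_cell_closure[OF T_cell[OF T]] polyhedral_cell_rel_interior_nonempty[OF T_cell[OF T]] by auto
qed

lemma T_sub: "T \<in> \<T> \<Longrightarrow> T \<subseteq> closure \<Omega>"
  using mesh_cover by blast

text \<open>Convexity excludes slits and punctures, so the interior of the closure adds no
  points.\<close>

lemma interior_closure_Omega: "interior (closure \<Omega>) = \<Omega>"
  using convex_interior_closure[OF domain(3)] domain(1) by (simp add: interior_open)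

lemma interior_T_sub: "T \<in> \<T> \<Longrightarrow> interior T \<subseteq> \<Omega>"
  using interior_mono[OF T_sub] interior_closure_Omega by simp

lemma is_normal: "T \<in> \<T> \<Longrightarrow> e \<in> edges T \<Longrightarrow> is_outward_normal T e (nrm T e)"
proof -
  assume T: "T \<in> \<T>" and e: "e \<in> edges T"
  then obtain n where "is_outward_normal T e n" using normal_ex by blast
  then show ?thesis
    using outward_normal_eq[OF E_dim polyhedral_cell_rel_interior_nonempty[OF E_cell]] edgesD[OF e] by metis
qed

lemmas skeleton_ex = cells_skeleton[OF finite_E E_cell E_dim E_disjoint]

lemma mesh_edgeI: "T \<in> \<T> \<Longrightarrow> e \<in> edges T \<Longrightarrow> q \<in> e \<Longrightarrow> mesh_edge e (nrm T e) q"
  using E_cell edgesD is_outward_normal_spans[OF E_dim is_normal] by (intro mesh_edge.intro) blast+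

lemma mesh_edge_ex:
  assumes "e \<in> \<E>" obtains n q where "mesh_edge e n q"
proof -
  obtain T where T: "T \<in> \<T>" "e \<in> edges T" using E_edges[OF assms] by blast
  obtain q where "q \<in> e"
    using polyhedral_cell_rel_interior_nonempty[OF E_cell[OF assms]] rel_interior_subset by blast
  then show ?thesis using that mesh_edgeI[OF T] by blast
qed

lemma divergence_T:
  assumes T: "T \<in> \<T>" and \<phi>: "real_polynomial_function \<phi>"
  shows "(\<integral>x. partial_deriv i \<phi> x \<partial>lebesgue_on T) = bdry_integral \<E> T (\<lambda>e x. \<phi> x * nrm T e $ i)"
proof (rule skeleton_ex)
  fix \<Z> assume Z: "finite \<Z>" "\<And>Z. Z \<in> \<Z> \<Longrightarrow> aff_dim Z \<le> int CARD('d) - 2"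
    "\<And>x e. e \<in> \<E> \<Longrightarrow> x \<in> e \<Longrightarrow> x \<notin> \<Union>\<Z> \<Longrightarrow> x \<in> rel_interior e"
    "\<And>x e e'. e \<in> \<E> \<Longrightarrow> e' \<in> \<E> \<Longrightarrow> x \<in> e \<Longrightarrow> x \<in> e' \<Longrightarrow> x \<notin> \<Union>\<Z> \<Longrightarrow> e = e'"
  have fr: "frontier T = \<Union>(edges T)" by (rule frontier_T[OF T])
  note TB = T_borel[OF T]
  \<comment> \<open>The skeleton of the whole mesh serves for each element, as its edges are among
    the mesh edges.\<close>
  interpret cell_boundary T "edges T" "nrm T" \<Z>
    by unfold_locales
      (use T_compact[OF T] finite_edges E_cell E_dim edgesD is_normal[OF T] fr Z in \<open>blast+\<close>)
  have "(\<integral>x. partial_deriv i \<phi> x \<partial>lebesgue_on T)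
    = (\<integral>x. indicator T x * frechet_derivative \<phi> (at x) (axis i 1) \<partial>lborel)"
    using lebesgue_on_integral[OF TB rpf_borel[OF rpf_partial_deriv[OF \<phi>, of i]]]
    by (simp add: partial_deriv_def)
  also have "\<dots> = (\<Sum>e\<in>edges T. (axis i 1 \<bullet> nrm T e) * (\<integral>x. \<phi> x \<partial>flat_measure e))"
    by (rule divergence_theorem[OF \<phi>])
  finally show "(\<integral>x. partial_deriv i \<phi> x \<partial>lebesgue_on T) = bdry_integral \<E> T (\<lambda>e x. \<phi> x * nrm T e $ i)"
    by (simp add: bdry_integral_def inner_axis' mult.commute)
qed

text \<open>Agreement is asked on the edges only, since components of weak functions are not
  controlled elsewhere. Singleton and Boolean index sets turn this into congruence and difference
  rules.\<close>

lemma bdry_integral_lincomb: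
  assumes T: "T \<in> \<T>" and F: "\<And>i e. i \<in> I \<Longrightarrow> e \<in> edges T \<Longrightarrow> edge_poly e (F i e)" "finite I"
    and eq: "\<And>e x. e \<in> edges T \<Longrightarrow> x \<in> e \<Longrightarrow> G e x = (\<Sum>i\<in>I. c i * F i e x)"
  shows "bdry_integral \<E> T G = (\<Sum>i\<in>I. c i * bdry_integral \<E> T (F i))"
proof -
  have "(\<integral>x. G e x \<partial>flat_measure e) = (\<Sum>i\<in>I. c i * (\<integral>x. F i e x \<partial>flat_measure e))" if e: "e \<in> edges T" for e
  proof -
    obtain n q where "mesh_edge e n q" using mesh_edge_ex edgesD[OF e] by blast
    then interpret mesh_edge e n q .
    have "edge_poly e (\<lambda>x. \<Sum>i\<in>I. c i * F i e x)"
      using F(1)[OF _ e] by (intro edge_poly_sum edge_poly_mult edge_poly_const)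
    then have "(\<integral>x. G e x \<partial>flat_measure e) = (\<integral>x. (\<Sum>i\<in>I. c i * F i e x) \<partial>flat_measure e)"
      by (rule edge_integral_cong[symmetric]) (simp add: eq[OF e])
    also have "\<dots> = (\<Sum>i\<in>I. c i * (\<integral>x. F i e x \<partial>flat_measure e))"
      using edge_poly_integrable[OF F(1)[OF _ e]] by (subst Bochner_Integration.integral_sum) auto
    finally show ?thesis .
  qed
  then show ?thesis unfolding bdry_integral_def
    by (simp add: sum_distrib_left) (rule sum.swap)
qed

lemma bdry_integral_cong:
  assumes T: "T \<in> \<T>" and F: "\<And>e. e \<in> edges T \<Longrightarrow> edge_poly e (F e)"
    and eq: "\<And>e x. e \<in> edges T \<Longrightarrow> x \<in> e \<Longrightarrow> G e x = F e x"
  shows "bdry_integral \<E> T G = bdry_integral \<E> T F"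
  using bdry_integral_lincomb[OF T, of "{()}" "\<lambda>_. F" G "\<lambda>_. 1"] F eq by simp

section \<open>Polynomial integrals over elements and Riesz representatives\<close>

lemma T_integral_lincomb:
  assumes T: "T \<in> \<T>" and F: "\<And>i. i \<in> I \<Longrightarrow> real_polynomial_function (F i)"
    and eq: "\<And>x. G x = (\<Sum>i\<in>I. c i * F i x)"
  shows "(\<integral>x. G x \<partial>lebesgue_on T) = (\<Sum>i\<in>I. c i * (\<integral>x. F i x \<partial>lebesgue_on T))"
  unfolding eq using integrable_lebesgue_on_rpf[OF T_compact[OF T] F]
  by (subst Bochner_Integration.integral_sum) auto

lemma T_poly_zero:
  assumes T: "T \<in> \<T>" and p: "real_polynomial_function p" and z: "(\<integral>x. p x * p x \<partial>lebesgue_on T) = 0"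
  shows "p = (\<lambda>x. 0)"
proof -
  have "integrable (lebesgue_on T) (\<lambda>x. p x * p x)" using p by (intro integrable_lebesgue_on_rpf T_compact T) auto
  then have "AE x in lebesgue_on T. p x * p x = 0"
    using z integral_nonneg_eq_0_iff_AE[of "lebesgue_on T" "\<lambda>x. p x * p x"] by auto
  then have ae: "AE x in lebesgue. x \<in> T \<longrightarrow> p x = 0"
    using T_borel[OF T] by (subst (asm) AE_restrict_space_iff) auto
  define U where "U = interior T \<inter> {x. p x \<noteq> 0}"
  have "open U" unfolding U_def
    by (intro open_Int open_interior open_Collect_neq rpf_continuous_on p continuous_intros)
  moreover have "negligible U"
  proof -
    have "AE x in lebesgue. x \<notin> U" using ae interior_subset by (auto simp: U_def elim!: eventually_mono)
    then show ?thesis using \<open>open U\<close> by (simp add: negligible_iff_null_sets AE_iff_null_sets)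
  qed
  ultimately have "U = {}" using open_not_negligible by blast
  then have "p x = 0" if "x \<in> interior T" for x using that unfolding U_def by blast
  then show ?thesis using rpf_zero_on_open[OF p open_interior T_interior[OF T]] by blast
qed

text \<open>The Riesz representative of \<open>l\<close> among polynomials of degree
  \<open>k - 1\<close> for the \<open>L^2\<close> product on \<open>T\<close>; the weak Laplacian
  and each component of the weak gradient are of this kind.\<close>

definition poly_rep :: "(real^'d) set \<Rightarrow> ((real^'d \<Rightarrow> real) \<Rightarrow> real) \<Rightarrow> (real^'d \<Rightarrow> real) \<Rightarrow> bool" where
  "poly_rep T l p \<longleftrightarrow> p \<in> poly_fun (k - 1) \<and> (\<forall>w\<in>poly_fun (k - 1). (\<integral>x. p x * w x \<partial>lebesgue_on T) = l w)"

lemma poly_rep_unique: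
  assumes T: "T \<in> \<T>" and p: "poly_rep T l p" "poly_rep T l q" shows "p = q"
proof -
  have pq: "(\<lambda>x. p x - q x) \<in> poly_fun (k - 1)" using p unfolding poly_rep_def by (auto intro: poly_fun_diff)
  have i: "integrable (lebesgue_on T) (\<lambda>x. r x * (p x - q x))" if "r \<in> poly_fun (k - 1)" for r
    using that pq by (intro integrable_lebesgue_on_rpf T_compact[OF T] rpf_mult rpf_poly_fun)
  have "(\<integral>x. (p x - q x) * (p x - q x) \<partial>lebesgue_on T)
    = (\<integral>x. p x * (p x - q x) \<partial>lebesgue_on T) - (\<integral>x. q x * (p x - q x) \<partial>lebesgue_on T)"
    using p unfolding poly_rep_def left_diff_distrib by (intro Bochner_Integration.integral_diff i) auto
  also have "\<dots> = 0" using p pq unfolding poly_rep_def by auto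
  finally have "(\<lambda>x. p x - q x) = (\<lambda>x. 0)" by (intro T_poly_zero[OF T rpf_poly_fun[OF pq]])
  then show ?thesis by (auto simp: fun_eq_iff)
qed

lemma poly_rep_ex:
  assumes T: "T \<in> \<T>"
    and lin: "\<And>I c F (G :: real^'d \<Rightarrow> real). finite (I :: ('d \<Rightarrow> nat) set) \<Longrightarrow> (\<And>i. i \<in> I \<Longrightarrow> real_polynomial_function (F i)) \<Longrightarrow>
       G = (\<lambda>x. \<Sum>i\<in>I. c i * F i x) \<Longrightarrow> l G = (\<Sum>i\<in>I. c i * l (F i))"
  shows "\<exists>p. poly_rep T l p"
proof -
  have l0: "l (\<lambda>x. 0) = 0" using lin[of "{}"] by simp
  have "\<exists>p\<in>poly_fun (k - 1). \<forall>q\<in>poly_fun (k - 1). (\<integral>x. p x * q x \<partial>lebesgue_on T) = l q"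
  proof (rule poly_riesz)
    show "integrable (lebesgue_on T) p" if "real_polynomial_function p" for p
      by (rule integrable_lebesgue_on_rpf[OF T_compact[OF T] that])
    show "l (\<lambda>x. \<Sum>\<alpha>\<in>multi_indices (k - 1). c \<alpha> * mono_fun \<alpha> x) = (\<Sum>\<alpha>\<in>multi_indices (k - 1). c \<alpha> * l (mono_fun \<alpha>))" for c
      by (rule lin) (auto simp: finite_multi_indices rpf_mono_fun)
    show "l p = 0" if "p \<in> poly_fun (k - 1)" "(\<integral>x. p x * p x \<partial>lebesgue_on T) = 0" for p
      using T_poly_zero[OF T rpf_poly_fun[OF that(1)] that(2)] l0 by simp
  qed
  then show ?thesis unfolding poly_rep_def by blast
qed

lemma poly_rep_lincomb:
  assumes T: "T \<in> \<T>" and p: "\<And>i. i \<in> I \<Longrightarrow> poly_rep T (l i) (p i)" "finite I"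
    and l: "\<And>w. w \<in> poly_fun (k - 1) \<Longrightarrow> m w = (\<Sum>i\<in>I. c i * l i w)"
  shows "poly_rep T m (\<lambda>x. \<Sum>i\<in>I. c i * p i x)"
  unfolding poly_rep_def
proof (intro conjI ballI)
  have pf: "\<And>i. i \<in> I \<Longrightarrow> p i \<in> poly_fun (k - 1)" using p unfolding poly_rep_def by blast
  then show "(\<lambda>x. \<Sum>i\<in>I. c i * p i x) \<in> poly_fun (k - 1)" by (rule poly_fun_lincomb)
  fix w :: "real^'d \<Rightarrow> real" assume w: "w \<in> poly_fun (k - 1)"
  have "(\<integral>x. (\<Sum>i\<in>I. c i * p i x) * w x \<partial>lebesgue_on T) = (\<Sum>i\<in>I. c i * (\<integral>x. p i x * w x \<partial>lebesgue_on T))"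
    by (rule T_integral_lincomb[OF T rpf_mult[OF rpf_poly_fun[OF pf] rpf_poly_fun[OF w]]])
      (simp_all add: sum_distrib_right mult.assoc)
  then show "(\<integral>x. (\<Sum>i\<in>I. c i * p i x) * w x \<partial>lebesgue_on T) = m w"
    using p w l unfolding poly_rep_def by simp
qed

end

section \<open>The weak operators\<close>

lemma rpf_vec_poly_fun: "q \<in> vec_poly_fun r \<Longrightarrow> real_polynomial_function (\<lambda>x. q x $ i)"
  unfolding vec_poly_fun_def by (auto intro: rpf_poly_fun)

context wg_mesh
begin

abbreviation "WG \<equiv> WG_space k \<T> \<E>"

lemma WG_v0: "v \<in> WG \<Longrightarrow> T \<in> \<T> \<Longrightarrow> v0 v T \<in> poly_fun k"
  unfolding WG_space_def by (auto simp: PiE_iff)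

lemma WG_v0_rpf: "v \<in> WG \<Longrightarrow> T \<in> \<T> \<Longrightarrow> real_polynomial_function (v0 v T)"
  using WG_v0 rpf_poly_fun by blast

lemma WG_vb: "v \<in> WG \<Longrightarrow> e \<in> \<E> \<Longrightarrow> edge_poly e (vb v e)"
  unfolding WG_space_def PiE_iff poly_on_def by (auto intro!: edge_poly_restrict rpf_poly_fun)

lemma WG_vg: "v \<in> WG \<Longrightarrow> e \<in> \<E> \<Longrightarrow> edge_poly e (\<lambda>x. vg v e x $ i)"
proof -
  assume "v \<in> WG" "e \<in> \<E>"
  then obtain q where q: "q \<in> vec_poly_fun (k - 1)" "vg v e = restrict q e"
    unfolding WG_space_def PiE_iff vec_poly_on_def by auto
  show ?thesis unfolding edge_poly_def
    by (rule exI[of _ "\<lambda>x. q x $ i"]) (simp add: q(2) rpf_vec_poly_fun[OF q(1)])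
qed

lemma WG_vg_inner: "v \<in> WG \<Longrightarrow> e \<in> \<E> \<Longrightarrow> edge_poly e (\<lambda>x. vg v e x \<bullet> n)"
  by (intro edge_poly_inner WG_vg)

definition lapl_fun :: "'d weak_fun \<Rightarrow> (real^'d) set \<Rightarrow> (real^'d \<Rightarrow> real) \<Rightarrow> real" where
  "lapl_fun v T w = (\<integral>x. v0 v T x * laplacian w x \<partial>lebesgue_on T)
       - bdry_integral \<E> T (\<lambda>e x. vb v e x * (grad w x \<bullet> nrm T e))
       + bdry_integral \<E> T (\<lambda>e x. (vg v e x \<bullet> nrm T e) * w x)"

text \<open>The right-hand side of the weak gradient for the test field \<open>w\<close> times the
  \<open>i\<close>-th unit vector, whose divergence is \<open>partial_deriv i w\<close>.\<close>

definition grad_fun :: "'d weak_fun \<Rightarrow> (real^'d) set \<Rightarrow> 'd \<Rightarrow> (real^'d \<Rightarrow> real) \<Rightarrow> real" where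
  "grad_fun v T i w = - (\<integral>x. v0 v T x * partial_deriv i w x \<partial>lebesgue_on T)
       + bdry_integral \<E> T (\<lambda>e x. vb v e x * (w x * nrm T e $ i))"

lemma lapl_fun_linear:
  assumes v: "v \<in> WG" "T \<in> \<T>" and I: "finite I" "\<And>i. i \<in> I \<Longrightarrow> real_polynomial_function (F i)"
  shows "lapl_fun v T (\<lambda>x. \<Sum>i\<in>I. c i * F i x) = (\<Sum>i\<in>I. c i * lapl_fun v T (F i))"
proof -
  have "(\<integral>x. v0 v T x * laplacian (\<lambda>x. \<Sum>i\<in>I. c i * F i x) x \<partial>lebesgue_on T)
    = (\<Sum>i\<in>I. c i * (\<integral>x. v0 v T x * laplacian (F i) x \<partial>lebesgue_on T))"
    by (rule T_integral_lincomb[OF v(2)])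
      (auto simp: laplacian_lincomb[OF I] sum_distrib_left mult_ac intro!: rpf_mult WG_v0_rpf[OF v] rpf_laplacian I(2))
  moreover have "bdry_integral \<E> T (\<lambda>e x. vb v e x * (grad (\<lambda>x. \<Sum>i\<in>I. c i * F i x) x \<bullet> nrm T e))
    = (\<Sum>i\<in>I. c i * bdry_integral \<E> T (\<lambda>e x. vb v e x * (grad (F i) x \<bullet> nrm T e)))"
    by (rule bdry_integral_lincomb[OF v(2) _ I(1)])
      (auto simp: grad_lincomb[OF I] inner_sum_left sum_distrib_left mult_ac
        intro!: edge_poly_mult WG_vb[OF v(1)] edge_poly_grad I(2) edgesD)
  moreover have "bdry_integral \<E> T (\<lambda>e x. (vg v e x \<bullet> nrm T e) * (\<Sum>i\<in>I. c i * F i x))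
    = (\<Sum>i\<in>I. c i * bdry_integral \<E> T (\<lambda>e x. (vg v e x \<bullet> nrm T e) * F i x))"
    by (rule bdry_integral_lincomb[OF v(2) _ I(1)])
      (auto simp: sum_distrib_left mult_ac intro!: edge_poly_mult WG_vg_inner[OF v(1)] edge_poly_rpf[OF I(2)] edgesD)
  ultimately show ?thesis unfolding lapl_fun_def
    by (simp add: right_diff_distrib distrib_left sum_subtractf sum.distrib)
qed

lemma grad_fun_linear:
  assumes v: "v \<in> WG" "T \<in> \<T>" and I: "finite I" "\<And>i. i \<in> I \<Longrightarrow> real_polynomial_function (F i)"
  shows "grad_fun v T j (\<lambda>x. \<Sum>i\<in>I. c i * F i x) = (\<Sum>i\<in>I. c i * grad_fun v T j (F i))"
proof -
  have "(\<integral>x. v0 v T x * partial_deriv j (\<lambda>x. \<Sum>i\<in>I. c i * F i x) x \<partial>lebesgue_on T)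
    = (\<Sum>i\<in>I. c i * (\<integral>x. v0 v T x * partial_deriv j (F i) x \<partial>lebesgue_on T))"
    by (rule T_integral_lincomb[OF v(2)])
      (auto simp: partial_deriv_lincomb[OF I] sum_distrib_left mult_ac intro!: rpf_mult WG_v0_rpf[OF v] rpf_partial_deriv I(2))
  moreover have "bdry_integral \<E> T (\<lambda>e x. vb v e x * ((\<Sum>i\<in>I. c i * F i x) * nrm T e $ j))
    = (\<Sum>i\<in>I. c i * bdry_integral \<E> T (\<lambda>e x. vb v e x * (F i x * nrm T e $ j)))"
    by (rule bdry_integral_lincomb[OF v(2) _ I(1)])
      (auto simp: sum_distrib_left sum_distrib_right mult_ac
        intro!: edge_poly_mult edge_poly_const WG_vb[OF v(1)] edge_poly_rpf[OF I(2)] edgesD)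
  ultimately show ?thesis unfolding grad_fun_def
    by (simp add: distrib_left right_diff_distrib sum_subtractf sum_negf sum.distrib)
qed

text \<open>\<open>v\<close> is the combination of the \<open>\<beta> i\<close> with coefficients \<open>c i\<close>, up to the invisible tangential part
  of the edge gradients.\<close>

definition is_comb :: "'i set \<Rightarrow> ('i \<Rightarrow> real) \<Rightarrow> ('i \<Rightarrow> 'd weak_fun) \<Rightarrow> 'd weak_fun \<Rightarrow> bool" where
  "is_comb I c \<beta> v \<longleftrightarrow> finite I \<and> (\<forall>i\<in>I. \<beta> i \<in> WG) \<and> v \<in> WG \<and>
     (\<forall>T\<in>\<T>. \<forall>x. v0 v T x = (\<Sum>i\<in>I. c i * v0 (\<beta> i) T x)) \<and>
     (\<forall>e\<in>\<E>. \<forall>x\<in>e. vb v e x = (\<Sum>i\<in>I. c i * vb (\<beta> i) e x)) \<and>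
     (\<forall>T\<in>\<T>. \<forall>e\<in>edges T. \<forall>x\<in>e. vg v e x \<bullet> nrm T e = (\<Sum>i\<in>I. c i * (vg (\<beta> i) e x \<bullet> nrm T e)))"

lemma is_combD:
  assumes "is_comb I c \<beta> v"
  shows "finite I" "\<And>i. i \<in> I \<Longrightarrow> \<beta> i \<in> WG" "v \<in> WG"
    "\<And>T x. T \<in> \<T> \<Longrightarrow> v0 v T x = (\<Sum>i\<in>I. c i * v0 (\<beta> i) T x)"
    "\<And>e x. e \<in> \<E> \<Longrightarrow> x \<in> e \<Longrightarrow> vb v e x = (\<Sum>i\<in>I. c i * vb (\<beta> i) e x)"
    "\<And>T e x. T \<in> \<T> \<Longrightarrow> e \<in> edges T \<Longrightarrow> x \<in> e \<Longrightarrow>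
       vg v e x \<bullet> nrm T e = (\<Sum>i\<in>I. c i * (vg (\<beta> i) e x \<bullet> nrm T e))"
  using assms unfolding is_comb_def by simp_all

lemma lapl_fun_comb:
  assumes C: "is_comb I c \<beta> v" and T: "T \<in> \<T>" and w: "real_polynomial_function w"
  shows "lapl_fun v T w = (\<Sum>i\<in>I. c i * lapl_fun (\<beta> i) T w)"
proof -
  note C = is_combD[OF C]
  have "(\<integral>x. v0 v T x * laplacian w x \<partial>lebesgue_on T)
    = (\<Sum>i\<in>I. c i * (\<integral>x. v0 (\<beta> i) T x * laplacian w x \<partial>lebesgue_on T))"
    by (rule T_integral_lincomb[OF T])
      (auto simp: C(4)[OF T] sum_distrib_left mult_ac intro!: rpf_mult WG_v0_rpf[OF C(2) T] rpf_laplacian w)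
  moreover have "bdry_integral \<E> T (\<lambda>e x. vb v e x * (grad w x \<bullet> nrm T e))
    = (\<Sum>i\<in>I. c i * bdry_integral \<E> T (\<lambda>e x. vb (\<beta> i) e x * (grad w x \<bullet> nrm T e)))"
    by (rule bdry_integral_lincomb[OF T _ C(1)])
      (auto simp: C(5)[OF edgesD] sum_distrib_left mult_ac
        intro!: edge_poly_mult WG_vb[OF C(2)] edge_poly_grad w edgesD)
  moreover have "bdry_integral \<E> T (\<lambda>e x. (vg v e x \<bullet> nrm T e) * w x)
    = (\<Sum>i\<in>I. c i * bdry_integral \<E> T (\<lambda>e x. (vg (\<beta> i) e x \<bullet> nrm T e) * w x))"
    by (rule bdry_integral_lincomb[OF T _ C(1)])
      (auto simp: C(6)[OF T] sum_distrib_left mult_ac intro!: edge_poly_mult WG_vg_inner[OF C(2)] edge_poly_rpf[OF w] edgesD)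
  ultimately show ?thesis unfolding lapl_fun_def
    by (simp add: right_diff_distrib distrib_left sum_subtractf sum.distrib)
qed

lemma grad_fun_comb:
  assumes C: "is_comb I c \<beta> v" and T: "T \<in> \<T>" and w: "real_polynomial_function w"
  shows "grad_fun v T j w = (\<Sum>i\<in>I. c i * grad_fun (\<beta> i) T j w)"
proof -
  note C = is_combD[OF C]
  have "(\<integral>x. v0 v T x * partial_deriv j w x \<partial>lebesgue_on T)
    = (\<Sum>i\<in>I. c i * (\<integral>x. v0 (\<beta> i) T x * partial_deriv j w x \<partial>lebesgue_on T))"
    by (rule T_integral_lincomb[OF T])
      (auto simp: C(4)[OF T] sum_distrib_left mult_ac intro!: rpf_mult WG_v0_rpf[OF C(2) T] rpf_partial_deriv w)
  moreover have "bdry_integral \<E> T (\<lambda>e x. vb v e x * (w x * nrm T e $ j))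
    = (\<Sum>i\<in>I. c i * bdry_integral \<E> T (\<lambda>e x. vb (\<beta> i) e x * (w x * nrm T e $ j)))"
    by (rule bdry_integral_lincomb[OF T _ C(1)])
      (auto simp: C(5)[OF edgesD] sum_distrib_left mult_ac
        intro!: edge_poly_mult edge_poly_const WG_vb[OF C(2)] edge_poly_rpf[OF w] edgesD)
  ultimately show ?thesis unfolding grad_fun_def
    by (simp add: distrib_left right_diff_distrib sum_subtractf sum_negf sum.distrib)
qed

text \<open>Riesz representation shows that the \<open>THE\<close> in the definition denotes an
  actual polynomial; uniqueness rests on the nonempty interior of \<open>T\<close>.\<close>

lemma weak_laplacian_rep:
  assumes "v \<in> WG" "T \<in> \<T>" shows "poly_rep T (lapl_fun v T) (weak_laplacian k \<E> v T)"
proof -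
  have "\<exists>p. poly_rep T (lapl_fun v T) p"
    by (rule poly_rep_ex[OF assms(2)]) (simp add: lapl_fun_linear[OF assms])
  then obtain p where p: "poly_rep T (lapl_fun v T) p" by blast
  have "weak_laplacian k \<E> v T = (THE p. poly_rep T (lapl_fun v T) p)"
    unfolding weak_laplacian_def poly_rep_def lapl_fun_def ..
  also have "\<dots> = p" by (rule the_equality, rule p, rule poly_rep_unique[OF assms(2) _ p])
  finally show ?thesis using p by simp
qed

text \<open>The \<open>L^2\<close> product of vector fields is a sum over components, so the
  condition decouples: unit-vector test fields give one direction, summation over components the
  other.\<close>

lemma weak_gradient_char:
  assumes v: "v \<in> WG" and T: "T \<in> \<T>"
  shows "(q \<in> vec_poly_fun (k - 1) \<and> (\<forall>\<psi>\<in>vec_poly_fun (k - 1).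
     (\<integral>x. q x \<bullet> \<psi> x \<partial>lebesgue_on T) =
       - (\<integral>x. v0 v T x * divergence \<psi> x \<partial>lebesgue_on T)
       + bdry_integral \<E> T (\<lambda>e x. vb v e x * (\<psi> x \<bullet> nrm T e))))
    \<longleftrightarrow> (\<forall>i. poly_rep T (grad_fun v T i) (\<lambda>x. q x $ i))" (is "?L \<longleftrightarrow> ?R")
proof
  assume L: ?L
  show ?R unfolding poly_rep_def
  proof (intro allI conjI ballI)
    fix i
    show "(\<lambda>x. q x $ i) \<in> poly_fun (k - 1)" using L unfolding vec_poly_fun_def by blast
    fix w :: "real^'d \<Rightarrow> real" assume w: "w \<in> poly_fun (k - 1)"
    define \<psi> where "\<psi> x = w x *\<^sub>R axis i (1::real)" for x
    have comp: "\<psi> x $ j = (if j = i then w x else 0)" for x j by (simp add: \<psi>_def axis_def)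
    have "(\<lambda>x. \<psi> x $ j) \<in> poly_fun (k - 1)" for j
      using w by (cases "j = i") (auto simp: comp poly_fun_zero)
    then have \<psi>: "\<psi> \<in> vec_poly_fun (k - 1)" unfolding vec_poly_fun_def by blast
    have "partial_deriv j (\<lambda>y. \<psi> y $ j) x = (if j = i then partial_deriv i w x else 0)" for j x
      by (cases "j = i") (auto simp: comp partial_deriv_const)
    then have d: "divergence \<psi> x = partial_deriv i w x" for x unfolding divergence_def by simp
    have in1: "y \<bullet> \<psi> x = y $ i * w x" "\<psi> x \<bullet> y = w x * y $ i" for x y
      by (simp_all add: \<psi>_def inner_axis inner_axis' mult.commute)
    show "(\<integral>x. q x $ i * w x \<partial>lebesgue_on T) = grad_fun v T i w"
      using L[THEN conjunct2, rule_format, OF \<psi>] unfolding grad_fun_def by (simp only: d in1)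
  qed
next
  assume R: ?R
  then have qp: "\<And>i. (\<lambda>x. q x $ i) \<in> poly_fun (k - 1)"
    and qi: "\<And>i w. w \<in> poly_fun (k - 1) \<Longrightarrow> (\<integral>x. q x $ i * w x \<partial>lebesgue_on T) = grad_fun v T i w"
    unfolding poly_rep_def by blast+
  show ?L
  proof (intro conjI ballI)
    show "q \<in> vec_poly_fun (k - 1)" unfolding vec_poly_fun_def using qp by blast
    fix \<psi> :: "real^'d \<Rightarrow> real^'d" assume "\<psi> \<in> vec_poly_fun (k - 1)"
    then have \<psi>: "\<And>i. (\<lambda>x. \<psi> x $ i) \<in> poly_fun (k - 1)" unfolding vec_poly_fun_def by blast
    have "(\<integral>x. q x \<bullet> \<psi> x \<partial>lebesgue_on T) = (\<Sum>i\<in>UNIV. 1 * (\<integral>x. q x $ i * \<psi> x $ i \<partial>lebesgue_on T))"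
      by (rule T_integral_lincomb[OF T rpf_mult[OF rpf_poly_fun[OF qp] rpf_poly_fun[OF \<psi>]]]) (simp add: inner_vec_def)
    also have "\<dots> = (\<Sum>i\<in>UNIV. grad_fun v T i (\<lambda>x. \<psi> x $ i))" using qi[OF \<psi>] by simp
    also have "\<dots> = - (\<Sum>i\<in>UNIV. 1 * (\<integral>x. v0 v T x * partial_deriv i (\<lambda>x. \<psi> x $ i) x \<partial>lebesgue_on T))
       + (\<Sum>i\<in>UNIV. 1 * bdry_integral \<E> T (\<lambda>e x. vb v e x * (\<psi> x $ i * nrm T e $ i)))"
      unfolding grad_fun_def by (simp add: sum.distrib sum_negf sum_subtractf)
    also have "(\<Sum>i\<in>UNIV. 1 * (\<integral>x. v0 v T x * partial_deriv i (\<lambda>x. \<psi> x $ i) x \<partial>lebesgue_on T))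
      = (\<integral>x. v0 v T x * divergence \<psi> x \<partial>lebesgue_on T)"
      by (rule T_integral_lincomb[OF T rpf_mult[OF WG_v0_rpf[OF v T] rpf_partial_deriv[OF rpf_poly_fun[OF \<psi>]]], symmetric])
        (simp add: divergence_def sum_distrib_left)
    also have "(\<Sum>i\<in>UNIV. 1 * bdry_integral \<E> T (\<lambda>e x. vb v e x * (\<psi> x $ i * nrm T e $ i)))
      = bdry_integral \<E> T (\<lambda>e x. vb v e x * (\<psi> x \<bullet> nrm T e))"
      by (rule bdry_integral_lincomb[OF T, symmetric])
        (simp_all add: inner_vec_def sum_distrib_left edge_poly_mult edge_poly_const edge_poly_rpf
          WG_vb[OF v edgesD] rpf_poly_fun[OF \<psi>])
    finally show "(\<integral>x. q x \<bullet> \<psi> x \<partial>lebesgue_on T) =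
       - (\<integral>x. v0 v T x * divergence \<psi> x \<partial>lebesgue_on T)
       + bdry_integral \<E> T (\<lambda>e x. vb v e x * (\<psi> x \<bullet> nrm T e))" .
  qed
qed

lemma weak_gradient_rep:
  assumes v: "v \<in> WG" "T \<in> \<T>"
  shows "poly_rep T (grad_fun v T i) (\<lambda>x. weak_gradient k \<E> v T x $ i)"
proof -
  have "\<exists>p. poly_rep T (grad_fun v T i) p" for i
    by (rule poly_rep_ex[OF v(2)]) (simp add: grad_fun_linear[OF v])
  then obtain p where p: "\<And>i. poly_rep T (grad_fun v T i) (p i)" by metis
  have "weak_gradient k \<E> v T = (THE q. \<forall>i. poly_rep T (grad_fun v T i) (\<lambda>x. q x $ i))"
    unfolding weak_gradient_def weak_gradient_char[OF v] ..
  also have "\<dots> = (\<lambda>x. \<chi> i. p i x)"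
  proof (rule the_equality)
    show "\<forall>i. poly_rep T (grad_fun v T i) (\<lambda>x. (\<chi> i. p i x) $ i)" using p by simp
    fix q assume q: "\<forall>i. poly_rep T (grad_fun v T i) (\<lambda>x. q x $ i)"
    have "(\<lambda>x. q x $ i) = p i" for i using poly_rep_unique[OF v(2) q[rule_format] p] .
    then have "q x $ i = p i x" for x i by metis
    then show "q = (\<lambda>x. \<chi> i. p i x)" by (simp add: fun_eq_iff vec_eq_iff)
  qed
  finally show ?thesis using p by simp
qed

text \<open>Both weak operators represent functionals that are linear in the weak function, and
  representatives are unique; only the components seen by these functionals have to combine.\<close>

lemma weak_operator_comb:
  assumes C: "is_comb I c \<beta> v" and T: "T \<in> \<T>"
  shows "weak_operator k \<epsilon> b \<E> v T x = (\<Sum>i\<in>I. c i * weak_operator k \<epsilon> b \<E> (\<beta> i) T x)"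
proof -
  note C' = is_combD[OF C]
  have L: "weak_laplacian k \<E> v T = (\<lambda>x. \<Sum>i\<in>I. c i * weak_laplacian k \<E> (\<beta> i) T x)"
    by (rule poly_rep_unique[OF T weak_laplacian_rep[OF C'(3) T]],
        rule poly_rep_lincomb[OF T weak_laplacian_rep[OF C'(2) T] C'(1) lapl_fun_comb[OF C T rpf_poly_fun]])
  have "(\<lambda>x. weak_gradient k \<E> v T x $ j) = (\<lambda>x. \<Sum>i\<in>I. c i * weak_gradient k \<E> (\<beta> i) T x $ j)" for j
    by (rule poly_rep_unique[OF T weak_gradient_rep[OF C'(3) T]],
        rule poly_rep_lincomb[OF T weak_gradient_rep[OF C'(2) T] C'(1) grad_fun_comb[OF C T rpf_poly_fun]])
  then have "weak_gradient k \<E> v T x $ j = (\<Sum>i\<in>I. c i *\<^sub>R weak_gradient k \<E> (\<beta> i) T x) $ j" for j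
    by (simp add: fun_eq_iff)
  then have G: "weak_gradient k \<E> v T x = (\<Sum>i\<in>I. c i *\<^sub>R weak_gradient k \<E> (\<beta> i) T x)"
    by (intro iffD2[OF vec_eq_iff] allI)
  show ?thesis unfolding weak_operator_def L G
    by (simp add: inner_sum_right sum_distrib_left distrib_left right_diff_distrib sum.distrib sum_subtractf sum_negf mult_ac)
qed

section \<open>Coefficients and data on closed elements\<close>

lemma negligible_boundary: "negligible (closure \<Omega> - \<Omega>)"
  using negligible_convex_frontier[OF domain(3)] domain(1) by (simp add: frontier_def interior_open)

lemma Omega_lebesgue: "\<Omega> \<in> sets lebesgue" using domain(1) by simp

text \<open>A closed element may touch the boundary of \<open>\<Omega>\<close>, where nothing is
  known about \<open>g\<close>. These points form a null set by convexity, and Lebesgue measure is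
  complete.\<close>

lemma measurable_on_element:
  fixes g :: "real^'d \<Rightarrow> 'c::{real_normed_vector, second_countable_topology}"
  assumes g: "g \<in> borel_measurable (lebesgue_on \<Omega>)" and T: "T \<in> \<T>"
  shows "g \<in> borel_measurable (lebesgue_on T)"
proof -
  have a: "(\<lambda>x. indicator \<Omega> x *\<^sub>R g x) \<in> borel_measurable lebesgue"
    using g Omega_lebesgue by (simp add: borel_measurable_restrict_space_iff)
  have "(\<lambda>x. indicator T x :: real) \<in> borel_measurable lebesgue"
    using T_borel[OF T] by (intro borel_measurable_indicator) simp
  from borel_measurable_scaleR[OF this a]
  have "(\<lambda>x. indicator T x *\<^sub>R indicator \<Omega> x *\<^sub>R g x) \<in> borel_measurable lebesgue" .
  then have "(\<lambda>x. indicator T x *\<^sub>R g x) \<in> borel_measurable lebesgue"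
  proof (rule measurable_completion_cong)
    show "closure \<Omega> - \<Omega> \<in> null_sets lebesgue" using negligible_boundary by (simp add: negligible_iff_null_sets)
    show "indicator T x *\<^sub>R g x = indicator T x *\<^sub>R indicator \<Omega> x *\<^sub>R g x" if "x \<notin> closure \<Omega> - \<Omega>" for x
      using that T_sub[OF T] by (auto simp: indicator_def)
  qed
  then show ?thesis using T_borel[OF T] by (simp add: borel_measurable_restrict_space_iff)
qed

lemma AE_boundary: "AE x in lebesgue. x \<notin> closure \<Omega> - \<Omega>"
  using negligible_boundary by (intro AE_not_in) (simp add: negligible_iff_null_sets)

lemma AE_on_element:
  assumes "AE x in lebesgue_on \<Omega>. P x" and T: "T \<in> \<T>"
  shows "AE x in lebesgue_on T. P x"
proof -
  have "AE x in lebesgue. x \<in> \<Omega> \<longrightarrow> P x"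
    using assms(1) Omega_lebesgue by (subst (asm) AE_restrict_space_iff) auto
  then have "AE x in lebesgue. x \<in> T \<longrightarrow> P x"
    using AE_boundary by eventually_elim (use T_sub[OF T] in auto)
  then show ?thesis using T_borel[OF T] by (subst AE_restrict_space_iff) auto
qed

lemma L2_on_element:
  assumes f: "L2_fun (lebesgue_on \<Omega>) f" and T: "T \<in> \<T>"
  shows "L2_fun (lebesgue_on T) f"
proof -
  have m: "f \<in> borel_measurable (lebesgue_on T)" using measurable_on_element f T unfolding L2_fun_def by blast
  have i: "integrable lebesgue (\<lambda>x. indicator \<Omega> x *\<^sub>R (f x)\<^sup>2)"
    using f Omega_lebesgue unfolding L2_fun_def by (simp add: integrable_restrict_space)
  have "integrable lebesgue (\<lambda>x. indicator T x *\<^sub>R indicator \<Omega> x *\<^sub>R (f x)\<^sup>2)"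
    using T_borel[OF T] by (intro integrable_mult_indicator i) simp
  moreover have "(\<lambda>x. indicator T x *\<^sub>R (f x)\<^sup>2) \<in> borel_measurable lebesgue"
    using borel_measurable_power[OF m, of 2] T_borel[OF T] by (simp add: borel_measurable_restrict_space_iff)
  moreover have "AE x in lebesgue. indicator T x *\<^sub>R indicator \<Omega> x *\<^sub>R (f x)\<^sup>2 = indicator T x *\<^sub>R (f x)\<^sup>2"
    using AE_boundary by eventually_elim (use T_sub[OF T] in \<open>auto simp: indicator_def\<close>)
  ultimately have "integrable lebesgue (\<lambda>x. indicator T x *\<^sub>R (f x)\<^sup>2)"
    by (rule integrable_cong_AE_imp)
  then show ?thesis unfolding L2_fun_def using m T_borel[OF T] by (simp add: integrable_restrict_space)
qed

text \<open>On a compact element the weak derivatives are bounded polynomials and \<open>b\<close>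
  is essentially bounded, so the operator is essentially bounded on a set of finite measure. Its
  products with square integrable functions are then integrable, as linearity of the form
  requires.\<close>

lemma weak_operator_L2:
  assumes v: "v \<in> WG" and T: "T \<in> \<T>"
  shows "L2_fun (lebesgue_on T) (weak_operator k \<epsilon> b \<E> v T)"
proof -
  let ?L = "weak_laplacian k \<E> v T" and ?G = "weak_gradient k \<E> v T" and ?M = "lebesgue_on T"
  have L: "real_polynomial_function ?L"
    using weak_laplacian_rep[OF v T] unfolding poly_rep_def by (auto intro: rpf_poly_fun)
  have G: "real_polynomial_function (\<lambda>x. ?G x $ i)" for i
    using weak_gradient_rep[OF v T, of i] unfolding poly_rep_def by (auto intro: rpf_poly_fun)
  have rm: "g \<in> borel_measurable ?M" if "real_polynomial_function g" for g
    using integrable_lebesgue_on_rpf[OF T_compact[OF T] that] by (rule borel_measurable_integrable)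
  have bm: "b \<in> borel_measurable ?M" using measurable_on_element[OF _ T] b unfolding Linf_vec_def by blast
  have bi: "(\<lambda>x. b x $ i) \<in> borel_measurable ?M" for i
    by (rule measurable_compose[OF bm]) (intro borel_measurable_continuous_onI continuous_intros)
  obtain C where C: "AE x in ?M. norm (b x) \<le> C" using AE_on_element[OF _ T] b unfolding Linf_vec_def by blast
  have meas: "weak_operator k \<epsilon> b \<E> v T \<in> borel_measurable ?M"
    unfolding weak_operator_def[abs_def] inner_vec_def inner_real_def
    by (intro borel_measurable_add borel_measurable_times borel_measurable_const borel_measurable_sum rm L G bi)
  obtain B1 where B1: "\<And>x. x \<in> T \<Longrightarrow> \<bar>?L x\<bar> \<le> B1"
    using rpf_bounded_on[OF L compact_imp_bounded[OF T_compact[OF T]]] by blast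
  have "\<exists>B. \<forall>x\<in>T. \<bar>?G x $ i\<bar> \<le> B" for i by (rule rpf_bounded_on[OF G compact_imp_bounded[OF T_compact[OF T]]])
  then obtain B2 where B2: "\<And>i x. x \<in> T \<Longrightarrow> \<bar>?G x $ i\<bar> \<le> B2 i" by metis
  define K where "K = \<bar>\<epsilon>\<bar> * B1 + C * (\<Sum>i\<in>UNIV. B2 i)"
  interpret finite_measure ?M
  proof
    show "emeasure ?M (space ?M) \<noteq> \<infinity>"
      using emeasure_compact_finite[OF T_compact[OF T]] T_borel[OF T]
      by (simp add: emeasure_restrict_space less_top)
  qed
  have "AE x in ?M. x \<in> T" using AE_space[of ?M] by simp
  with C have bound: "AE x in ?M. norm ((weak_operator k \<epsilon> b \<E> v T x)\<^sup>2) \<le> K\<^sup>2"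
  proof eventually_elim
    case (elim x)
    note x = elim(2)
    have "\<bar>weak_operator k \<epsilon> b \<E> v T x\<bar> \<le> \<bar>\<epsilon>\<bar> * \<bar>?L x\<bar> + \<bar>b x \<bullet> ?G x\<bar>"
      unfolding weak_operator_def using abs_triangle_ineq[of "- \<epsilon> * ?L x" "b x \<bullet> ?G x"] by (simp add: abs_mult)
    also have "\<dots> \<le> \<bar>\<epsilon>\<bar> * B1 + norm (b x) * norm (?G x)"
      by (intro add_mono mult_left_mono B1 x Cauchy_Schwarz_ineq2) auto
    also have "norm (b x) * norm (?G x) \<le> C * (\<Sum>i\<in>UNIV. B2 i)"
    proof (rule mult_mono)
      have "norm (?G x) \<le> (\<Sum>i\<in>UNIV. \<bar>?G x $ i\<bar>)" by (rule norm_le_l1_cart)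
      also have "\<dots> \<le> (\<Sum>i\<in>UNIV. B2 i)" by (intro sum_mono B2 x)
      finally show "norm (?G x) \<le> (\<Sum>i\<in>UNIV. B2 i)" .
      show "0 \<le> C" using elim(1) norm_ge_zero[of "b x"] by linarith
    qed (use elim in auto)
    finally have "\<bar>weak_operator k \<epsilon> b \<E> v T x\<bar> \<le> K" unfolding K_def by simp
    then have "\<bar>weak_operator k \<epsilon> b \<E> v T x\<bar>\<^sup>2 \<le> K\<^sup>2" by (intro power_mono) auto
    then show ?case by simp
  qed
  have "integrable ?M (\<lambda>x. (weak_operator k \<epsilon> b \<E> v T x)\<^sup>2)"
    by (rule integrable_const_bound[OF bound]) (use meas in simp)
  then show ?thesis unfolding L2_fun_def using meas by simp
qed

section \<open>The bilinear form\<close>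

definition load :: "(real^'d \<Rightarrow> real) \<Rightarrow> 'd weak_fun \<Rightarrow> real" where
  "load f v = (\<Sum>T\<in>\<T>. \<integral>x. f x * weak_operator k \<epsilon> b \<E> v T x \<partial>lebesgue_on T)"

abbreviation "form \<equiv> LSWG_form k \<epsilon> b \<T> \<E>"

lemma weak_operator_integral_comb:
  assumes C: "is_comb I c \<beta> v" and T: "T \<in> \<T>" and g: "L2_fun (lebesgue_on T) g"
  shows "(\<integral>x. g x * weak_operator k \<epsilon> b \<E> v T x \<partial>lebesgue_on T)
    = (\<Sum>i\<in>I. c i * (\<integral>x. g x * weak_operator k \<epsilon> b \<E> (\<beta> i) T x \<partial>lebesgue_on T))"
proof -
  note C' = is_combD[OF C]
  have "g x * weak_operator k \<epsilon> b \<E> v T x = (\<Sum>i\<in>I. c i * (g x * weak_operator k \<epsilon> b \<E> (\<beta> i) T x))" for x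
    unfolding weak_operator_comb[OF C T] by (simp add: sum_distrib_left mult_ac)
  then show ?thesis
    using L2_fun_mult[OF g weak_operator_L2[OF C'(2) T]]
    by (simp add: Bochner_Integration.integral_sum)
qed

lemma load_comb:
  assumes C: "is_comb I c \<beta> v" and f: "L2_fun (lebesgue_on \<Omega>) f"
  shows "load f v = (\<Sum>i\<in>I. c i * load f (\<beta> i))"
  unfolding load_def sum_distrib_left
  by (subst sum.swap) (intro sum.cong refl weak_operator_integral_comb[OF C] L2_on_element[OF f])

lemma LSWG_form_commute: "form u v = form v u"
  unfolding LSWG_form_def stab_form_def by (simp add: mult.commute)

lemma edge_poly_jump:
  "v \<in> WG \<Longrightarrow> T \<in> \<T> \<Longrightarrow> e \<in> edges T \<Longrightarrow> edge_poly e (\<lambda>x. v0 v T x - vb v e x)"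
  by (intro edge_poly_diff edge_poly_rpf WG_v0_rpf WG_vb edgesD)

lemma edge_poly_normal_jump:
  "v \<in> WG \<Longrightarrow> T \<in> \<T> \<Longrightarrow> e \<in> edges T \<Longrightarrow> edge_poly e (\<lambda>x. (grad (v0 v T) x - vg v e x) \<bullet> nrm T e)"
  unfolding inner_diff_left by (intro edge_poly_diff edge_poly_grad WG_v0_rpf WG_vg_inner edgesD)

lemma LSWG_form_comb:
  assumes C: "is_comb I c \<beta> v" and w: "w \<in> WG"
  shows "form w v = (\<Sum>i\<in>I. c i * form w (\<beta> i))"
proof -
  note C' = is_combD[OF C]
  have 1: "(\<integral>x. weak_operator k \<epsilon> b \<E> w T x * weak_operator k \<epsilon> b \<E> v T x \<partial>lebesgue_on T)
    = (\<Sum>i\<in>I. c i * (\<integral>x. weak_operator k \<epsilon> b \<E> w T x * weak_operator k \<epsilon> b \<E> (\<beta> i) T x \<partial>lebesgue_on T))"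
    if "T \<in> \<T>" for T by (rule weak_operator_integral_comb[OF C that weak_operator_L2[OF w that]])
  have 2: "bdry_integral \<E> T (\<lambda>e x. (v0 w T x - vb w e x) * (v0 v T x - vb v e x))
    = (\<Sum>i\<in>I. c i * bdry_integral \<E> T (\<lambda>e x. (v0 w T x - vb w e x) * (v0 (\<beta> i) T x - vb (\<beta> i) e x)))"
    if T: "T \<in> \<T>" for T
  proof (rule bdry_integral_lincomb[OF T _ C'(1)])
    fix e x assume e: "e \<in> edges T" "x \<in> e"
    have "v0 v T x - vb v e x = (\<Sum>i\<in>I. c i * (v0 (\<beta> i) T x - vb (\<beta> i) e x))"
      unfolding C'(4)[OF T] C'(5)[OF edgesD[OF e(1)] e(2)] by (simp add: sum_subtractf right_diff_distrib)
    then show "(v0 w T x - vb w e x) * (v0 v T x - vb v e x)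
      = (\<Sum>i\<in>I. c i * ((v0 w T x - vb w e x) * (v0 (\<beta> i) T x - vb (\<beta> i) e x)))"
      by (simp add: sum_distrib_left mult_ac)
  qed (intro edge_poly_mult edge_poly_jump w T C'(2))
  have gr: "grad (v0 v T) x \<bullet> n = (\<Sum>i\<in>I. c i * (grad (v0 (\<beta> i) T) x \<bullet> n))" if T: "T \<in> \<T>" for T x n
  proof -
    have "v0 v T = (\<lambda>x. \<Sum>i\<in>I. c i * v0 (\<beta> i) T x)" using C'(4)[OF T] by auto
    then show ?thesis using grad_lincomb[OF C'(1) WG_v0_rpf[OF C'(2) T], where c=c and x=x] by (simp add: inner_sum_left)
  qed
  have 3: "bdry_integral \<E> T (\<lambda>e x. ((grad (v0 w T) x - vg w e x) \<bullet> nrm T e) * ((grad (v0 v T) x - vg v e x) \<bullet> nrm T e))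
    = (\<Sum>i\<in>I. c i * bdry_integral \<E> T (\<lambda>e x. ((grad (v0 w T) x - vg w e x) \<bullet> nrm T e)
         * ((grad (v0 (\<beta> i) T) x - vg (\<beta> i) e x) \<bullet> nrm T e)))"
    if T: "T \<in> \<T>" for T
  proof (rule bdry_integral_lincomb[OF T _ C'(1)])
    fix e x assume e: "e \<in> edges T" "x \<in> e"
    have "(grad (v0 v T) x - vg v e x) \<bullet> nrm T e = (\<Sum>i\<in>I. c i * ((grad (v0 (\<beta> i) T) x - vg (\<beta> i) e x) \<bullet> nrm T e))"
      unfolding inner_diff_left gr[OF T] C'(6)[OF T e] by (simp add: sum_subtractf right_diff_distrib)
    then show "((grad (v0 w T) x - vg w e x) \<bullet> nrm T e) * ((grad (v0 v T) x - vg v e x) \<bullet> nrm T e)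
      = (\<Sum>i\<in>I. c i * (((grad (v0 w T) x - vg w e x) \<bullet> nrm T e) * ((grad (v0 (\<beta> i) T) x - vg (\<beta> i) e x) \<bullet> nrm T e)))"
      by (simp add: sum_distrib_left mult_ac)
  qed (intro edge_poly_mult edge_poly_normal_jump w T C'(2))
  have "form w v = (\<Sum>T\<in>\<T>. \<Sum>i\<in>I. c i * (
      (\<integral>x. weak_operator k \<epsilon> b \<E> w T x * weak_operator k \<epsilon> b \<E> (\<beta> i) T x \<partial>lebesgue_on T)
     + (inverse (diameter T ^ 3) * bdry_integral \<E> T (\<lambda>e x. (v0 w T x - vb w e x) * (v0 (\<beta> i) T x - vb (\<beta> i) e x))
     + inverse (diameter T) * bdry_integral \<E> T (\<lambda>e x. ((grad (v0 w T) x - vg w e x) \<bullet> nrm T e)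
         * ((grad (v0 (\<beta> i) T) x - vg (\<beta> i) e x) \<bullet> nrm T e)))))"
    unfolding LSWG_form_def stab_form_def sum.distrib[symmetric]
    by (intro sum.cong refl) (simp only: 1 2 3 distrib_left sum.distrib sum_distrib_left mult.left_commute)
  also have "\<dots> = (\<Sum>i\<in>I. c i * form w (\<beta> i))"
    unfolding LSWG_form_def stab_form_def sum.distrib[symmetric] sum_distrib_left by (rule sum.swap)
  finally show ?thesis .
qed

lemma bdry_integral_square_nonneg: "0 \<le> bdry_integral \<E> T (\<lambda>e x. F e x * F e x)"
  unfolding bdry_integral_def by (intro sum_nonneg integral_nonneg_AE) auto

lemma integral_square_nonneg: "0 \<le> (\<integral>x. g x * (g x :: real) \<partial>M)"
  by (rule integral_nonneg_AE) auto

lemma diameter_pos: "T \<in> \<T> \<Longrightarrow> 0 < diameter T"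
proof -
  assume T: "T \<in> \<T>"
  obtain x where "x \<in> interior T" using T_interior[OF T] by blast
  then obtain r where r: "r > 0" "ball x r \<subseteq> T" using mem_interior by blast
  then have "diameter (ball x r) \<le> diameter T" using compact_imp_bounded[OF T_compact[OF T]] diameter_subset by blast
  then show ?thesis using r(1) by (simp add: diameter_ball)
qed

lemma LSWG_form_nonneg: "0 \<le> form v v"
  unfolding LSWG_form_def stab_form_def
  using diameter_pos
  by (intro add_nonneg_nonneg sum_nonneg integral_square_nonneg mult_nonneg_nonneg
      bdry_integral_square_nonneg) (auto simp: less_imp_le)

text \<open>Every summand of the form is nonnegative, so each vanishes. The edge terms involve
  polynomials and vanish pointwise on the closed edge; the volume term contains \<open>b\<close> and
  vanishes only almost everywhere.\<close>

lemma LSWG_form_zero: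
  assumes v: "v \<in> WG" and z: "form v v = 0" and T: "T \<in> \<T>"
  shows "AE x in lebesgue_on T. weak_operator k \<epsilon> b \<E> v T x = 0"
    and "\<And>e x. e \<in> edges T \<Longrightarrow> x \<in> e \<Longrightarrow> v0 v T x = vb v e x"
    and "\<And>e x. e \<in> edges T \<Longrightarrow> x \<in> e \<Longrightarrow> grad (v0 v T) x \<bullet> nrm T e = vg v e x \<bullet> nrm T e"
proof -
  let ?A = "\<lambda>T. \<integral>x. weak_operator k \<epsilon> b \<E> v T x * weak_operator k \<epsilon> b \<E> v T x \<partial>lebesgue_on T"
  let ?F = "\<lambda>T e x. (v0 v T x - vb v e x) * (v0 v T x - vb v e x)"
  let ?G = "\<lambda>T e x. ((grad (v0 v T) x - vg v e x) \<bullet> nrm T e) * ((grad (v0 v T) x - vg v e x) \<bullet> nrm T e)"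
  let ?B = "\<lambda>T. inverse (diameter T ^ 3) * bdry_integral \<E> T (?F T)"
  let ?C = "\<lambda>T. inverse (diameter T) * bdry_integral \<E> T (?G T)"
  have nn: "0 \<le> ?A S" "0 \<le> ?B S" "0 \<le> ?C S" if "S \<in> \<T>" for S
    using diameter_pos[OF that]
    by (auto intro!: integral_square_nonneg mult_nonneg_nonneg bdry_integral_square_nonneg)
  have "(\<Sum>S\<in>\<T>. ?A S + (?B S + ?C S)) = 0"
    using z unfolding LSWG_form_def stab_form_def sum.distrib[symmetric] .
  moreover have "0 \<le> ?A S + (?B S + ?C S)" if "S \<in> \<T>" for S using nn[OF that] by (intro add_nonneg_nonneg)
  ultimately have "\<forall>S\<in>\<T>. ?A S + (?B S + ?C S) = 0"
    using sum_nonneg_eq_0_iff[OF finite_T, of "\<lambda>S. ?A S + (?B S + ?C S)"] by blast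
  then have "?A T + (?B T + ?C T) = 0" using T by blast
  then have zero: "?A T = 0" "?B T = 0" "?C T = 0" using nn[OF T] by linarith+
  have "AE x in lebesgue_on T. weak_operator k \<epsilon> b \<E> v T x * weak_operator k \<epsilon> b \<E> v T x = 0"
    using integral_nonneg_eq_0_iff_AE[OF L2_fun_mult[OF weak_operator_L2[OF v T] weak_operator_L2[OF v T]]] zero(1)
    by auto
  then show "AE x in lebesgue_on T. weak_operator k \<epsilon> b \<E> v T x = 0" by simp
  have bz: "(\<integral>x. F e x \<partial>flat_measure e) = 0"
    if "bdry_integral \<E> T F = 0" "\<And>e x. 0 \<le> F e x" "e \<in> edges T" for F e
    using that sum_nonneg_eq_0_iff[OF finite_edges, of T "\<lambda>e. \<integral>x. F e x \<partial>flat_measure e"]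
    unfolding bdry_integral_def by (auto simp: integral_nonneg_AE)
  have d: "diameter T \<noteq> 0" using diameter_pos[OF T] by simp
  have F0: "bdry_integral \<E> T (?F T) = 0" "bdry_integral \<E> T (?G T) = 0" using zero d by auto
  show "v0 v T x = vb v e x" if e: "e \<in> edges T" "x \<in> e" for e x
  proof -
    interpret mesh_edge e "nrm T e" x by (rule mesh_edgeI[OF T e])
    show ?thesis
      using edge_poly_zero[OF edge_poly_jump[OF v T e(1)] bz[OF F0(1) _ e(1)] e(2)] by simp
  qed
  show "grad (v0 v T) x \<bullet> nrm T e = vg v e x \<bullet> nrm T e" if e: "e \<in> edges T" "x \<in> e" for e x
  proof -
    interpret mesh_edge e "nrm T e" x by (rule mesh_edgeI[OF T e])
    show ?thesis
      using edge_poly_zero[OF edge_poly_normal_jump[OF v T e(1)] bz[OF F0(2) _ e(1)] e(2)]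
      by (simp add: inner_diff_left)
  qed
qed

text \<open>The load depends on \<open>v\<close> only through its weak operator. This is one half of
  the kernel condition that the semidefinite system asks of its right-hand side.\<close>

lemma load_zero:
  assumes v: "v \<in> WG" and z: "form v v = 0" shows "load f v = 0"
  unfolding load_def
proof (rule sum.neutral, rule ballI)
  fix T assume T: "T \<in> \<T>"
  show "(\<integral>x. f x * weak_operator k \<epsilon> b \<E> v T x \<partial>lebesgue_on T) = 0"
    by (rule integral_eq_zero_AE) (use LSWG_form_zero(1)[OF v z T] in \<open>auto elim: eventually_mono\<close>)
qed

text \<open>The other half of the kernel condition, for the contribution of the lifted boundary
  data: every integrand contains a vanishing factor.\<close>

lemma LSWG_form_zero_left:
  assumes v: "v \<in> WG" and z: "form v v = 0" shows "form w v = 0"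
proof -
  have "(\<integral>x. weak_operator k \<epsilon> b \<E> w T x * weak_operator k \<epsilon> b \<E> v T x \<partial>lebesgue_on T) = 0" if "T \<in> \<T>" for T
    by (rule integral_eq_zero_AE) (use LSWG_form_zero(1)[OF v z that] in \<open>auto elim: eventually_mono\<close>)
  moreover have "bdry_integral \<E> T (\<lambda>e x. (v0 w T x - vb w e x) * (v0 v T x - vb v e x))
    = bdry_integral \<E> T (\<lambda>e x. 0)" if T: "T \<in> \<T>" for T
    by (rule bdry_integral_cong[OF T edge_poly_const]) (simp add: LSWG_form_zero(2)[OF v z T])
  moreover have "bdry_integral \<E> T (\<lambda>e x. ((grad (v0 w T) x - vg w e x) \<bullet> nrm T e)
       * ((grad (v0 v T) x - vg v e x) \<bullet> nrm T e)) = bdry_integral \<E> T (\<lambda>e x. 0)" if T: "T \<in> \<T>" for T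
    by (rule bdry_integral_cong[OF T edge_poly_const]) (simp add: inner_diff_left LSWG_form_zero(3)[OF v z T])
  moreover have "bdry_integral \<E> T (\<lambda>e x. 0) = 0" for T by (simp add: bdry_integral_def)
  ultimately show ?thesis unfolding LSWG_form_def stab_form_def by simp
qed

end

section \<open>Green's formula and the classical form of the weak operators\<close>

lemma partial_deriv_diff:
  assumes "real_polynomial_function f" "real_polynomial_function g"
  shows "partial_deriv i (\<lambda>x. f x - g x) x = partial_deriv i f x - partial_deriv i g x"
  using partial_deriv_add[OF real_polynomial_function_diff[OF assms] assms(2), of i x] by simp

context wg_mesh
begin

lemma bdry_integral_diff:
  assumes T: "T \<in> \<T>" and F: "\<And>e. e \<in> edges T \<Longrightarrow> edge_poly e (F e)" "\<And>e. e \<in> edges T \<Longrightarrow> edge_poly e (G e)"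
  shows "bdry_integral \<E> T (\<lambda>e x. F e x - G e x) = bdry_integral \<E> T F - bdry_integral \<E> T G"
  using bdry_integral_lincomb[OF T, of "UNIV :: bool set" "\<lambda>i. if i then F else G" "\<lambda>e x. F e x - G e x"
      "\<lambda>i. if i then 1 else - 1"] F by (simp add: UNIV_bool split: if_splits)

text \<open>The divergence theorem for the field with components \<open>\<phi> i\<close>, in whose
  divergence the mixed first-order products cancel.\<close>

lemma green:
  assumes T: "T \<in> \<T>" and p: "real_polynomial_function p" and w: "real_polynomial_function w"
  shows "(\<integral>x. laplacian p x * w x \<partial>lebesgue_on T) = (\<integral>x. p x * laplacian w x \<partial>lebesgue_on T)
    - bdry_integral \<E> T (\<lambda>e x. p x * (grad w x \<bullet> nrm T e)) + bdry_integral \<E> T (\<lambda>e x. (grad p x \<bullet> nrm T e) * w x)"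
proof -
  define \<phi> where "\<phi> i x = partial_deriv i p x * w x - p x * partial_deriv i w x" for i x
  have pw: "real_polynomial_function (\<lambda>x. partial_deriv i p x * w x)" "real_polynomial_function (\<lambda>x. p x * partial_deriv i w x)" for i
    by (intro rpf_mult rpf_partial_deriv p w)+
  have \<phi>: "real_polynomial_function (\<phi> i)" for i
    unfolding \<phi>_def[abs_def] by (rule real_polynomial_function_diff[OF pw])
  have d\<phi>: "partial_deriv i (\<phi> i) x = partial_deriv i (partial_deriv i p) x * w x - p x * partial_deriv i (partial_deriv i w) x" for i x
    unfolding \<phi>_def[abs_def] partial_deriv_diff[OF pw]
      partial_deriv_mult[OF rpf_partial_deriv[OF p] w] partial_deriv_mult[OF p rpf_partial_deriv[OF w]] by simp
  have int: "integrable (lebesgue_on T) (\<lambda>x. laplacian p x * w x)" "integrable (lebesgue_on T) (\<lambda>x. p x * laplacian w x)"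
    by (intro integrable_lebesgue_on_rpf T_compact[OF T] rpf_mult rpf_laplacian p w)+
  have "(\<integral>x. laplacian p x * w x \<partial>lebesgue_on T) - (\<integral>x. p x * laplacian w x \<partial>lebesgue_on T)
    = (\<integral>x. laplacian p x * w x - p x * laplacian w x \<partial>lebesgue_on T)"
    by (rule Bochner_Integration.integral_diff[OF int, symmetric])
  also have "\<dots> = (\<Sum>i\<in>UNIV. 1 * (\<integral>x. partial_deriv i (\<phi> i) x \<partial>lebesgue_on T))"
    by (rule T_integral_lincomb[OF T rpf_partial_deriv[OF \<phi>]])
      (simp add: d\<phi> laplacian_def sum_distrib_left sum_distrib_right sum_subtractf)
  also have "\<dots> = (\<Sum>i\<in>UNIV. 1 * bdry_integral \<E> T (\<lambda>e x. \<phi> i x * nrm T e $ i))"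
    by (simp add: divergence_T[OF T \<phi>])
  also have "\<dots> = bdry_integral \<E> T (\<lambda>e x. (grad p x \<bullet> nrm T e) * w x - p x * (grad w x \<bullet> nrm T e))"
  proof (rule bdry_integral_lincomb[OF T, symmetric])
    show "edge_poly e (\<lambda>x. \<phi> i x * nrm T e $ i)" for i e
      by (rule edge_poly_mult[OF edge_poly_rpf[OF \<phi>] edge_poly_const])
  qed (simp_all add: \<phi>_def grad_def inner_vec_def sum_distrib_left sum_distrib_right
        sum_subtractf[symmetric] algebra_simps)
  also have "\<dots> = bdry_integral \<E> T (\<lambda>e x. (grad p x \<bullet> nrm T e) * w x) - bdry_integral \<E> T (\<lambda>e x. p x * (grad w x \<bullet> nrm T e))"
    by (rule bdry_integral_diff[OF T]) (intro edge_poly_mult edge_poly_grad edge_poly_rpf[OF p] edge_poly_rpf[OF w] p w)+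
  finally show ?thesis by simp
qed

text \<open>With these traces the defining identities are Green's formula and integration by parts
  for \<open>v0 v T\<close>. Its Laplacian and gradient have degree at most \<open>k - 1\<close>, so
  they are admissible representatives and uniqueness identifies them.\<close>

lemma weak_operators_classical:
  assumes v: "v \<in> WG" and T: "T \<in> \<T>"
    and tr: "\<And>e x. e \<in> edges T \<Longrightarrow> x \<in> e \<Longrightarrow> v0 v T x = vb v e x"
    and ntr: "\<And>e x. e \<in> edges T \<Longrightarrow> x \<in> e \<Longrightarrow> grad (v0 v T) x \<bullet> nrm T e = vg v e x \<bullet> nrm T e"
  shows "weak_laplacian k \<E> v T = laplacian (v0 v T)" "weak_gradient k \<E> v T = grad (v0 v T)"
proof -
  let ?p = "v0 v T"
  have p: "real_polynomial_function ?p" by (rule WG_v0_rpf[OF v T])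
  have b1: "bdry_integral \<E> T (\<lambda>e x. vb v e x * g e x) = bdry_integral \<E> T (\<lambda>e x. ?p x * g e x)"
    if "\<And>e. e \<in> edges T \<Longrightarrow> edge_poly e (g e)" for g
    by (rule bdry_integral_cong[OF T]) (simp_all add: tr edge_poly_mult[OF edge_poly_rpf[OF p] that])
  have b2: "bdry_integral \<E> T (\<lambda>e x. (vg v e x \<bullet> nrm T e) * w x) = bdry_integral \<E> T (\<lambda>e x. (grad ?p x \<bullet> nrm T e) * w x)"
    if "real_polynomial_function w" for w
    by (rule bdry_integral_cong[OF T]) (simp_all add: ntr edge_poly_mult[OF edge_poly_grad[OF p] edge_poly_rpf[OF that]])
  have "poly_rep T (lapl_fun v T) (laplacian ?p)" unfolding poly_rep_def
  proof (intro conjI ballI laplacian_in_poly_fun WG_v0[OF v T])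
    fix w :: "real^'d \<Rightarrow> real" assume "w \<in> poly_fun (k - 1)"
    then have w: "real_polynomial_function w" by (rule rpf_poly_fun)
    show "(\<integral>x. laplacian ?p x * w x \<partial>lebesgue_on T) = lapl_fun v T w"
      unfolding lapl_fun_def b1[OF edge_poly_grad[OF w]] b2[OF w] by (rule green[OF T p w])
  qed
  then show "weak_laplacian k \<E> v T = laplacian ?p" by (rule poly_rep_unique[OF T weak_laplacian_rep[OF v T]])
  have "poly_rep T (grad_fun v T i) (partial_deriv i ?p)" for i unfolding poly_rep_def
  proof (intro conjI ballI partial_deriv_in_poly_fun WG_v0[OF v T])
    fix w :: "real^'d \<Rightarrow> real" assume "w \<in> poly_fun (k - 1)"
    then have w: "real_polynomial_function w" by (rule rpf_poly_fun)
    have int: "integrable (lebesgue_on T) (\<lambda>x. ?p x * partial_deriv i w x)" "integrable (lebesgue_on T) (\<lambda>x. partial_deriv i ?p x * w x)"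
      by (intro integrable_lebesgue_on_rpf T_compact[OF T] rpf_mult rpf_partial_deriv p w)+
    have "(\<integral>x. ?p x * partial_deriv i w x \<partial>lebesgue_on T) + (\<integral>x. partial_deriv i ?p x * w x \<partial>lebesgue_on T)
      = (\<integral>x. partial_deriv i (\<lambda>x. ?p x * w x) x \<partial>lebesgue_on T)"
      unfolding partial_deriv_mult[OF p w] by (rule Bochner_Integration.integral_add[OF int, symmetric])
    also have "\<dots> = bdry_integral \<E> T (\<lambda>e x. ?p x * w x * nrm T e $ i)"
      by (rule divergence_T[OF T rpf_mult[OF p w]])
    finally show "(\<integral>x. partial_deriv i ?p x * w x \<partial>lebesgue_on T) = grad_fun v T i w"
      unfolding grad_fun_def b1[OF edge_poly_mult[OF edge_poly_rpf[OF w] edge_poly_const]] by (simp add: mult.assoc)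
  qed
  then have "(\<lambda>x. weak_gradient k \<E> v T x $ i) = partial_deriv i ?p" for i
    by (rule poly_rep_unique[OF T weak_gradient_rep[OF v T]])
  then have "weak_gradient k \<E> v T x $ i = grad ?p x $ i" for x i by (simp add: grad_def fun_eq_iff)
  then show "weak_gradient k \<E> v T = grad ?p" by (intro ext) (simp add: vec_eq_iff)
qed

lemma common_normal:
  assumes "T \<in> \<T>" "T' \<in> \<T>" "e \<in> edges T" "e \<in> edges T'"
  shows "nrm T' e = nrm T e \<or> nrm T' e = - nrm T e"
proof -
  obtain q where q: "q \<in> e"
    using polyhedral_cell_rel_interior_nonempty[OF E_cell[OF edgesD[OF assms(3)]]] rel_interior_subset by blast
  have S: "spans_hyperplane e (nrm T e) q" "spans_hyperplane e (nrm T' e) q"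
    using mesh_edgeI[OF assms(1,3) q] mesh_edgeI[OF assms(2,4) q] unfolding mesh_edge_def by auto
  show ?thesis
    by (rule spans_hyperplane_normal_unique[OF S(1) _ q spans_hyperplane_in[OF S(2)]])
      (use S(2) in \<open>auto simp: spans_hyperplane_def\<close>)
qed

text \<open>Bounding \<open>b\<close> and dividing by \<open>\<epsilon>\<close> leaves only
  continuous functions. The interior points that violate the inequality form an open null set, so
  there are none.\<close>

lemma pointwise_inequality:
  assumes T: "T \<in> \<T>" and p: "real_polynomial_function p" and \<epsilon>: "\<epsilon> > 0"
    and ae: "AE x in lebesgue_on T. - \<epsilon> * laplacian p x + b x \<bullet> grad p x = 0"
  shows "\<exists>C. \<forall>x\<in>interior T. \<bar>laplacian p x\<bar> \<le> C * (\<Sum>i\<in>UNIV. \<bar>partial_deriv i p x\<bar>)"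
proof -
  obtain C where C: "AE x in lebesgue_on T. norm (b x) \<le> C" using AE_on_element[OF _ T] b unfolding Linf_vec_def by blast
  define D where "D x = (\<Sum>i\<in>UNIV. \<bar>partial_deriv i p x\<bar>)" for x
  have "AE x in lebesgue_on T. \<bar>laplacian p x\<bar> \<le> C / \<epsilon> * D x"
    using C ae
  proof eventually_elim
    case (elim x)
    have "\<epsilon> * \<bar>laplacian p x\<bar> = \<bar>b x \<bullet> grad p x\<bar>" using elim(2) \<epsilon> by (simp add: abs_mult flip: abs_of_pos)
    also have "\<dots> \<le> norm (b x) * norm (grad p x)" by (rule Cauchy_Schwarz_ineq2)
    also have "\<dots> \<le> C * D x"
    proof (rule mult_mono)
      show "norm (grad p x) \<le> D x" using norm_le_l1_cart[of "grad p x"] by (simp add: D_def grad_def)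
      show "0 \<le> C" using elim(1) norm_ge_zero[of "b x"] by linarith
    qed (use elim in auto)
    finally show ?case using \<epsilon> by (simp add: pos_le_divide_eq mult.commute)
  qed
  then have ae': "AE x in lebesgue. x \<in> T \<longrightarrow> \<bar>laplacian p x\<bar> \<le> C / \<epsilon> * D x"
    using T_borel[OF T] by (subst (asm) AE_restrict_space_iff) auto
  define U where "U = interior T \<inter> {x. C / \<epsilon> * D x < \<bar>laplacian p x\<bar>}"
  have "open U" unfolding U_def D_def
    by (intro open_Int open_interior open_Collect_less continuous_intros rpf_continuous_on rpf_partial_deriv rpf_laplacian p)
  moreover have "negligible U"
  proof -
    have "AE x in lebesgue. x \<notin> U" using ae' interior_subset by (auto simp: U_def elim!: eventually_mono)
    then show ?thesis using \<open>open U\<close> by (simp add: negligible_iff_null_sets AE_iff_null_sets)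
  qed
  ultimately have "U = {}" using open_not_negligible by blast
  then show ?thesis unfolding U_def D_def by (intro exI[of _ "C / \<epsilon>"]) force
qed

lemma unique_continuation_element:
  assumes v: "v \<in> WG" and z: "form v v = 0" and \<epsilon>: "\<epsilon> > 0" and T: "T \<in> \<T>" and e: "e \<in> edges T"
    and dirichlet: "\<And>x. x \<in> e \<Longrightarrow> vb v e x = 0" and neumann: "\<And>x. x \<in> e \<Longrightarrow> vg v e x \<bullet> nrm T e = 0"
  shows "v0 v T = (\<lambda>x. 0)"
proof
  fix x
  note Z = LSWG_form_zero[OF v z T]
  have W: "weak_laplacian k \<E> v T = laplacian (v0 v T)" "weak_gradient k \<E> v T = grad (v0 v T)"
    using weak_operators_classical[OF v T] Z(2,3) by blast+
  have p: "real_polynomial_function (v0 v T)" by (rule WG_v0_rpf[OF v T])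
  have "AE x in lebesgue_on T. - \<epsilon> * laplacian (v0 v T) x + b x \<bullet> grad (v0 v T) x = 0"
    using Z(1) unfolding weak_operator_def W .
  then obtain C where C: "\<And>x. x \<in> interior T \<Longrightarrow>
      \<bar>laplacian (v0 v T) x\<bar> \<le> C * (\<Sum>i\<in>UNIV. \<bar>partial_deriv i (v0 v T) x\<bar>)"
    using pointwise_inequality[OF T p \<epsilon>] by blast
  have ne: "rel_interior e \<noteq> {}" by (rule polyhedral_cell_rel_interior_nonempty[OF E_cell[OF edgesD[OF e]]])
  then obtain q where q: "q \<in> e" using rel_interior_subset by blast
  have S: "norm (nrm T e) = 1" "affine hull e = {x. nrm T e \<bullet> (x - q) = 0}"
    using mesh_edgeI[OF T e q] unfolding mesh_edge_def spans_hyperplane_def by auto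
  show "v0 v T x = 0"
  proof (rule polynomial_unique_continuation[OF p S(1) ne S(2)])
    fix y assume y: "y \<in> rel_interior e"
    then have ye: "y \<in> e" using rel_interior_subset by blast
    show "v0 v T y = 0" "grad (v0 v T) y \<bullet> nrm T e = 0"
      using Z(2)[OF e ye] Z(3)[OF e ye] dirichlet[OF ye] neumann[OF ye] by auto
    obtain d where "d > 0" "\<And>t. 0 < t \<Longrightarrow> t < d \<Longrightarrow> y - t *\<^sub>R nrm T e \<in> interior T"
      using is_normal[OF T e] y unfolding is_outward_normal_def by blast
    then show "\<exists>\<delta>>0. \<forall>t. 0 < t \<and> t < \<delta> \<longrightarrow> \<bar>laplacian (v0 v T) (y - t *\<^sub>R nrm T e)\<bar>
       \<le> C * (\<Sum>i\<in>UNIV. \<bar>partial_deriv i (v0 v T) (y - t *\<^sub>R nrm T e)\<bar>)"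
      using C by (intro exI[of _ d]) blast
  qed
qed

text \<open>The edge components are shared by both elements and carry the zero traces of
  \<open>T\<close> over to \<open>T'\<close>; an opposite normal only changes a sign.\<close>

lemma zero_propagates:
  assumes v: "v \<in> WG" and z: "form v v = 0" and \<epsilon>: "\<epsilon> > 0" and T: "T \<in> \<T>" and T': "T' \<in> \<T>"
    and e: "e \<in> edges T" "e \<in> edges T'" and zero: "v0 v T = (\<lambda>x. 0)"
  shows "v0 v T' = (\<lambda>x. 0)"
proof (rule unique_continuation_element[OF v z \<epsilon> T' e(2)])
  note Z = LSWG_form_zero[OF v z T]
  fix x assume x: "x \<in> e"
  show "vb v e x = 0" using Z(2)[OF e(1) x] zero by simp
  have "vg v e x \<bullet> nrm T e = 0"
    using Z(3)[OF e(1) x] zero by (simp add: grad_def partial_deriv_const zero_vec_def[symmetric])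
  then show "vg v e x \<bullet> nrm T' e = 0" using common_normal[OF T T' e] by auto
qed

text \<open>Two generic interior points are joined by a segment that avoids the codimension-two skeleton, so
  that it passes from element to element through common edges.\<close>

lemma mesh_connected:
  assumes step: "\<And>T T' e. T \<in> \<T> \<Longrightarrow> T' \<in> \<T> \<Longrightarrow> e \<in> edges T \<Longrightarrow> e \<in> edges T' \<Longrightarrow> P T \<Longrightarrow> P T'"
    and T1: "T1 \<in> \<T>" "P T1" and T2: "T2 \<in> \<T>"
  shows "P T2"
proof (rule ccontr)
  assume nP: "\<not> P T2"
  show False
  proof (rule skeleton_ex)
    fix \<Z> assume Z: "finite \<Z>" "\<And>Z. Z \<in> \<Z> \<Longrightarrow> aff_dim Z \<le> int CARD('d) - 2"
      "\<And>x e. e \<in> \<E> \<Longrightarrow> x \<in> e \<Longrightarrow> x \<notin> \<Union>\<Z> \<Longrightarrow> x \<in> rel_interior e"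
      "\<And>x e e'. e \<in> \<E> \<Longrightarrow> e' \<in> \<E> \<Longrightarrow> x \<in> e \<Longrightarrow> x \<in> e' \<Longrightarrow> x \<notin> \<Union>\<Z> \<Longrightarrow> e = e'"
    have "negligible (\<Union>\<Z>)"
      using Z(1) by (rule negligible_Union) (use Z(2) in \<open>force intro: negligible_aff_dim\<close>)
    then have "\<not> interior T1 \<subseteq> \<Union>\<Z>"
      using open_not_negligible[OF open_interior T_interior[OF T1(1)]] negligible_subset by blast
    then obtain x where x: "x \<in> interior T1" "x \<notin> \<Union>\<Z>" by blast
    \<comment> \<open>If the segment from \<open>x\<close> met a piece \<open>Z\<close>, its end
      point would lie in the affine hull of \<open>x\<close> and \<open>Z\<close>, of codimension at
      least one. A generic end point avoids these hulls.\<close>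
    have "negligible (\<Union>Z\<in>\<Z>. affine hull (insert x Z))"
    proof (rule negligible_Union)
      fix X assume "X \<in> (\<lambda>Z. affine hull (insert x Z)) ` \<Z>"
      then obtain W where W: "W \<in> \<Z>" "X = affine hull (insert x W)" by blast
      have "aff_dim X < int CARD('d)" using Z(2)[OF W(1)] unfolding W(2) by (simp add: aff_dim_insert)
      then show "negligible X" by (rule negligible_aff_dim)
    qed (use Z(1) in simp)
    then have "\<not> interior T2 \<subseteq> (\<Union>Z\<in>\<Z>. affine hull (insert x Z))"
      using open_not_negligible[OF open_interior T_interior[OF T2]] negligible_subset by blast
    then obtain y where y: "y \<in> interior T2" "\<And>Z. Z \<in> \<Z> \<Longrightarrow> y \<notin> affine hull (insert x Z)" by blast
    have seg: "z \<notin> \<Union>\<Z>" if z: "z \<in> closed_segment x y" for z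
    proof
      assume "z \<in> \<Union>\<Z>"
      then obtain W where W: "W \<in> \<Z>" "z \<in> W" by blast
      obtain s where s: "z = (1 - s) *\<^sub>R x + s *\<^sub>R y" using z unfolding in_segment by blast
      have "s \<noteq> 0" using s x(2) W by auto
      then have "y = (1 - 1 / s) *\<^sub>R x + (1 / s) *\<^sub>R z"
        unfolding s by (simp add: scaleR_add_right algebra_simps)
      moreover have "(1 - 1 / s) *\<^sub>R x + (1 / s) *\<^sub>R z \<in> affine hull (insert x W)"
        using W(2) by (intro mem_affine affine_affine_hull) (auto intro: hull_inc)
      ultimately show False using y(2)[OF W(1)] by simp
    qed
    define \<A> where "\<A> = {T\<in>\<T>. P T}"
    define \<B> where "\<B> = {T\<in>\<T>. \<not> P T}"
    have cl: "closed (\<Union>\<A>)" "closed (\<Union>\<B>)" unfolding \<A>_def \<B>_def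
      using finite_T T_compact by (auto intro!: closed_Union compact_imp_closed)
    have "x \<in> closure \<Omega>" "y \<in> closure \<Omega>"
      using x(1) y(1) interior_subset T_sub[OF T1(1)] T_sub[OF T2] by blast+
    then have "closed_segment x y \<subseteq> closure \<Omega>"
      using convex_closure[OF domain(3)] by (intro closed_segment_subset) auto
    then have cover: "closed_segment x y \<subseteq> \<Union>\<A> \<union> \<Union>\<B>" using mesh_cover unfolding \<A>_def \<B>_def by blast
    have "x \<in> \<Union>\<A> \<inter> closed_segment x y" "y \<in> \<Union>\<B> \<inter> closed_segment x y"
      using x(1) y(1) T1 T2 nP interior_subset unfolding \<A>_def \<B>_def by auto
    \<comment> \<open>The segment is connected and covered by two closed sets that both meet it, so
      they share a point of it; there an element with \<open>P\<close> touches one without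
      it.\<close>
    then have "\<Union>\<A> \<inter> \<Union>\<B> \<inter> closed_segment x y \<noteq> {}"
      using connected_closedD[OF connected_segment(1)[of x y] _ cover cl] by blast
    then obtain z S S' where zz: "z \<in> closed_segment x y" "z \<in> S" "S \<in> \<T>" "P S" "z \<in> S'" "S' \<in> \<T>" "\<not> P S'"
      unfolding \<A>_def \<B>_def by blast
    \<comment> \<open>A point of \<open>B\<close> is a limit of interior points of \<open>B\<close>,
      and interiors are disjoint, so it is not interior to another element. The shared point
      therefore lies on both frontiers.\<close>
    have nint: "z \<notin> interior A" if "A \<in> \<T>" "B \<in> \<T>" "A \<noteq> B" "z \<in> B" for A B
    proof
      assume "z \<in> interior A"
      moreover have "z \<in> closure (interior B)" using T_closure_interior[OF that(2)] that(4) by simp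
      ultimately have "interior A \<inter> interior B \<noteq> {}"
        using open_Int_closure_eq_empty[OF open_interior, of A "interior B"] by blast
      then show False using T_disjoint[OF that(1,2,3)] by simp
    qed
    have SS: "S \<noteq> S'" using zz by blast
    have "z \<in> frontier S" "z \<in> frontier S'"
      using nint[OF zz(3,6) SS zz(5)] nint[OF zz(6,3) SS[symmetric] zz(2)] zz closure_subset unfolding frontier_def by auto
    then obtain e e' where ee: "e \<in> edges S" "z \<in> e" "e' \<in> edges S'" "z \<in> e'"
      using frontier_T[OF zz(3)] frontier_T[OF zz(6)] by blast
    then have "e = e'" using Z(4)[OF edgesD edgesD] seg[OF zz(1)] by blast
    then show False using step[OF zz(3,6)] ee zz(4,7) by blast
  qed
qed

end

section \<open>The Cauchy boundary\<close>

text \<open>Data are given on the Cauchy part of a facet but projected on closed edges, whose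
  relative boundary may leave that part. \<open>N\<close> collects the excess, and the lines over it
  are null. The common pair \<open>m\<close>, \<open>q\<close> puts both surface integrals over one
  slab.\<close>

lemma L2_fun_flat_measure_mono:
  fixes e S :: "(real^'d) set"
  assumes e: "spans_hyperplane e m q" "e \<in> sets borel" and S: "spans_hyperplane S m q" "S \<in> sets borel"
    and sub: "e - N \<subseteq> S" and N: "negligible {x. \<exists>s. x + s *\<^sub>R m \<in> N}"
    and g: "L2_fun (flat_measure S) g"
  shows "L2_fun (flat_measure e) g"
proof -
  have mono: "(\<integral>\<^sup>+x. h x \<partial>flat_measure e) \<le> (\<integral>\<^sup>+x. h x \<partial>flat_measure S)"
    if h: "h \<in> borel_measurable borel" for h :: "real^'d \<Rightarrow> ennreal"
    unfolding nn_integral_flat_measure_slab[OF e h] nn_integral_flat_measure_slab[OF S h]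
  proof (rule nn_integral_mono_AE)
    show "AE x in lborel. indicator {0..1} (m \<bullet> (x - q)) * (indicator e (hyper_proj m q m x) * h (hyper_proj m q m x))
      \<le> indicator {0..1} (m \<bullet> (x - q)) * (indicator S (hyper_proj m q m x) * h (hyper_proj m q m x))"
      using AE_lborel_negligible[OF N]
    proof eventually_elim
      case (elim x)
      have "hyper_proj m q m x = x + (- ((m \<bullet> (x - q)) / (m \<bullet> m))) *\<^sub>R m" by (simp add: hyper_proj_def)
      moreover have "x + (- ((m \<bullet> (x - q)) / (m \<bullet> m))) *\<^sub>R m \<notin> N" using elim by blast
      ultimately have "hyper_proj m q m x \<notin> N" by simp
      then have "hyper_proj m q m x \<in> e \<Longrightarrow> hyper_proj m q m x \<in> S" using sub by blast
      then show ?case by (auto split: split_indicator)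
    qed
  qed
  obtain M where M: "flat_measure S = completion M" "sets M = sets borel" "space M = UNIV"
    unfolding flat_measure_def Let_def by auto
  obtain M' where M': "flat_measure e = completion M'" "sets M' = sets borel" "space M' = UNIV"
    unfolding flat_measure_def Let_def by auto
  have gm: "g \<in> borel_measurable (completion M)" "integrable (flat_measure S) (\<lambda>x. (g x)\<^sup>2)"
    using g unfolding L2_fun_def M by auto
  \<comment> \<open>\<open>g\<close> is known to be measurable only for the completion belonging to
    \<open>S\<close>. A Borel version and a Borel exceptional set transfer to \<open>e\<close>,
    since \<open>mono\<close> shows that this set is null there as well.\<close>
  obtain g' where g': "g' \<in> borel_measurable M" "AE x in M. g x = g' x"
    using completion_ex_borel_measurable_real[OF gm(1)] by blast
  have g'b: "g' \<in> borel_measurable borel" using g'(1) measurable_cong_sets[OF M(2) refl] by blast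
  obtain A where A: "{x \<in> space M. g x \<noteq> g' x} \<subseteq> A" "emeasure M A = 0" "A \<in> sets M"
    using AE_E[OF g'(2)] by blast
  have Ab: "A \<in> sets borel" using A(3) M(2) by simp
  have "emeasure (flat_measure e) A \<le> emeasure (flat_measure S) A"
    using mono[of "indicator A"] sets_flat_measure[OF e(2) Ab] sets_flat_measure[OF S(2) Ab] Ab by simp
  also have "\<dots> = 0"
  proof -
    have "A \<in> null_sets M" using A unfolding null_sets_def by blast
    then show ?thesis unfolding M(1) by (intro null_setsD1 null_sets_completionI)
  qed
  finally have An: "A \<in> null_sets (completion M')"
    using sets_flat_measure[OF e(2) Ab] unfolding M' null_sets_def by simp
  have g'M: "g' \<in> borel_measurable (completion M')" using borel_measurable_flat_measure[OF g'b, of e] unfolding M' .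
  have gm': "g \<in> borel_measurable (flat_measure e)"
    unfolding M' by (rule measurable_completion_cong[OF g'M An]) (use A(1) M(3) in auto)
  have aeS: "AE x in flat_measure S. g x = g' x" unfolding M using g'(2) by (rule AE_completion)
  have aee: "AE x in flat_measure e. g x = g' x"
    unfolding M' by (rule AE_I'[OF An]) (use A(1) M(3) in auto)
  have "(\<integral>\<^sup>+x. ennreal ((g x)\<^sup>2) \<partial>flat_measure e) = (\<integral>\<^sup>+x. ennreal ((g' x)\<^sup>2) \<partial>flat_measure e)"
    using aee by (intro nn_integral_cong_AE) (auto elim: eventually_mono)
  also have "\<dots> \<le> (\<integral>\<^sup>+x. ennreal ((g' x)\<^sup>2) \<partial>flat_measure S)" by (rule mono) (use g'b in measurable)
  also have "\<dots> = (\<integral>\<^sup>+x. ennreal ((g x)\<^sup>2) \<partial>flat_measure S)"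
    using aeS by (intro nn_integral_cong_AE) (auto elim: eventually_mono)
  also have "\<dots> < \<infinity>" using gm(2) by (simp add: integrable_iff_bounded)
  finally have "integrable (flat_measure e) (\<lambda>x. (g x)\<^sup>2)" using gm' by (intro integrableI_nonneg) auto
  then show ?thesis unfolding L2_fun_def using gm' by blast
qed

context mesh_edge
begin

text \<open>Existence comes from \<open>poly_riesz\<close>, whose kernel hypothesis holds because a
  polynomial of zero norm vanishes on \<open>e\<close>. The ambient polynomial is not determined,
  but its restriction to \<open>e\<close> is, so the \<open>THE\<close> is met.\<close>

lemma L2_proj_in_poly_on:
  assumes g: "L2_fun (flat_measure e) g"
  shows "L2_proj r e g \<in> poly_on r e"
proof -
  have L2: "L2_fun (flat_measure e) h" if "edge_poly e h" for h
    unfolding L2_fun_def power2_eq_square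
    using edge_poly_measurable[OF that] edge_poly_integrable[OF edge_poly_mult[OF that that]] by blast
  have restr: "(\<integral>x. restrict p e x * restrict q e x \<partial>flat_measure e) = (\<integral>x. p x * q x \<partial>flat_measure e)"
    if "p \<in> poly_fun r" "q \<in> poly_fun r" for p q
    using that by (intro edge_integral_cong edge_poly_mult edge_poly_restrict rpf_poly_fun) auto
  have restrg: "(\<integral>x. g x * restrict q e x \<partial>flat_measure e) = (\<integral>x. g x * q x \<partial>flat_measure e)"
    if q: "q \<in> poly_fun r" for q
  proof (rule integral_cong_AE)
    have gm: "g \<in> borel_measurable (flat_measure e)" using g unfolding L2_fun_def by blast
    show "(\<lambda>x. g x * restrict q e x) \<in> borel_measurable (flat_measure e)"
      by (rule borel_measurable_times[OF gm edge_poly_measurable[OF edge_poly_restrict[OF rpf_poly_fun[OF q]]]])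
    show "(\<lambda>x. g x * q x) \<in> borel_measurable (flat_measure e)"
      by (rule borel_measurable_times[OF gm edge_poly_measurable[OF edge_poly_rpf[OF rpf_poly_fun[OF q]]]])
    show "AE x in flat_measure e. g x * restrict q e x = g x * q x"
      using AE_flat_measure_in[OF spans edge_borel] by eventually_elim simp
  qed
  have "\<exists>p\<in>poly_fun r. \<forall>q\<in>poly_fun r. (\<integral>x. p x * q x \<partial>flat_measure e) = (\<integral>x. g x * q x \<partial>flat_measure e)"
  proof (rule poly_riesz)
    show "integrable (flat_measure e) p" if "real_polynomial_function p" for p
      using that by (intro edge_poly_integrable edge_poly_rpf)
    have i: "integrable (flat_measure e) (\<lambda>x. g x * mono_fun \<alpha> x)" for \<alpha>
      by (intro L2_fun_mult g L2 edge_poly_rpf rpf_mono_fun)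
    show "(\<integral>x. g x * (\<Sum>\<alpha>\<in>multi_indices r. c \<alpha> * mono_fun \<alpha> x) \<partial>flat_measure e)
      = (\<Sum>\<alpha>\<in>multi_indices r. c \<alpha> * (\<integral>x. g x * mono_fun \<alpha> x \<partial>flat_measure e))" for c
    proof -
      have "g x * (\<Sum>\<alpha>\<in>multi_indices r. c \<alpha> * mono_fun \<alpha> x) = (\<Sum>\<alpha>\<in>multi_indices r. c \<alpha> * (g x * mono_fun \<alpha> x))" for x
        by (simp add: sum_distrib_left mult_ac)
      then show ?thesis using i by (simp add: Bochner_Integration.integral_sum)
    qed
    show "(\<integral>x. g x * p x \<partial>flat_measure e) = 0" if "p \<in> poly_fun r" "(\<integral>x. p x * p x \<partial>flat_measure e) = 0" for p
    proof (rule integral_eq_zero_AE)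
      have "p x = 0" if "x \<in> e" for x
        using edge_poly_zero[OF edge_poly_rpf[OF rpf_poly_fun[OF \<open>p \<in> poly_fun r\<close>]] \<open>(\<integral>x. p x * p x \<partial>flat_measure e) = 0\<close> that] .
      then show "AE x in flat_measure e. g x * p x = 0"
        using AE_flat_measure_in[OF spans edge_borel] by (auto elim: eventually_mono)
    qed
  qed
  then obtain p where p: "p \<in> poly_fun r"
    "\<And>q. q \<in> poly_fun r \<Longrightarrow> (\<integral>x. p x * q x \<partial>flat_measure e) = (\<integral>x. g x * q x \<partial>flat_measure e)" by blast
  have char: "(\<forall>q\<in>poly_on r e. (\<integral>x. restrict p' e x * q x \<partial>flat_measure e) = (\<integral>x. g x * q x \<partial>flat_measure e)) \<longleftrightarrow>
      (\<forall>q\<in>poly_fun r. (\<integral>x. p' x * q x \<partial>flat_measure e) = (\<integral>x. g x * q x \<partial>flat_measure e))"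
    if "p' \<in> poly_fun r" for p'
    unfolding poly_on_def ball_simps using that by (simp add: restr restrg del: restrict_apply)
  have "L2_proj r e g = restrict p e" unfolding L2_proj_def
  proof (rule the_equality)
    show "restrict p e \<in> poly_on r e \<and> (\<forall>q\<in>poly_on r e.
       (\<integral>x. restrict p e x * q x \<partial>flat_measure e) = (\<integral>x. g x * q x \<partial>flat_measure e))"
      unfolding char[OF p(1)] using p unfolding poly_on_def by blast
    fix s assume s: "s \<in> poly_on r e \<and> (\<forall>q\<in>poly_on r e. (\<integral>x. s x * q x \<partial>flat_measure e) = (\<integral>x. g x * q x \<partial>flat_measure e))"
    then obtain p' where p': "p' \<in> poly_fun r" "s = restrict p' e" unfolding poly_on_def by blast
    have q: "(\<integral>x. p' x * q x \<partial>flat_measure e) = (\<integral>x. g x * q x \<partial>flat_measure e)" if "q \<in> poly_fun r" for q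
      using s that unfolding p'(2) char[OF p'(1)] by blast
    define d where "d x = p' x - p x" for x
    have d: "d \<in> poly_fun r" unfolding d_def[abs_def] by (rule poly_fun_diff[OF p'(1) p(1)])
    have "(\<integral>x. d x * d x \<partial>flat_measure e) = (\<integral>x. p' x * d x - p x * d x \<partial>flat_measure e)"
      by (simp add: d_def left_diff_distrib)
    also have "\<dots> = (\<integral>x. p' x * d x \<partial>flat_measure e) - (\<integral>x. p x * d x \<partial>flat_measure e)"
      using p(1) p'(1) d
      by (intro Bochner_Integration.integral_diff edge_poly_integrable edge_poly_rpf rpf_mult) (auto intro: rpf_poly_fun)
    also have "\<dots> = 0" using p(2)[OF d] q[OF d] by simp
    finally have "d x = 0" if "x \<in> e" for x
      using edge_poly_zero[OF edge_poly_rpf[OF rpf_poly_fun[OF d]] _ that] by blast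
    then show "s = restrict p e" unfolding p'(2) d_def by (intro restrict_ext) simp
  qed
  then show ?thesis using p(1) unfolding poly_on_def by blast
qed

end

locale lswg_problem = wg_mesh \<Omega> \<T> \<E> k \<epsilon> b
  for \<Omega> :: "(real^'d) set" and \<T> \<E> k \<epsilon> b +
  fixes \<Gamma>\<^sub>1 \<Gamma>\<^sub>2 :: "(real^'d) set"
  assumes Omega_ne: "\<Omega> \<noteq> {}" and polytope: "polytope (closure \<Omega>)"
    and Gamma_open: "openin (top_of_set (frontier \<Omega>)) \<Gamma>\<^sub>1" and Gamma_disj: "\<Gamma>\<^sub>1 \<inter> \<Gamma>\<^sub>2 = {}"
    and area: "surface_area \<Omega> \<Gamma>\<^sub>1 > 0" and resolves: "mesh_resolves_boundary \<Omega> \<Gamma>\<^sub>1 \<Gamma>\<^sub>2 \<E>"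
    and eps: "\<epsilon> > 0"
begin

abbreviation "\<E>\<^sub>1 \<equiv> edges_in \<E> \<Gamma>\<^sub>1"

lemma Gamma_frontier: "\<Gamma>\<^sub>1 \<subseteq> frontier \<Omega>" using openin_imp_subset[OF Gamma_open] .

lemma Gamma_borel: "\<Gamma>\<^sub>1 \<in> sets borel"
proof -
  obtain U where "open U" "\<Gamma>\<^sub>1 = frontier \<Omega> \<inter> U" using Gamma_open unfolding openin_open by blast
  then show ?thesis by simp
qed

lemma E1_edge: "e \<in> \<E>\<^sub>1 \<Longrightarrow> e \<in> \<E>" and E1_rel_interior: "e \<in> \<E>\<^sub>1 \<Longrightarrow> rel_interior e \<subseteq> \<Gamma>\<^sub>1"
  by (simp_all add: edges_in_def)

lemma edge_sub: "e \<in> \<E> \<Longrightarrow> e \<subseteq> closure \<Omega>"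
proof -
  assume "e \<in> \<E>"
  then obtain T where T: "T \<in> \<T>" "e \<in> edges T" using E_edges by blast
  then have "e \<subseteq> T" using edges_frontier frontier_subset_closed compact_imp_closed[OF T_compact] by blast
  then show ?thesis using T_sub[OF T(1)] by blast
qed

text \<open>The supporting functional attains its minimum over \<open>closure \<Omega>\<close> at
  the relative interior point \<open>x\<close> of \<open>e\<close>. A short step from
  \<open>x\<close> away from \<open>y\<close> stays in \<open>e\<close>, so the functional cannot
  grow towards \<open>y\<close> and is constant on \<open>e\<close>.\<close>

lemma edge_supporting_hyperplane:
  assumes e: "e \<in> \<E>" and x: "x \<in> rel_interior e" "x \<in> frontier \<Omega>"
  obtains a where "a \<noteq> 0" "\<And>y. y \<in> closure \<Omega> \<Longrightarrow> a \<bullet> x \<le> a \<bullet> y" "\<And>y. y \<in> \<Omega> \<Longrightarrow> a \<bullet> x < a \<bullet> y"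
    "\<And>y. y \<in> e \<Longrightarrow> a \<bullet> y = a \<bullet> x"
proof -
  have ri: "rel_interior \<Omega> = \<Omega>" using domain(1) by (rule rel_interior_open)
  have xO: "x \<in> closure \<Omega>" "x \<notin> rel_interior \<Omega>"
    using x(2) domain(1) by (auto simp: frontier_def interior_open ri)
  obtain a where a: "a \<noteq> 0" "\<And>y. y \<in> closure \<Omega> \<Longrightarrow> a \<bullet> x \<le> a \<bullet> y" "\<And>y. y \<in> rel_interior \<Omega> \<Longrightarrow> a \<bullet> x < a \<bullet> y"
    using supporting_hyperplane_relative_frontier[OF domain(3) xO] by blast
  obtain r where r: "r > 0" "ball x r \<inter> affine hull e \<subseteq> e" using x(1) mem_rel_interior_ball by blast
  have "a \<bullet> y = a \<bullet> x" if y: "y \<in> e" for y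
  proof (rule antisym)
    show "a \<bullet> x \<le> a \<bullet> y" using a(2) edge_sub[OF e] y by blast
    define d where "d = norm (y - x) + 1"
    \<comment> \<open>This keeps the step of length \<open>s * norm (y - x)\<close> below
      \<open>r\<close>; the \<open>+ 1\<close> in \<open>d\<close> covers
      \<open>y = x\<close>.\<close>
    define s where "s = r / (2 * d)"
    have d: "0 < d" by (simp add: d_def add_nonneg_pos)
    then have s: "0 < s" using r(1) by (simp add: s_def)
    have "s * d = r / 2" using d by (simp add: s_def)
    then have "s * norm (y - x) < r" using s r(1) by (simp add: d_def distrib_left)
    then have "x + s *\<^sub>R (x - y) \<in> ball x r" using s by (simp add: dist_norm norm_minus_commute)
    moreover have "x + s *\<^sub>R (x - y) \<in> affine hull e"
    proof -
      have xe: "x \<in> affine hull e" using x(1) rel_interior_subset hull_subset by (metis subsetD)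
      have "(1 + s) *\<^sub>R x + (- s) *\<^sub>R y \<in> affine hull e"
        by (rule mem_affine[OF affine_affine_hull xe hull_inc[OF y]]) simp
      then show ?thesis by (simp add: algebra_simps)
    qed
    ultimately have "x + s *\<^sub>R (x - y) \<in> closure \<Omega>" using r(2) edge_sub[OF e] by blast
    then have "0 \<le> s * (a \<bullet> x - a \<bullet> y)" using a(2) by (force simp: inner_add_right inner_diff_right)
    then show "a \<bullet> y \<le> a \<bullet> x" using s by (simp add: zero_le_mult_iff)
  qed
  then show ?thesis using that[OF a(1,2)] a(3) unfolding ri by blast
qed

text \<open>A step inwards stays in the interior of the element, hence in \<open>\<Omega>\<close>; a
  step outwards lands on the wrong side of the supporting hyperplane. So the element normal meets
  the defining conditions for \<open>closure \<Omega>\<close>.\<close>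

lemma boundary_normal:
  assumes e: "e \<in> \<E>\<^sub>1" and T: "T \<in> \<T>" "e \<in> edges T"
  shows "outward_normal (closure \<Omega>) e = nrm T e"
proof (rule outward_normal_eq[OF E_dim])
  show "e \<in> \<E>" by (rule E1_edge[OF e])
  then show ne: "rel_interior e \<noteq> {}" using polyhedral_cell_rel_interior_nonempty[OF E_cell] by blast
  have n: "is_outward_normal T e (nrm T e)" by (rule is_normal[OF T])
  show "is_outward_normal (closure \<Omega>) e (nrm T e)" unfolding is_outward_normal_def
  proof (intro conjI ballI)
    fix x assume x: "x \<in> rel_interior e"
    then have "x \<in> frontier \<Omega>" using E1_rel_interior[OF e] Gamma_frontier by blast
    then obtain a where a: "\<And>y. y \<in> closure \<Omega> \<Longrightarrow> a \<bullet> x \<le> a \<bullet> y" "\<And>y. y \<in> \<Omega> \<Longrightarrow> a \<bullet> x < a \<bullet> y"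
      using edge_supporting_hyperplane[OF E1_edge[OF e] x] by metis
    obtain d where d: "d > 0" "\<And>t. 0 < t \<Longrightarrow> t < d \<Longrightarrow> x - t *\<^sub>R nrm T e \<in> interior T"
      using n x unfolding is_outward_normal_def by blast
    show "\<exists>\<delta>>0. \<forall>t. 0 < t \<and> t < \<delta> \<longrightarrow> x - t *\<^sub>R nrm T e \<in> interior (closure \<Omega>) \<and> x + t *\<^sub>R nrm T e \<notin> closure \<Omega>"
    proof (intro exI[of _ d] conjI allI impI)
      fix t assume t: "0 < t \<and> t < d"
      then have i: "x - t *\<^sub>R nrm T e \<in> \<Omega>" using d(2)[of t] interior_T_sub[OF T(1)] by blast
      then show "x - t *\<^sub>R nrm T e \<in> interior (closure \<Omega>)" unfolding interior_closure_Omega .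
      have "t * (a \<bullet> nrm T e) < 0" using a(2)[OF i] by (simp add: inner_diff_right)
      then show "x + t *\<^sub>R nrm T e \<notin> closure \<Omega>" using a(1)[of "x + t *\<^sub>R nrm T e"] by (auto simp: inner_add_right)
    qed (use d in auto)
  qed (use n in \<open>auto simp: is_outward_normal_def\<close>)
qed

text \<open>The supporting hyperplane at \<open>e\<close> cuts out a proper face containing
  \<open>e\<close>, and the dimensions force it to be a facet. The data given on that facet are then
  transferred to \<open>e\<close>.\<close>

lemma data_on_edge:
  assumes e: "e \<in> \<E>\<^sub>1" and g: "\<And>F. F facet_of closure \<Omega> \<Longrightarrow> L2_fun (flat_measure (\<Gamma>\<^sub>1 \<inter> F)) g"
  shows "L2_fun (flat_measure e) g"
proof -
  have eE: "e \<in> \<E>" by (rule E1_edge[OF e])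
  note cell = E_cell[OF eE]
  obtain x where x: "x \<in> rel_interior e" using polyhedral_cell_rel_interior_nonempty[OF cell] by blast
  have xf: "x \<in> frontier \<Omega>" using x E1_rel_interior[OF e] Gamma_frontier by blast
  have xe: "x \<in> e" using x rel_interior_subset by blast
  obtain a where a: "a \<noteq> 0" "\<And>y. y \<in> closure \<Omega> \<Longrightarrow> a \<bullet> x \<le> a \<bullet> y" "\<And>y. y \<in> \<Omega> \<Longrightarrow> a \<bullet> x < a \<bullet> y"
    "\<And>y. y \<in> e \<Longrightarrow> a \<bullet> y = a \<bullet> x" using edge_supporting_hyperplane[OF eE x xf] by metis
  define F where "F = closure \<Omega> \<inter> {y. a \<bullet> y = a \<bullet> x}"
  have face: "F face_of closure \<Omega>" unfolding F_def
    using a(2) convex_closure[OF domain(3)] by (intro face_of_Int_supporting_hyperplane_ge) auto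
  have eF: "e \<subseteq> F" unfolding F_def using edge_sub[OF eE] a(4) by blast
  have "F \<noteq> closure \<Omega>"
  proof
    assume F: "F = closure \<Omega>"
    obtain y where y: "y \<in> \<Omega>" using Omega_ne by blast
    then have "y \<in> F" using F closure_subset by blast
    then have "a \<bullet> y = a \<bullet> x" by (simp add: F_def)
    then show False using a(3)[OF y] by simp
  qed
  then have lt: "aff_dim F < aff_dim (closure \<Omega>)" by (intro face_of_aff_dim_lt[OF _ face]) (use convex_closure[OF domain(3)] in auto)
  have dO: "aff_dim (closure \<Omega>) = int CARD('d)"
    using aff_dim_open[OF domain(1) Omega_ne] by (simp add: aff_dim_affine_hull2[of "closure \<Omega>" \<Omega>])
  have dF: "aff_dim F = int CARD('d) - 1" using lt dO aff_dim_subset[OF eF] E_dim[OF eE] by simp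
  have facet: "F facet_of closure \<Omega>" unfolding facet_of_def using face eF xe dF dO by auto
  obtain T where T: "T \<in> \<T>" "e \<in> edges T" using E_edges[OF eE] by blast
  interpret mesh_edge e "nrm T e" x by (rule mesh_edgeI[OF T xe])
  have ri: "affine hull (rel_interior e) = affine hull e"
    using closure_same_affine_hull[of "rel_interior e"] polyhedral_cell_closure[OF E_cell[OF eE]] by simp
  have hullF: "affine hull F = affine hull e"
    using aff_dim_eq_full_gen[OF eF] dF E_dim[OF eE] by simp
  have riS: "rel_interior e \<subseteq> \<Gamma>\<^sub>1 \<inter> F" using E1_rel_interior[OF e] eF rel_interior_subset by blast
  have "affine hull (\<Gamma>\<^sub>1 \<inter> F) = affine hull e"
    using hull_mono[OF riS, of affine] hull_mono[of "\<Gamma>\<^sub>1 \<inter> F" F affine] unfolding ri hullF by blast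
  then have S: "spans_hyperplane (\<Gamma>\<^sub>1 \<inter> F) (nrm T e) x" using spans unfolding spans_hyperplane_def by simp
  have Sb: "\<Gamma>\<^sub>1 \<inter> F \<in> sets borel" unfolding F_def
    by (intro sets.Int Gamma_borel borel_closed closed_closure closed_hyperplane)
  \<comment> \<open>Only the relative interior of \<open>e\<close> is known to lie in
    \<open>\<Gamma>\<^sub>1\<close>; the relative boundary has codimension two, so the normal lines
    over it form a null set.\<close>
  have "negligible {y. \<exists>s. y + s *\<^sub>R nrm T e \<in> e - rel_interior e}"
  proof -
    obtain \<Z> where Z: "finite \<Z>" "\<And>Z. Z \<in> \<Z> \<Longrightarrow> aff_dim Z \<le> int CARD('d) - 2" "e - rel_interior e \<subseteq> \<Union>\<Z>"
      using polyhedral_cell_skeleton[OF E_cell[OF eE] E_dim[OF eE]] by blast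
    have "negligible (\<Union>Z\<in>\<Z>. {y. \<exists>s. y + s *\<^sub>R nrm T e \<in> Z})"
      using Z by (intro negligible_Union) (auto intro!: negligible_lines_through)
    then show ?thesis by (rule negligible_subset) (use Z(3) in blast)
  qed
  then show ?thesis
    using L2_fun_flat_measure_mono[OF spans edge_borel S Sb _ _ g[OF facet]] riS by blast
qed

text \<open>Positive area cannot be carried by the skeleton, so \<open>\<Gamma>\<^sub>1\<close> has
  a point outside it. This point is in the relative interior of an edge, which the supporting
  hyperplane keeps on the frontier; the mesh resolves the boundary, and disjointness rules out
  \<open>\<Gamma>\<^sub>2\<close>.\<close>

lemma boundary_edge_ex: "\<exists>e T. e \<in> \<E>\<^sub>1 \<and> T \<in> \<T> \<and> e \<in> edges T"
proof (rule skeleton_ex)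
  fix \<Z> assume Z: "finite \<Z>" "\<And>Z. Z \<in> \<Z> \<Longrightarrow> aff_dim Z \<le> int CARD('d) - 2"
    "\<And>x e. e \<in> \<E> \<Longrightarrow> x \<in> e \<Longrightarrow> x \<notin> \<Union>\<Z> \<Longrightarrow> x \<in> rel_interior e"
    "\<And>x e e'. e \<in> \<E> \<Longrightarrow> e' \<in> \<E> \<Longrightarrow> x \<in> e \<Longrightarrow> x \<in> e' \<Longrightarrow> x \<notin> \<Union>\<Z> \<Longrightarrow> e = e'"
  obtain F where F: "F facet_of closure \<Omega>" "emeasure (flat_measure (\<Gamma>\<^sub>1 \<inter> F)) UNIV \<noteq> 0"
    using area sum.neutral unfolding surface_area_def by (metis (mono_tags, lifting) less_irrefl mem_Collect_eq)
  define S where "S = \<Gamma>\<^sub>1 \<inter> F"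
  have "closed F" using F(1) polytope face_of_imp_closed facet_of_imp_face_of polytope_imp_closed polytope_imp_convex by blast
  then have Sb: "S \<in> sets borel" unfolding S_def using Gamma_borel by (intro sets.Int) auto
  \<comment> \<open>An empty piece has the zero measure; it is excluded first because
    \<open>flat_measureE\<close> needs a base point.\<close>
  have Sne: "S \<noteq> {}"
  proof
    assume "S = {}"
    then have "flat_measure S = completion (distr (restrict_space lborel {}) borel (\<lambda>y. y - ((SOME n. norm n = 1) \<bullet> (y - (SOME p. False))) *\<^sub>R (SOME n. norm n = 1)))"
      unfolding flat_measure_def Let_def by simp
    moreover have "emeasure (completion (distr (restrict_space lborel {}) borel h)) UNIV = 0" for h :: "real^'d \<Rightarrow> real^'d"
    proof -
      have h: "h \<in> measurable (restrict_space lborel {}) borel"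
        by (auto simp: measurable_def space_restrict_space)
      show ?thesis by (simp add: emeasure_distr[OF h] space_restrict_space)
    qed
    ultimately show False using F(2) unfolding S_def by simp
  qed
  have "aff_dim F < DIM(real^'d)"
  proof -
    have "aff_dim F = aff_dim (closure \<Omega>) - 1" using F(1) by (simp add: facet_of_def)
    then show ?thesis using aff_dim_le_DIM[of "closure \<Omega>"] by simp
  qed
  then obtain a c where a: "a \<noteq> 0" "F \<subseteq> {x. a \<bullet> x = c}" using aff_lowdim_subset_hyperplane by blast
  have "norm (a /\<^sub>R norm a) = 1" using a(1) by simp
  moreover have "(a /\<^sub>R norm a) \<bullet> (x - y) = 0" if "x \<in> S" "y \<in> S" for x y
    using that a(2) unfolding S_def by (auto simp: inner_diff_right)
  ultimately obtain n p where n: "norm n = 1"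
    "flat_measure S = completion (distr (restrict_space lborel
        {y. hyper_proj n p n y \<in> S \<and> 0 \<le> n \<bullet> (y - p) \<and> n \<bullet> (y - p) \<le> 1}) borel (hyper_proj n p n))"
    using flat_measureE[OF Sne] by blast
  have "\<not> S \<subseteq> \<Union>\<Z>"
  proof
    assume sub: "S \<subseteq> \<Union>\<Z>"
    have "negligible (\<Union>Z\<in>\<Z>. {y. \<exists>s. y + s *\<^sub>R n \<in> Z})"
      using Z by (intro negligible_Union) (auto intro!: negligible_lines_through)
    from AE_lborel_negligible[OF this]
    have "AE x in lborel. indicator {0..1} (n \<bullet> (x - p)) * (indicator S (hyper_proj n p n x) * (1::ennreal)) = 0"
    proof eventually_elim
      case (elim x)
      have "hyper_proj n p n x = x + (- ((n \<bullet> (x - p)) / (n \<bullet> n))) *\<^sub>R n" by (simp add: hyper_proj_def)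
      moreover have "x + (- ((n \<bullet> (x - p)) / (n \<bullet> n))) *\<^sub>R n \<notin> \<Union>\<Z>" using elim by blast
      ultimately have "hyper_proj n p n x \<notin> \<Union>\<Z>" by simp
      then have "hyper_proj n p n x \<notin> S" using sub by blast
      then show ?case by simp
    qed
    then have "(\<integral>\<^sup>+x. 1 \<partial>flat_measure S) = 0"
      unfolding n(2) by (subst nn_integral_flat_aux[OF Sb]) (simp_all add: nn_integral_0_iff_AE[THEN iffD2] nn_integral_cong_AE[of _ "\<lambda>_. 0"])
    then show False using F(2) unfolding S_def by simp
  qed
  then obtain x where x: "x \<in> \<Gamma>\<^sub>1" "x \<in> F" "x \<notin> \<Union>\<Z>" unfolding S_def by blast
  have xf: "x \<in> frontier \<Omega>" using x(1) Gamma_frontier by blast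
  then have xO: "x \<in> closure \<Omega>" "x \<notin> \<Omega>" using domain(1) by (auto simp: frontier_def interior_open)
  obtain T where T: "T \<in> \<T>" "x \<in> T" using xO(1) mesh_cover by blast
  have "x \<notin> interior T" using interior_T_sub[OF T(1)] xO(2) by blast
  then have "x \<in> frontier T" using T(2) closure_subset unfolding frontier_def by blast
  then obtain e where e: "e \<in> edges T" "x \<in> e" using frontier_T[OF T(1)] by blast
  have eE: "e \<in> \<E>" by (rule edgesD[OF e(1)])
  have xr: "x \<in> rel_interior e" by (rule Z(3)[OF eE e(2) x(3)])
  obtain d where d: "\<And>y. y \<in> \<Omega> \<Longrightarrow> d \<bullet> x < d \<bullet> y" "\<And>y. y \<in> e \<Longrightarrow> d \<bullet> y = d \<bullet> x"
    using edge_supporting_hyperplane[OF eE xr xf] by metis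
  have "e \<subseteq> frontier \<Omega>" using edge_sub[OF eE] d domain(1) by (force simp: frontier_def interior_open)
  then have "rel_interior e \<subseteq> \<Gamma>\<^sub>1 \<or> rel_interior e \<subseteq> \<Gamma>\<^sub>2" using resolves eE unfolding mesh_resolves_boundary_def by blast
  then have "rel_interior e \<subseteq> \<Gamma>\<^sub>1" using xr x(1) Gamma_disj by blast
  then show "\<exists>e T. e \<in> \<E>\<^sub>1 \<and> T \<in> \<T> \<and> e \<in> edges T" using eE e(1) T(1) unfolding edges_in_def by blast
qed

lemma form_definite:
  assumes v: "v \<in> WG" and z: "form v v = 0"
    and D: "\<And>e x. e \<in> \<E>\<^sub>1 \<Longrightarrow> x \<in> e \<Longrightarrow> vb v e x = 0"
    and N: "\<And>e x. e \<in> \<E>\<^sub>1 \<Longrightarrow> x \<in> e \<Longrightarrow> vg v e x \<bullet> outward_normal (closure \<Omega>) e = 0"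
  shows "T \<in> \<T> \<Longrightarrow> v0 v T = (\<lambda>x. 0)" "e \<in> \<E> \<Longrightarrow> x \<in> e \<Longrightarrow> vb v e x = 0"
    "T \<in> \<T> \<Longrightarrow> e \<in> edges T \<Longrightarrow> x \<in> e \<Longrightarrow> vg v e x \<bullet> nrm T e = 0"
proof -
  obtain e1 T1 where e1: "e1 \<in> \<E>\<^sub>1" "T1 \<in> \<T>" "e1 \<in> edges T1" using boundary_edge_ex by blast
  have base: "v0 v T1 = (\<lambda>x. 0)"
    using D[OF e1(1)] N[OF e1(1)] unfolding boundary_normal[OF e1]
    by (rule unique_continuation_element[OF v z eps e1(2,3)])
  have 0: "v0 v T = (\<lambda>x. 0)" if "T \<in> \<T>" for T
    by (rule mesh_connected[where P = "\<lambda>T. v0 v T = (\<lambda>x. 0)", OF _ e1(2) base that])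
      (use zero_propagates[OF v z eps] in blast)+
  show "v0 v T = (\<lambda>x. 0)" if "T \<in> \<T>" by (rule 0[OF that])
  show "vb v e x = 0" if e: "e \<in> \<E>" "x \<in> e"
  proof -
    obtain T where T: "T \<in> \<T>" "e \<in> edges T" using E_edges[OF e(1)] by blast
    show ?thesis using LSWG_form_zero(2)[OF v z T e(2)] 0[OF T(1)] by simp
  qed
  show "vg v e x \<bullet> nrm T e = 0" if T: "T \<in> \<T>" "e \<in> edges T" "x \<in> e"
    using LSWG_form_zero(3)[OF v z T] 0[OF T(1)] by (simp add: grad_def partial_deriv_const zero_vec_def[symmetric])
qed

end

section \<open>Existence of a discrete solution\<close>

context wg_mesh
begin

section \<open>Linear combinations and unit functions in the discrete space\<close>

lemma vec_poly_fun_lincomb: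
  assumes "\<And>i. i \<in> I \<Longrightarrow> q i \<in> vec_poly_fun r"
  shows "(\<lambda>x. \<Sum>i\<in>I. c i *\<^sub>R q i x) \<in> vec_poly_fun r"
  using poly_fun_lincomb[of I "\<lambda>i x. q i x $ _" r c] assms unfolding vec_poly_fun_def by simp

lemma poly_on_lincomb:
  assumes "\<And>i. i \<in> I \<Longrightarrow> f i \<in> poly_on r e"
  shows "(\<lambda>x\<in>e. \<Sum>i\<in>I. c i * f i x) \<in> poly_on r e"
proof -
  have "\<forall>i\<in>I. \<exists>p. p \<in> poly_fun r \<and> f i = restrict p e" using assms unfolding poly_on_def by blast
  then obtain p where p: "\<And>i. i \<in> I \<Longrightarrow> p i \<in> poly_fun r" "\<And>i. i \<in> I \<Longrightarrow> f i = restrict (p i) e" by metis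
  have "(\<lambda>x\<in>e. \<Sum>i\<in>I. c i * f i x) = restrict (\<lambda>x. \<Sum>i\<in>I. c i * p i x) e"
    by (intro restrict_ext sum.cong refl) (simp add: p(2))
  then show ?thesis unfolding poly_on_def using poly_fun_lincomb[of I p r c] p(1) by blast
qed

lemma vec_poly_on_lincomb:
  assumes "\<And>i. i \<in> I \<Longrightarrow> f i \<in> vec_poly_on r e"
  shows "(\<lambda>x\<in>e. \<Sum>i\<in>I. c i *\<^sub>R f i x) \<in> vec_poly_on r e"
proof -
  have "\<forall>i\<in>I. \<exists>p. p \<in> vec_poly_fun r \<and> f i = restrict p e" using assms unfolding vec_poly_on_def by blast
  then obtain p where p: "\<And>i. i \<in> I \<Longrightarrow> p i \<in> vec_poly_fun r" "\<And>i. i \<in> I \<Longrightarrow> f i = restrict (p i) e" by metis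
  have "(\<lambda>x\<in>e. \<Sum>i\<in>I. c i *\<^sub>R f i x) = restrict (\<lambda>x. \<Sum>i\<in>I. c i *\<^sub>R p i x) e"
    by (intro restrict_ext sum.cong refl) (simp add: p(2))
  then show ?thesis unfolding vec_poly_on_def using vec_poly_fun_lincomb[of I p r c] p(1) by blast
qed

text \<open>An actual element of the space for given coefficients, with the tangential parts
  combined as well; \<open>is_comb\<close> is the weaker relation under which it is used.\<close>

definition wcomb :: "'i set \<Rightarrow> ('i \<Rightarrow> real) \<Rightarrow> ('i \<Rightarrow> 'd weak_fun) \<Rightarrow> 'd weak_fun" where
  "wcomb I c \<beta> = \<lparr>v0 = (\<lambda>T\<in>\<T>. \<lambda>x. \<Sum>i\<in>I. c i * v0 (\<beta> i) T x),
     vb = (\<lambda>e\<in>\<E>. \<lambda>x\<in>e. \<Sum>i\<in>I. c i * vb (\<beta> i) e x),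
     vg = (\<lambda>e\<in>\<E>. \<lambda>x\<in>e. \<Sum>i\<in>I. c i *\<^sub>R vg (\<beta> i) e x)\<rparr>"

lemma wcomb_WG:
  assumes "\<And>i. i \<in> I \<Longrightarrow> \<beta> i \<in> WG"
  shows "wcomb I c \<beta> \<in> WG"
proof -
  have "v0 (\<beta> i) T \<in> poly_fun k" if "i \<in> I" "T \<in> \<T>" for i T using assms that WG_v0 by blast
  moreover have "vb (\<beta> i) e \<in> poly_on k e" "vg (\<beta> i) e \<in> vec_poly_on (k - 1) e" if "i \<in> I" "e \<in> \<E>" for i e
    using assms[OF that(1)] that(2) unfolding WG_space_def by (auto simp: PiE_iff)
  ultimately show ?thesis
    unfolding WG_space_def wcomb_def by (auto intro!: poly_fun_lincomb poly_on_lincomb vec_poly_on_lincomb)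
qed

lemma wcomb_is_comb:
  assumes "finite I" "\<And>i. i \<in> I \<Longrightarrow> \<beta> i \<in> WG"
  shows "is_comb I c \<beta> (wcomb I c \<beta>)"
  using assms wcomb_WG[of I \<beta> c] unfolding is_comb_def
  by (auto simp: wcomb_def inner_sum_left edges_of_def)

definition weak_unit :: "((real^'d) set \<Rightarrow> real^'d \<Rightarrow> real) \<Rightarrow> ((real^'d) set \<Rightarrow> real^'d \<Rightarrow> real) \<Rightarrow>
    ((real^'d) set \<Rightarrow> real^'d \<Rightarrow> real^'d) \<Rightarrow> 'd weak_fun" where
  "weak_unit p q g = \<lparr>v0 = restrict p \<T>, vb = (\<lambda>e\<in>\<E>. restrict (q e) e), vg = (\<lambda>e\<in>\<E>. restrict (g e) e)\<rparr>"

lemma weak_unit_WG: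
  assumes "\<And>T. T \<in> \<T> \<Longrightarrow> p T \<in> poly_fun k" "\<And>e. e \<in> \<E> \<Longrightarrow> q e \<in> poly_fun k"
    "\<And>e. e \<in> \<E> \<Longrightarrow> g e \<in> vec_poly_fun (k - 1)"
  shows "weak_unit p q g \<in> WG"
  using assms unfolding WG_space_def weak_unit_def poly_on_def vec_poly_on_def by auto

lemma vec_poly_fun_zero: "(\<lambda>x. 0) \<in> vec_poly_fun r"
  unfolding vec_poly_fun_def by (simp add: poly_fun_zero)

lemma vec_poly_fun_scaleR: "p \<in> poly_fun r \<Longrightarrow> (\<lambda>x. p x *\<^sub>R n) \<in> vec_poly_fun r"
  unfolding vec_poly_fun_def
proof (intro CollectI allI)
  fix i assume "p \<in> poly_fun r"
  from poly_fun_cmul[OF this, of "n $ i"] show "(\<lambda>x. (p x *\<^sub>R n) $ i) \<in> poly_fun r" by (simp add: mult.commute)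
qed

end

text \<open>Degrees of freedom: monomials on elements, on edges, and vector-valued monomials on edges; edges
  on \<open>\<Gamma>\<^sub>1\<close> are left out.\<close>

type_synonym ('a, 'b) dof = "('a \<times> ('b \<Rightarrow> nat)) + (('a \<times> ('b \<Rightarrow> nat)) + ('a \<times> ('b \<times> ('b \<Rightarrow> nat))))"

context lswg_problem
begin

definition dofs :: "((real^'d) set, 'd) dof set" where
  "dofs = (\<T> \<times> multi_indices k) <+>
     (((\<E> - \<E>\<^sub>1) \<times> multi_indices k) <+> ((\<E> - \<E>\<^sub>1) \<times> (UNIV \<times> multi_indices (k - 1))))"

text \<open>A spanning family up to tangential parts on \<open>\<E>\<^sub>1\<close>, not a basis:
  ambient monomials are dependent on an edge once \<open>k \<ge> 1\<close>. The semidefinite solver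
  accepts this. Over \<open>dofs\<close> every member has zero edge components on
  \<open>\<E>\<^sub>1\<close>.\<close>

fun basis :: "((real^'d) set, 'd) dof \<Rightarrow> 'd weak_fun" where
  "basis (Inl (T, \<alpha>)) = weak_unit (\<lambda>T'. if T' = T then mono_fun \<alpha> else (\<lambda>x. 0)) (\<lambda>e x. 0) (\<lambda>e x. 0)"
| "basis (Inr (Inl (e, \<alpha>))) = weak_unit (\<lambda>T x. 0) (\<lambda>e'. if e' = e then mono_fun \<alpha> else (\<lambda>x. 0)) (\<lambda>e x. 0)"
| "basis (Inr (Inr (e, i, \<alpha>))) = weak_unit (\<lambda>T x. 0) (\<lambda>e x. 0)
     (\<lambda>e'. if e' = e then (\<lambda>x. mono_fun \<alpha> x *\<^sub>R axis i 1) else (\<lambda>x. 0))"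

lemma finite_dofs: "finite dofs"
  unfolding dofs_def using finite_T finite_E finite_multi_indices by (intro finite_Plus finite_cartesian_product) auto

lemma sum_dofs:
  fixes f :: "((real^'d) set, 'd) dof \<Rightarrow> real"
  shows "sum f dofs = (\<Sum>T\<in>\<T>. \<Sum>\<alpha>\<in>multi_indices k. f (Inl (T, \<alpha>)))
    + ((\<Sum>e\<in>\<E> - \<E>\<^sub>1. \<Sum>\<alpha>\<in>multi_indices k. f (Inr (Inl (e, \<alpha>))))
    + (\<Sum>e\<in>\<E> - \<E>\<^sub>1. \<Sum>i\<in>UNIV. \<Sum>\<alpha>\<in>multi_indices (k - 1). f (Inr (Inr (e, i, \<alpha>)))))"
proof -
  have fin: "finite (\<T> \<times> (multi_indices k :: ('d \<Rightarrow> nat) set))"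
    "finite ((\<E> - \<E>\<^sub>1) \<times> (multi_indices k :: ('d \<Rightarrow> nat) set))"
    "finite ((\<E> - \<E>\<^sub>1) \<times> ((UNIV :: 'd set) \<times> (multi_indices (k - 1) :: ('d \<Rightarrow> nat) set)))"
    using finite_T finite_E finite_multi_indices by (intro finite_cartesian_product; auto)+
  show ?thesis
    unfolding dofs_def sum.Plus[OF fin(1) finite_Plus[OF fin(2,3)]] sum.Plus[OF fin(2,3)]
    by (simp add: sum.cartesian_product')
qed

lemma basis_WG:
  assumes "j \<in> dofs" shows "basis j \<in> WG"
proof -
  consider T \<alpha> where "j = Inl (T, \<alpha>)" "\<alpha> \<in> multi_indices k"
    | e \<alpha> where "j = Inr (Inl (e, \<alpha>))" "\<alpha> \<in> multi_indices k"
    | e i \<alpha> where "j = Inr (Inr (e, i, \<alpha>))" "\<alpha> \<in> multi_indices (k - 1)"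
    using assms unfolding dofs_def by auto
  then show ?thesis
    by cases (auto intro!: weak_unit_WG simp: poly_fun_zero vec_poly_fun_zero mono_fun_in_poly_fun vec_poly_fun_scaleR)
qed

lemma basis_zero:
  assumes "j \<in> dofs" "e \<in> \<E>\<^sub>1" "x \<in> e" shows "vb (basis j) e x = 0" "vg (basis j) e x = 0"
proof -
  have e: "e \<in> \<E>" using assms(2) by (rule E1_edge)
  have "vb (basis j) e x = 0 \<and> vg (basis j) e x = 0"
    using assms e unfolding dofs_def by (auto simp: weak_unit_def)
  then show "vb (basis j) e x = 0" "vg (basis j) e x = 0" by auto
qed

text \<open>On edges in \<open>\<E>\<^sub>1\<close> a test function may keep a tangential part of
  \<open>vg\<close> that the family cannot produce. \<open>is_comb\<close> compares normal
  components only, and these vanish on both sides.\<close>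

lemma test_function_comb:
  assumes v: "v \<in> WG_space0 k \<Omega> \<Gamma>\<^sub>1 \<T> \<E>"
  shows "\<exists>c. is_comb dofs c basis v"
proof -
  have vW: "v \<in> WG" using v unfolding WG_space0_def by blast
  have "\<forall>T\<in>\<T>. \<exists>a. \<forall>x. v0 v T x = (\<Sum>\<alpha>\<in>multi_indices k. a \<alpha> * mono_fun \<alpha> x)"
    using WG_v0[OF vW] unfolding poly_fun_iff by metis
  then obtain a where a: "\<And>T x. T \<in> \<T> \<Longrightarrow> v0 v T x = (\<Sum>\<alpha>\<in>multi_indices k. a T \<alpha> * mono_fun \<alpha> x)" by metis
  have "\<exists>d. \<forall>x\<in>e. vb v e x = (\<Sum>\<alpha>\<in>multi_indices k. d \<alpha> * mono_fun \<alpha> x)" if e: "e \<in> \<E>" for e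
  proof -
    obtain p where p: "p \<in> poly_fun k" "vb v e = restrict p e"
      using vW e unfolding WG_space_def poly_on_def by (auto simp: PiE_iff)
    obtain d where "p = (\<lambda>x. \<Sum>\<alpha>\<in>multi_indices k. d \<alpha> * mono_fun \<alpha> x)" using p(1) unfolding poly_fun_iff by blast
    then show ?thesis using p(2) by auto
  qed
  then obtain d where d: "\<And>e x. e \<in> \<E> \<Longrightarrow> x \<in> e \<Longrightarrow> vb v e x = (\<Sum>\<alpha>\<in>multi_indices k. d e \<alpha> * mono_fun \<alpha> x)" by metis
  have "\<exists>h. \<forall>i. \<forall>x\<in>e. vg v e x $ i = (\<Sum>\<alpha>\<in>multi_indices (k - 1). h i \<alpha> * mono_fun \<alpha> x)" if e: "e \<in> \<E>" for e
  proof -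
    obtain p where p: "p \<in> vec_poly_fun (k - 1)" "vg v e = restrict p e"
      using vW e unfolding WG_space_def vec_poly_on_def by (auto simp: PiE_iff)
    have "\<exists>h. (\<lambda>x. p x $ i) = (\<lambda>x. \<Sum>\<alpha>\<in>multi_indices (k - 1). h \<alpha> * mono_fun \<alpha> x)" for i
      using p(1) unfolding vec_poly_fun_def poly_fun_iff by blast
    then obtain h where "\<And>i. (\<lambda>x. p x $ i) = (\<lambda>x. \<Sum>\<alpha>\<in>multi_indices (k - 1). h i \<alpha> * mono_fun \<alpha> x)" by metis
    then have "p x $ i = (\<Sum>\<alpha>\<in>multi_indices (k - 1). h i \<alpha> * mono_fun \<alpha> x)" for i x by metis
    then show ?thesis using p(2) by (intro exI[of _ h]) simp
  qed
  then obtain h where h: "\<And>e i x. e \<in> \<E> \<Longrightarrow> x \<in> e \<Longrightarrow> vg v e x $ i = (\<Sum>\<alpha>\<in>multi_indices (k - 1). h e i \<alpha> * mono_fun \<alpha> x)" by metis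
  define c :: "((real^'d) set, 'd) dof \<Rightarrow> real" where
    "c j = (case j of Inl (T, \<alpha>) \<Rightarrow> a T \<alpha> | Inr (Inl (e, \<alpha>)) \<Rightarrow> d e \<alpha> | Inr (Inr (e, i, \<alpha>)) \<Rightarrow> h e i \<alpha>)" for j
  have "is_comb dofs c basis v" unfolding is_comb_def
  proof (intro conjI ballI allI finite_dofs basis_WG vW)
    show "v0 v T x = (\<Sum>j\<in>dofs. c j * v0 (basis j) T x)" if T: "T \<in> \<T>" for T x
    proof -
      have "(\<Sum>j\<in>dofs. c j * v0 (basis j) T x) = (\<Sum>T'\<in>\<T>. if T = T' then \<Sum>\<alpha>\<in>multi_indices k. a T' \<alpha> * mono_fun \<alpha> x else 0)"
        unfolding sum_dofs using T by (auto simp: c_def weak_unit_def intro!: sum.cong)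
      then show ?thesis using T finite_T a[OF T] by simp
    qed
    show "vb v e x = (\<Sum>j\<in>dofs. c j * vb (basis j) e x)" if e: "e \<in> \<E>" "x \<in> e" for e x
    proof (cases "e \<in> \<E>\<^sub>1")
      case True
      then have "vb v e x = 0" using v e(2) unfolding WG_space0_def by blast
      then show ?thesis using basis_zero(1)[OF _ True e(2)] by simp
    next
      case False
      have "(\<Sum>j\<in>dofs. c j * vb (basis j) e x) = (\<Sum>e'\<in>\<E> - \<E>\<^sub>1. if e = e' then \<Sum>\<alpha>\<in>multi_indices k. d e' \<alpha> * mono_fun \<alpha> x else 0)"
        unfolding sum_dofs using e by (auto simp: c_def weak_unit_def intro!: sum.cong)
      then show ?thesis using False e finite_E d[OF e] by simp
    qed
    show "vg v e x \<bullet> nrm T e = (\<Sum>j\<in>dofs. c j * (vg (basis j) e x \<bullet> nrm T e))"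
      if T: "T \<in> \<T>" "e \<in> edges T" "x \<in> e" for T e x
    proof (cases "e \<in> \<E>\<^sub>1")
      case True
      then have "vg v e x \<bullet> nrm T e = 0" using v T(3) boundary_normal[OF True T(1,2)] unfolding WG_space0_def by fastforce
      then show ?thesis using basis_zero(2)[OF _ True T(3)] by simp
    next
      case False
      have e: "e \<in> \<E>" by (rule edgesD[OF T(2)])
      have "(\<Sum>j\<in>dofs. c j * (vg (basis j) e x \<bullet> nrm T e)) = (\<Sum>e'\<in>\<E> - \<E>\<^sub>1. if e = e' then
          \<Sum>i\<in>UNIV. \<Sum>\<alpha>\<in>multi_indices (k - 1). h e' i \<alpha> * (mono_fun \<alpha> x * nrm T e $ i) else 0)"
        unfolding sum_dofs using e T(3) by (auto simp: c_def weak_unit_def inner_axis' intro!: sum.cong)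
      also have "\<dots> = (\<Sum>i\<in>UNIV. \<Sum>\<alpha>\<in>multi_indices (k - 1). h e i \<alpha> * (mono_fun \<alpha> x * nrm T e $ i))"
        using False e finite_E by simp
      also have "\<dots> = vg v e x \<bullet> nrm T e"
        unfolding inner_vec_def using h[OF e T(3)] by (simp add: sum_distrib_right mult.assoc)
      finally show ?thesis by simp
    qed
  qed auto
  then show ?thesis by blast
qed

text \<open>A lift \<open>uD\<close> of the projected data is corrected by a combination of the
  family. Testing with the family suffices, since every test function is a combination of
  it.\<close>

lemma solution_exists:
  assumes f: "L2_fun (lebesgue_on \<Omega>) f"
    and g1: "\<And>F. F facet_of closure \<Omega> \<Longrightarrow> L2_fun (flat_measure (\<Gamma>\<^sub>1 \<inter> F)) g1"
    and g2: "\<And>F. F facet_of closure \<Omega> \<Longrightarrow> L2_fun (flat_measure (\<Gamma>\<^sub>1 \<inter> F)) g2"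
  shows "\<exists>u. LSWG_solution k \<Omega> \<Gamma>\<^sub>1 \<epsilon> b f g1 g2 \<T> \<E> u"
proof -
  have proj: "L2_proj r e g \<in> poly_on r e"
    if e: "e \<in> \<E>\<^sub>1" and g: "\<And>F. F facet_of closure \<Omega> \<Longrightarrow> L2_fun (flat_measure (\<Gamma>\<^sub>1 \<inter> F)) g" for e g r
  proof -
    obtain n q where "mesh_edge e n q" using mesh_edge_ex[OF E1_edge[OF e]] by blast
    then show ?thesis using mesh_edge.L2_proj_in_poly_on data_on_edge[OF e g] by blast
  qed
  have "\<forall>e\<in>\<E>\<^sub>1. \<exists>p. p \<in> poly_fun k \<and> (\<forall>x\<in>e. L2_proj k e g1 x = p x)"
    using proj[OF _ g1, of _ k] unfolding poly_on_def by (auto simp: image_iff) (metis restrict_apply')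
  then obtain p1 where p1: "\<And>e. e \<in> \<E>\<^sub>1 \<Longrightarrow> p1 e \<in> poly_fun k"
    "\<And>e x. e \<in> \<E>\<^sub>1 \<Longrightarrow> x \<in> e \<Longrightarrow> L2_proj k e g1 x = p1 e x" by metis
  have "\<forall>e\<in>\<E>\<^sub>1. \<exists>p. p \<in> poly_fun (k - 1) \<and> (\<forall>x\<in>e. L2_proj (k - 1) e g2 x = p x)"
    using proj[OF _ g2, of _ "k - 1"] unfolding poly_on_def by (auto simp: image_iff) (metis restrict_apply')
  then obtain p2 where p2: "\<And>e. e \<in> \<E>\<^sub>1 \<Longrightarrow> p2 e \<in> poly_fun (k - 1)"
    "\<And>e x. e \<in> \<E>\<^sub>1 \<Longrightarrow> x \<in> e \<Longrightarrow> L2_proj (k - 1) e g2 x = p2 e x" by metis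
  \<comment> \<open>The Neumann part is put along the unit normal, so its normal component is
    exactly \<open>p2\<close>; the element values are zero.\<close>
  define uD where "uD = weak_unit (\<lambda>T x. 0) (\<lambda>e. if e \<in> \<E>\<^sub>1 then p1 e else (\<lambda>x. 0))
     (\<lambda>e. if e \<in> \<E>\<^sub>1 then (\<lambda>x. p2 e x *\<^sub>R outward_normal (closure \<Omega>) e) else (\<lambda>x. 0))"
  have uD: "uD \<in> WG" unfolding uD_def
    using p1(1) p2(1) by (intro weak_unit_WG) (auto simp: poly_fun_zero vec_poly_fun_zero vec_poly_fun_scaleR)
  define A where "A i j = form (basis i) (basis j)" for i j
  define l where "l j = load f (basis j) - form (basis j) uD" for j
  have "\<exists>c. \<forall>i\<in>dofs. (\<Sum>j\<in>dofs. c j * A i j) = l i"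
  proof (rule psd_system_solvable[OF finite_dofs])
    show "A i j = A j i" for i j unfolding A_def by (rule LSWG_form_commute)
    have C: "is_comb dofs c basis (wcomb dofs c basis)" for c by (rule wcomb_is_comb[OF finite_dofs basis_WG])
    have q: "(\<Sum>i\<in>dofs. \<Sum>j\<in>dofs. c i * c j * A i j) = form (wcomb dofs c basis) (wcomb dofs c basis)" for c
    proof -
      have "form (wcomb dofs c basis) (wcomb dofs c basis) = (\<Sum>i\<in>dofs. c i * form (basis i) (wcomb dofs c basis))"
        unfolding LSWG_form_comb[OF C is_combD(3)[OF C]] by (simp add: LSWG_form_commute)
      also have "\<dots> = (\<Sum>i\<in>dofs. c i * (\<Sum>j\<in>dofs. c j * A i j))"
        unfolding A_def by (intro sum.cong refl) (simp add: LSWG_form_comb[OF C basis_WG])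
      finally show ?thesis by (simp add: sum_distrib_left mult.assoc)
    qed
    show "0 \<le> (\<Sum>i\<in>dofs. \<Sum>j\<in>dofs. c i * c j * A i j)" for c unfolding q by (rule LSWG_form_nonneg)
    \<comment> \<open>By linearity this is the load minus the form with \<open>uD\<close>, both at a
      combination of zero energy, where each vanishes.\<close>
    show "(\<Sum>i\<in>dofs. c i * l i) = 0" if "(\<Sum>i\<in>dofs. \<Sum>j\<in>dofs. c i * c j * A i j) = 0" for c
    proof -
      note z = that[unfolded q]
      have "(\<Sum>i\<in>dofs. c i * l i) = (\<Sum>i\<in>dofs. c i * load f (basis i)) - (\<Sum>i\<in>dofs. c i * form uD (basis i))"
        unfolding l_def by (simp add: right_diff_distrib sum_subtractf LSWG_form_commute[of _ uD])
      also have "\<dots> = load f (wcomb dofs c basis) - form uD (wcomb dofs c basis)"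
        unfolding load_comb[OF C f] LSWG_form_comb[OF C uD] ..
      also have "\<dots> = 0" using load_zero[OF is_combD(3)[OF C] z] LSWG_form_zero_left[OF is_combD(3)[OF C] z] by simp
      finally show ?thesis .
    qed
  qed
  then obtain c where c: "\<And>i. i \<in> dofs \<Longrightarrow> (\<Sum>j\<in>dofs. c j * A i j) = l i" by blast
  \<comment> \<open>The lift enters as the additional index \<open>None\<close> with coefficient
    one, so that \<open>u\<close> itself is a combination and the linearity lemmas apply to
    it.\<close>
  define I where "I = insert None (Some ` dofs)"
  define c' where "c' i = (case i of None \<Rightarrow> 1 | Some j \<Rightarrow> c j)" for i
  define \<beta>' where "\<beta>' i = (case i of None \<Rightarrow> uD | Some j \<Rightarrow> basis j)" for i
  have sumI: "(\<Sum>i\<in>I. c' i * F (\<beta>' i)) = F uD + (\<Sum>j\<in>dofs. c j * F (basis j))" for F :: "'d weak_fun \<Rightarrow> real"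
    unfolding I_def using finite_dofs by (simp add: sum.reindex c'_def \<beta>'_def)
  define u where "u = wcomb I c' \<beta>'"
  have C: "is_comb I c' \<beta>' u" unfolding u_def
    by (rule wcomb_is_comb) (use finite_dofs uD basis_WG in \<open>auto simp: I_def \<beta>'_def\<close>)
  note CD = is_combD[OF C]
  have "LSWG_solution k \<Omega> \<Gamma>\<^sub>1 \<epsilon> b f g1 g2 \<T> \<E> u" unfolding LSWG_solution_def
  proof (intro conjI ballI)
    show "u \<in> WG" by (rule CD(3))
    fix e x assume e: "e \<in> \<E>\<^sub>1" and x: "x \<in> e"
    have eE: "e \<in> \<E>" by (rule E1_edge[OF e])
    obtain T where T: "T \<in> \<T>" "e \<in> edges T" using E_edges[OF eE] by blast
    show "vb u e x = L2_proj k e g1 x"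
      unfolding CD(5)[OF eE x] sumI[of "\<lambda>w. vb w e x"] p1(2)[OF e x]
      using eE e x basis_zero(1)[OF _ e x] by (simp add: uD_def weak_unit_def)
    have n: "nrm T e \<bullet> nrm T e = 1" using is_normal[OF T] by (simp add: is_outward_normal_def norm_eq_1)
    have "vg u e x \<bullet> nrm T e = vg uD e x \<bullet> nrm T e"
      unfolding CD(6)[OF T x] sumI[of "\<lambda>w. vg w e x \<bullet> nrm T e"] using basis_zero(2)[OF _ e x] by simp
    then show "vg u e x \<bullet> outward_normal (closure \<Omega>) e = L2_proj (k - 1) e g2 x"
      unfolding p2(2)[OF e x] boundary_normal[OF e T]
      using eE e x n by (simp add: uD_def weak_unit_def boundary_normal[OF e T])
  next
    fix v assume "v \<in> WG_space0 k \<Omega> \<Gamma>\<^sub>1 \<T> \<E>"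
    then obtain d where d: "is_comb dofs d basis v" using test_function_comb by blast
    have "form u (basis j) = load f (basis j)" if j: "j \<in> dofs" for j
    proof -
      have "form (basis j) u = form (basis j) uD + (\<Sum>i\<in>dofs. c i * A j i)"
        unfolding LSWG_form_comb[OF C basis_WG[OF j]] sumI[of "form (basis j)"] A_def ..
      then show ?thesis using c[OF j] by (simp add: l_def LSWG_form_commute[of u])
    qed
    then have "form u v = load f v" unfolding LSWG_form_comb[OF d CD(3)] load_comb[OF d f] by simp
    then show "form u v = (\<Sum>T\<in>\<T>. \<integral>x. f x * weak_operator k \<epsilon> b \<E> v T x \<partial>lebesgue_on T)"
      unfolding load_def .
  qed
  then show ?thesis by blast
qed

text \<open>The difference of two solutions has zero Cauchy data, so it is an admissible test
  function, and testing with itself gives zero energy. Extensionality turns equality on elements and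
  edges into equality of \<open>v0\<close> and \<open>vb\<close>.\<close>

lemma solution_unique:
  assumes u: "LSWG_solution k \<Omega> \<Gamma>\<^sub>1 \<epsilon> b f g1 g2 \<T> \<E> u" and w: "LSWG_solution k \<Omega> \<Gamma>\<^sub>1 \<epsilon> b f g1 g2 \<T> \<E> w"
  shows "same_weak_fun \<T> \<E> w u"
proof -
  have uW: "u \<in> WG" and wW: "w \<in> WG" using u w unfolding LSWG_solution_def by blast+
  \<comment> \<open>Writing the difference as a combination over Booleans makes the linearity lemmas
    applicable.\<close>
  define \<beta> where "\<beta> i = (if i then w else u)" for i
  define c where "c i = (if i then 1 else - 1 :: real)" for i
  define d where "d = wcomb UNIV c \<beta>"
  have C: "is_comb UNIV c \<beta> d" unfolding d_def by (rule wcomb_is_comb) (auto simp: \<beta>_def uW wW)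
  note CD = is_combD[OF C]
  have s: "(\<Sum>i\<in>UNIV. c i * F (\<beta> i)) = F w - F u" for F :: "'d weak_fun \<Rightarrow> real"
    by (simp add: UNIV_bool c_def \<beta>_def)
  have d0: "v0 d T x = v0 w T x - v0 u T x" if "T \<in> \<T>" for T x
    unfolding CD(4)[OF that] by (rule s)
  have db: "vb d e x = vb w e x - vb u e x" if "e \<in> \<E>" "x \<in> e" for e x
    unfolding CD(5)[OF that] by (rule s)
  have dg: "vg d e x \<bullet> nrm T e = vg w e x \<bullet> nrm T e - vg u e x \<bullet> nrm T e" if "T \<in> \<T>" "e \<in> edges T" "x \<in> e" for T e x
    unfolding CD(6)[OF that] by (rule s)
  have D: "vb d e x = 0" if "e \<in> \<E>\<^sub>1" "x \<in> e" for e x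
    using u w that E1_edge[OF that(1)] unfolding LSWG_solution_def by (simp add: db)
  have N: "vg d e x \<bullet> outward_normal (closure \<Omega>) e = 0" if e: "e \<in> \<E>\<^sub>1" "x \<in> e" for e x
  proof -
    obtain T where T: "T \<in> \<T>" "e \<in> edges T" using E_edges[OF E1_edge[OF e(1)]] by blast
    have "vg w e x \<bullet> nrm T e = vg u e x \<bullet> nrm T e"
      using u w e unfolding LSWG_solution_def boundary_normal[OF e(1) T, symmetric] by simp
    then show ?thesis using dg[OF T e(2)] boundary_normal[OF e(1) T] by simp
  qed
  have "d \<in> WG_space0 k \<Omega> \<Gamma>\<^sub>1 \<T> \<E>" unfolding WG_space0_def using CD(3) D N by blast
  then have "form w d = form u d" using u w unfolding LSWG_solution_def by simp
  then have zero: "form d d = 0"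
    unfolding LSWG_form_comb[OF C CD(3)] s[of "form d"] by (simp add: LSWG_form_commute[of d])
  have Z: "\<And>T. T \<in> \<T> \<Longrightarrow> v0 d T = (\<lambda>x. 0)" "\<And>e x. e \<in> \<E> \<Longrightarrow> x \<in> e \<Longrightarrow> vb d e x = 0"
    "\<And>T e x. T \<in> \<T> \<Longrightarrow> e \<in> edges T \<Longrightarrow> x \<in> e \<Longrightarrow> vg d e x \<bullet> nrm T e = 0"
    by (rule form_definite[OF CD(3) zero]; use D N in blast)+
  have e0: "v0 w T = v0 u T" if "T \<in> \<T>" for T
  proof
    fix x show "v0 w T x = v0 u T x" using d0[OF that, of x] Z(1)[OF that] by simp
  qed
  have ev0: "v0 w = v0 u"
    by (rule PiE_ext[of _ \<T> "\<lambda>_. poly_fun k"]) (use uW wW e0 in \<open>auto simp: WG_space_def\<close>)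
  have e1: "vb w e = vb u e" if e: "e \<in> \<E>" for e
  proof
    fix x
    have "vb w e \<in> poly_on k e" "vb u e \<in> poly_on k e" using uW wW e unfolding WG_space_def by (auto simp: PiE_iff)
    then obtain p p' where p: "vb w e = restrict p e" "vb u e = restrict p' e" unfolding poly_on_def by blast
    show "vb w e x = vb u e x" using db[OF e, of x] Z(2)[OF e, of x] by (cases "x \<in> e") (auto simp: p)
  qed
  have evb: "vb w = vb u"
    by (rule PiE_ext[of _ \<E> "\<lambda>e. poly_on k e"]) (use uW wW e1 in \<open>auto simp: WG_space_def\<close>)
  show ?thesis unfolding same_weak_fun_def using ev0 evb dg Z(3) by simp
qed

text \<open>\<open>w\<close> is a one-term combination of \<open>u\<close> with coefficient one, and
  the form respects combinations; the boundary conditions read only \<open>vb\<close> and the normal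
  part of \<open>vg\<close>.\<close>

lemma same_weak_fun_solution:
  assumes u: "LSWG_solution k \<Omega> \<Gamma>\<^sub>1 \<epsilon> b f g1 g2 \<T> \<E> u" and w: "w \<in> WG" and same: "same_weak_fun \<T> \<E> w u"
  shows "LSWG_solution k \<Omega> \<Gamma>\<^sub>1 \<epsilon> b f g1 g2 \<T> \<E> w"
proof -
  have uW: "u \<in> WG" using u unfolding LSWG_solution_def by blast
  have C: "is_comb {()} (\<lambda>_. 1) (\<lambda>_. u) w" unfolding is_comb_def
    using same w uW unfolding same_weak_fun_def by simp
  show ?thesis unfolding LSWG_solution_def
  proof (intro conjI ballI)
    show "w \<in> WG" by (rule w)
    fix e x assume e: "e \<in> \<E>\<^sub>1" "x \<in> e"
    obtain T where T: "T \<in> \<T>" "e \<in> edges T" using E_edges[OF E1_edge[OF e(1)]] by blast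
    show "vb w e x = L2_proj k e g1 x" using u e same unfolding LSWG_solution_def same_weak_fun_def by simp
    have "vg w e x \<bullet> nrm T e = vg u e x \<bullet> nrm T e" using same T e(2) unfolding same_weak_fun_def by blast
    then show "vg w e x \<bullet> outward_normal (closure \<Omega>) e = L2_proj (k - 1) e g2 x"
      using u e unfolding LSWG_solution_def boundary_normal[OF e(1) T, symmetric] by simp
  next
    fix v assume v: "v \<in> WG_space0 k \<Omega> \<Gamma>\<^sub>1 \<T> \<E>"
    then have vW: "v \<in> WG" unfolding WG_space0_def by blast
    have "form w v = form u v"
      using LSWG_form_comb[OF C vW] by (simp add: LSWG_form_commute[of v])
    then show "form w v = (\<Sum>T\<in>\<T>. \<integral>x. f x * weak_operator k \<epsilon> b \<E> v T x \<partial>lebesgue_on T)"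
      using u v unfolding LSWG_solution_def by simp
  qed
qed

end

text \<open>Tangential parts of \<open>vg\<close> are invisible to the scheme, so uniqueness is
  meant modulo \<open>same_weak_fun\<close>; the equivalence adds that every such change of a
  solution is again a solution.\<close>

theorem lemma4p2:
  fixes \<Omega> \<Gamma>\<^sub>1 \<Gamma>\<^sub>2 :: "(real^'d) set"
    and \<epsilon> :: real and b :: "real^'d \<Rightarrow> real^'d"
    and f g\<^sub>1 g\<^sub>2 :: "real^'d \<Rightarrow> real"
    and \<T> \<E> :: "(real^'d) set set"
    and k N :: nat
    and \<rho>\<^sub>v \<rho>\<^sub>e \<kappa> \<sigma> \<theta> \<gamma> \<rho>\<^sub>s :: real
  assumes dim: "CARD('d) = 2 \<or> CARD('d) = 3"
    and domain: "\<Omega> \<noteq> {}" "open \<Omega>" "bounded \<Omega>" "convex \<Omega>" "polytope (closure \<Omega>)"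
    and boundary: "openin (top_of_set (frontier \<Omega>)) \<Gamma>\<^sub>1" "openin (top_of_set (frontier \<Omega>)) \<Gamma>\<^sub>2"
      "\<Gamma>\<^sub>1 \<inter> \<Gamma>\<^sub>2 = {}" "frontier \<Omega> = closure \<Gamma>\<^sub>1 \<union> closure \<Gamma>\<^sub>2" "surface_area \<Omega> \<Gamma>\<^sub>1 > 0"
    and coefficients: "\<epsilon> > 0" "Linf_vec (lebesgue_on \<Omega>) b"
    and data: "L2_fun (lebesgue_on \<Omega>) f"
      "\<And>F. F facet_of closure \<Omega> \<Longrightarrow> L2_fun (flat_measure (\<Gamma>\<^sub>1 \<inter> F)) g\<^sub>1"
      "\<And>F. F facet_of closure \<Omega> \<Longrightarrow> L2_fun (flat_measure (\<Gamma>\<^sub>1 \<inter> F)) g\<^sub>2"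
    and mesh: "polytopal_mesh \<Omega> \<T> \<E>" "mesh_resolves_boundary \<Omega> \<Gamma>\<^sub>1 \<Gamma>\<^sub>2 \<E>"
      "shape_regular \<rho>\<^sub>v \<rho>\<^sub>e \<kappa> \<sigma> \<theta> \<gamma> \<rho>\<^sub>s N \<T> \<E>"
    and degree: "k \<ge> 1"
    and continuous_problem: "cauchy_uniquely_solvable \<Omega> \<Gamma>\<^sub>1 \<epsilon> b f g\<^sub>1 g\<^sub>2"
  shows "\<exists>u. LSWG_solution k \<Omega> \<Gamma>\<^sub>1 \<epsilon> b f g\<^sub>1 g\<^sub>2 \<T> \<E> u \<and>
           (\<forall>w. LSWG_solution k \<Omega> \<Gamma>\<^sub>1 \<epsilon> b f g\<^sub>1 g\<^sub>2 \<T> \<E> w \<longleftrightarrow>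
                  w \<in> WG_space k \<T> \<E> \<and> same_weak_fun \<T> \<E> w u)"
proof -
  have f: "L2_fun (lebesgue_on \<Omega>) f" and g: "\<And>F. F facet_of closure \<Omega> \<Longrightarrow> L2_fun (flat_measure (\<Gamma>\<^sub>1 \<inter> F)) g\<^sub>1"
    "\<And>F. F facet_of closure \<Omega> \<Longrightarrow> L2_fun (flat_measure (\<Gamma>\<^sub>1 \<inter> F)) g\<^sub>2" by (rule data; assumption?)+
  interpret lswg_problem \<Omega> \<T> \<E> k \<epsilon> b \<Gamma>\<^sub>1 \<Gamma>\<^sub>2
    by unfold_locales (use domain boundary coefficients mesh in blast)+
  obtain u where u: "LSWG_solution k \<Omega> \<Gamma>\<^sub>1 \<epsilon> b f g\<^sub>1 g\<^sub>2 \<T> \<E> u"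
    using solution_exists[OF f g] by blast
  show ?thesis
  proof (intro exI[of _ u] conjI allI iffI)
    show "LSWG_solution k \<Omega> \<Gamma>\<^sub>1 \<epsilon> b f g\<^sub>1 g\<^sub>2 \<T> \<E> u" by (rule u)
    fix w
    {
      assume w: "LSWG_solution k \<Omega> \<Gamma>\<^sub>1 \<epsilon> b f g\<^sub>1 g\<^sub>2 \<T> \<E> w"
      then show "w \<in> WG_space k \<T> \<E>" by (simp add: LSWG_solution_def)
      show "same_weak_fun \<T> \<E> w u" by (rule solution_unique[OF u w])
    }
    assume "w \<in> WG_space k \<T> \<E> \<and> same_weak_fun \<T> \<E> w u"
    then show "LSWG_solution k \<Omega> \<Gamma>\<^sub>1 \<epsilon> b f g\<^sub>1 g\<^sub>2 \<T> \<E> w"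
      using same_weak_fun_solution[OF u] by blast
  qed
qed

end
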